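(* Let $n\geq 5$ and $k\geq 1$ be two positive integers, and let $P(z)=z^{n}+az^{n-1}+b$, where $a,b$ are complex constants with $ab\neq 0$ and $\frac{b}{a^{n}}\neq(-1)^{n}\frac{(n-1)^{n-1}}{n^{n}}$. Let $S=\{z\in\mathbb{C}: P(z)=0\}$. Let $f$ and $g$ be two non-constant meromorphic functions satisfying $E_{f^{(k)}}(S,2)=E_{g^{(k)}}(S,2)$ and $E_{f^{(k)}}(0,1)=E_{g^{(k)}}(0,1)$. Then $f^{(k)}\equiv g^{(k)}$.
   Context: Meromorphic functions are meromorphic in the whole complex plane $\mathbb{C}$; $f^{(k)}$ denotes the $k$-th derivative of $f$. Weighted sharing: let $l\in\mathbb{N}\cup\{0\}\cup\{\infty\}$. For a meromorphic function $h$ and $c\in\mathbb{C}\cup\{\infty\}$, $E_{l}(c;h)$ denotes the set (multiset) of all $c$-points of $h$, where a $c$-point of multiplicity $m$ is counted $m$ times if $m\leq l$ and $l+1$ times if $m>l$. For a set $S$ of distinct elements of $\mathbb{C}\cup\{\infty\}$, $E_{h}(S,l)=\bigcup_{c\in S}E_{l}(c;h)$. For a single value $c$, $E_{h}(c,l)$ means $E_{h}(\{c\},l)$, i.e. $E_l(c;h)$.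
   Formalization: It is additionally assumed that f^(k) and g^(k) are not both constant; without this the claim is false (n=5, k=1, a=1, b=7, f(z)=z, g(z)=2z: f'=1 and g'=2 both omit 0 and S). *)

theory Defs
  imports "HOL-Complex_Analysis.Complex_Analysis" "HOL-Library.Extended_Nat"
begin

text \<open>
  A meromorphic function on the plane is represented by the function with
  \<^term>\<open>f nicely_meromorphic_on UNIV\<close>: removable singularities are filled in and the value at
  each pole is the dummy value 0. This representative is unique, so equality and constancy of
  meromorphic functions are literal equality and constancy of representatives.
  The function \<^term>\<open>(deriv ^^ k) f\<close> has unspecified values at the poles of \<^term>\<open>f\<close>;
  \<^const>\<open>remove_sings\<close> turns it into such a representative.
\<close>

definition mero_deriv :: "nat \<Rightarrow> (complex \<Rightarrow> complex) \<Rightarrow> complex \<Rightarrow> complex" where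
  "mero_deriv k f = remove_sings ((deriv ^^ k) f)"

lemma mero_deriv_nicely_meromorphic:
  assumes "f nicely_meromorphic_on UNIV"
  shows "mero_deriv k f nicely_meromorphic_on UNIV"
  using assms unfolding mero_deriv_def nicely_meromorphic_on_def[of f]
  by (intro remove_sings_nicely_meromorphic meromorphic_on_higher_deriv) auto

text \<open>
  Multiplicity of \<^term>\<open>z\<close> as a \<^term>\<open>c\<close>-point of a meromorphic \<^term>\<open>h\<close>, for finite \<^term>\<open>c\<close>:
  it is 0 if \<^term>\<open>z\<close> is not a \<^term>\<open>c\<close>-point. At a pole the order is negative and \<^const>\<open>nat\<close>
  sends it to 0. If \<^term>\<open>h\<close> is identically \<^term>\<open>c\<close> near \<^term>\<open>z\<close>, where \<^const>\<open>zorder\<close> is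
  not meaningful, the multiplicity is infinite.
\<close>

definition point_mult :: "complex \<Rightarrow> (complex \<Rightarrow> complex) \<Rightarrow> complex \<Rightarrow> enat" where
  "point_mult c h z =
     (if \<forall>\<^sub>F w in at z. h w = c then \<infinity> else enat (nat (zorder (\<lambda>w. h w - c) z)))"

text \<open>
  The multisets of weighted points may have infinite support, so they are given by their
  counting functions.
\<close>

definition weighted_points :: "enat \<Rightarrow> complex \<Rightarrow> (complex \<Rightarrow> complex) \<Rightarrow> complex \<Rightarrow> enat" where
  "weighted_points l c h z = (let m = point_mult c h z in if m \<le> l then m else l + 1)"

text \<open>
  Union of multisets is the pointwise supremum; since a point is a \<^term>\<open>c\<close>-point for at most one
  \<^term>\<open>c\<close>, this is the same as the sum of the multisets.
\<close>

definition weighted_preimage ::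
    "(complex \<Rightarrow> complex) \<Rightarrow> complex set \<Rightarrow> enat \<Rightarrow> complex \<Rightarrow> enat" where
  "weighted_preimage h S l z = (SUP c\<in>S. weighted_points l c h z)"

end

theory Submission
  imports Defs "HOL-Real_Asymp.Real_Asymp"
begin

text \<open>
  The proof is Nevanlinna theory for \<open>F = u\<^sup>n\<^sup>-\<^sup>1 (u + a)\<close> and \<open>G = v\<^sup>n\<^sup>-\<^sup>1 (v + a)\<close>, where \<open>u\<close> and \<open>v\<close> are
  the two derivatives; all their poles are multiple, and \<open>F\<close>, \<open>G\<close> share the value \<open>-b\<close> with weight 2.
  Let \<open>f = 1 / (F + b)\<close>, \<open>g = 1 / (G + b)\<close>, and let \<open>H\<close> and \<open>\<phi>\<close> be the logarithmic derivatives of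
  \<open>f' / g'\<close> and \<open>(F + b) / (G + b)\<close>. Common simple \<open>-b\<close>-points of \<open>F\<close> and \<open>G\<close> are zeros of \<open>H\<close>, and common
  zeros of \<open>u\<close> and \<open>v\<close> are zeros of \<open>\<phi>\<close> of high order. If neither function vanishes identically,
  counting these zeros in the second main theorem for \<open>F\<close> and \<open>G\<close> contradicts \<open>n \<ge> 5\<close>. Otherwise
  \<open>f = A g + C\<close> with constants \<open>A\<close> and \<open>C\<close>, and the second main theorem excludes every relation except \<open>F = G\<close>.
  In that case \<open>h = u / v\<close> has neither zeros nor poles, and \<open>v (h\<^sup>n - 1) = -a (h\<^sup>n\<^sup>-\<^sup>1 - 1)\<close> forces it to take
  an \<open>n\<close>-th root of unity other than 1 with multiplicity at least 2 everywhere, unless \<open>h = 1\<close>.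

  The circle means are only formed on radii outside a countable set, so that no integrand is ever
  singular. The bound for the logarithmic derivative is scale invariant, hence rational functions
  need no separate treatment.
\<close>

section \<open>Means over circles\<close>

text \<open>For \<open>n = 5\<close> the balance is so tight that it dictates the auxiliary
  functions. The second main theorem charges one unit for each zero of \<open>u\<close> and
  \<open>v\<close>, each \<open>-b\<close>-point and each pole. \<open>H\<close> refunds the common
  simple \<open>-b\<close>-points, but nothing for the zeros. At a common simple zero
  \<open>\<phi>\<close> has order at least \<open>n - 2\<close>, so adding it with weight
  \<open>2 / (n - 2)\<close> refunds these as well. Both functions may be added freely, because the
  zeros of a logarithmic derivative outnumber its poles by at most an error term. Their own poles,
  which occur where local orders differ, have to be paid for; at poles of \<open>u\<close> and
  \<open>v\<close> this is possible because a derivative has no simple poles. What is left for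
  \<open>n = 5\<close> is a comparison of 50/21 with 49/21. Exceptional sets of radii would obstruct
  the chaining of estimates. Since a contradiction needs only radii with arbitrarily large
  characteristic, all inequalities of an argument are asserted on one set of radii, to the right of
  which the characteristic at most doubles on a short window.\<close>

definition cmean :: "real \<Rightarrow> (complex \<Rightarrow> 'a::banach) \<Rightarrow> 'a" where
  "cmean r \<phi> = integral {0..1} (\<lambda>t. \<phi> (circlepath 0 r t))"

lemma circlepath_in_sphere: "r \<ge> 0 \<Longrightarrow> circlepath 0 r t \<in> sphere 0 r"
  by (simp add: circlepath norm_mult)

lemma norm_circlepath: "r \<ge> 0 \<Longrightarrow> norm (circlepath 0 r t) = r"
  using circlepath_in_sphere[of r t] by simp

lemma continuous_on_circlepath_compose:
  assumes "continuous_on (sphere 0 r) \<phi>" "r \<ge> 0"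
  shows   "continuous_on A (\<lambda>t. \<phi> (circlepath 0 r t))"
  by (rule continuous_on_compose2[OF assms(1)])
     (use circlepath_in_sphere[OF assms(2)] in \<open>auto simp: circlepath intro!: continuous_intros\<close>)

lemma cmean_integrable:
  fixes \<phi> :: "complex \<Rightarrow> 'a::banach"
  assumes "continuous_on (sphere 0 r) \<phi>" "r \<ge> 0"
  shows   "(\<lambda>t. \<phi> (circlepath 0 r t)) integrable_on {0..1}"
  by (rule integrable_continuous_real, rule continuous_on_circlepath_compose) (fact assms)+

lemma cmean_cong:
  assumes "r \<ge> 0" "\<And>z. norm z = r \<Longrightarrow> \<phi> z = \<psi> z"
  shows   "cmean r \<phi> = cmean r \<psi>"
  unfolding cmean_def using norm_circlepath[OF assms(1)] assms(2) by (intro integral_cong) auto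

lemma cmean_const [simp]: "cmean r (\<lambda>_. c) = c"
  by (simp add: cmean_def)

lemma cmean_add:
  assumes "r \<ge> 0" "continuous_on (sphere 0 r) \<phi>" "continuous_on (sphere 0 r) \<psi>"
  shows   "cmean r (\<lambda>z. \<phi> z + \<psi> z) = cmean r \<phi> + cmean r \<psi>"
  unfolding cmean_def by (intro integral_add cmean_integrable assms)

lemma cmean_diff:
  assumes "r \<ge> 0" "continuous_on (sphere 0 r) \<phi>" "continuous_on (sphere 0 r) \<psi>"
  shows   "cmean r (\<lambda>z. \<phi> z - \<psi> z) = cmean r \<phi> - cmean r \<psi>"
  unfolding cmean_def by (intro integral_diff cmean_integrable assms)

lemma cmean_cmul: "cmean r (\<lambda>z. c * \<phi> z) = c * cmean r (\<phi> :: complex \<Rightarrow> real)"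
  by (simp add: cmean_def)

lemma cmean_sum:
  assumes "finite A" "r \<ge> 0" "\<And>a. a \<in> A \<Longrightarrow> continuous_on (sphere 0 r) (\<phi> a)"
  shows   "cmean r (\<lambda>z. \<Sum>a\<in>A. \<phi> a z) = (\<Sum>a\<in>A. cmean r (\<phi> a))"
  unfolding cmean_def by (intro integral_sum cmean_integrable assms)

lemma cmean_mono:
  fixes \<phi> \<psi> :: "complex \<Rightarrow> real"
  assumes "r \<ge> 0" "continuous_on (sphere 0 r) \<phi>" "continuous_on (sphere 0 r) \<psi>"
          "\<And>z. norm z = r \<Longrightarrow> \<phi> z \<le> \<psi> z"
  shows   "cmean r \<phi> \<le> cmean r \<psi>"
  unfolding cmean_def by (intro integral_le cmean_integrable assms) (use norm_circlepath assms in auto)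

lemma cmean_ge:
  fixes \<phi> :: "complex \<Rightarrow> real"
  assumes "r \<ge> 0" "continuous_on (sphere 0 r) \<phi>" "\<And>z. norm z = r \<Longrightarrow> c \<le> \<phi> z"
  shows   "c \<le> cmean r \<phi>"
  using cmean_mono[OF assms(1) _ assms(2), of "\<lambda>_. c"] assms(3) by simp

lemma norm_cmean_le:
  assumes "r \<ge> 0" "continuous_on (sphere 0 r) \<phi>" "continuous_on (sphere 0 r) \<psi>"
          "\<And>z. norm z = r \<Longrightarrow> norm (\<phi> z) \<le> \<psi> z"
  shows   "norm (cmean r \<phi>) \<le> cmean r \<psi>"
  unfolding cmean_def
  by (intro integral_norm_bound_integral cmean_integrable assms) (use norm_circlepath assms in auto)

lemma Re_cmean:
  assumes "r \<ge> 0" "continuous_on (sphere 0 r) \<phi>"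
  shows   "Re (cmean r \<phi>) = cmean r (\<lambda>z. Re (\<phi> z))"
  using integral_linear[OF cmean_integrable[OF assms(2,1)] bounded_linear_Re]
  by (simp add: cmean_def o_def)

lemma cnj_cmean:
  assumes "r \<ge> 0" "continuous_on (sphere 0 r) \<phi>"
  shows   "cnj (cmean r \<phi>) = cmean r (\<lambda>z. cnj (\<phi> z))"
  using integral_linear[OF cmean_integrable[OF assms(2,1)] bounded_linear_cnj]
  by (simp add: cmean_def o_def)

text \<open>Rotation shifts the parameter by the fractional part of \<open>s / (2*pi)\<close>; by
  periodicity the overhang past 1 can be moved back to the start of the interval.\<close>

lemma cmean_rotate:
  fixes \<phi> :: "complex \<Rightarrow> 'a::banach"
  assumes "r \<ge> 0" "continuous_on (sphere 0 r) \<phi>"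
  shows   "cmean r (\<lambda>z. \<phi> (cis s * z)) = cmean r \<phi>"
proof -
  define p where "p = (\<lambda>t. \<phi> (circlepath 0 r t))"
  have per: "p (t + 1) = p t" for t
    by (simp add: p_def circlepath_add1)
  have cont: "continuous_on A p" for A
    unfolding p_def by (rule continuous_on_circlepath_compose[OF assms(2,1)])
  have main: "integral {0..1} (\<lambda>t. p (t + d)) = integral {0..1} p" if "0 \<le> d" "d \<le> 1" for d
  proof -
    have "integral {0..1} (\<lambda>t. p (t + d)) = integral {d..1+d} p"
      using integral_shift_Icc_real[of 0 1 p d] by (simp add: o_def add_ac)
    also have "\<dots> = integral {d..1} p + integral {1..1+d} p"
      using that by (intro Henstock_Kurzweil_Integration.integral_combine[symmetric] integrable_continuous_real cont) auto
    also have "integral {1..1+d} p = integral {0..d} (\<lambda>t. p (t + 1))"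
      using integral_shift_Icc_real[of 0 d p 1] by (simp add: o_def add_ac)
    also have "\<dots> = integral {0..d} p"
      by (simp add: per)
    also have "integral {d..1} p + integral {0..d} p = integral {0..1} p"
      using that by (subst add.commute)
        (intro Henstock_Kurzweil_Integration.integral_combine integrable_continuous_real cont; auto)
    finally show ?thesis .
  qed
  define d where "d = frac (s / (2*pi))"
  have d: "0 \<le> d" "d \<le> 1"
    by (auto simp: d_def intro: less_imp_le frac_lt_1)
  have "cis s = cis (2 * pi * d)"
  proof -
    have "s = 2 * pi * d + 2 * pi * of_int \<lfloor>s / (2*pi)\<rfloor>"
      by (simp add: d_def frac_def field_simps)
    hence "cis s = cis (2 * pi * d) * cis (2 * pi * of_int \<lfloor>s / (2*pi)\<rfloor>)"
      by (metis cis_mult)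
    thus ?thesis by simp
  qed
  hence "cis s * circlepath 0 r t = circlepath 0 r (t + d)" for t
    by (simp add: circlepath cis_conv_exp mult_ac ring_distribs add.commute flip: exp_add)
  hence "cmean r (\<lambda>z. \<phi> (cis s * z)) = integral {0..1} (\<lambda>t. p (t + d))"
    by (simp add: cmean_def p_def)
  also have "\<dots> = cmean r \<phi>"
    using main[OF d] by (simp add: cmean_def p_def)
  finally show ?thesis .
qed

text \<open>On the circle \<open>dz = 2 pi i z dt\<close>, which is where the factor
  \<open>z\<close> inside the mean comes from. This turns Cauchy's formulas into statements about
  means.\<close>

lemma has_contour_integral_circlepath_imp_cmean:
  assumes "(f has_contour_integral I) (circlepath 0 r)"
  shows   "cmean r (\<lambda>z. f z * z) = I / (2 * pi * \<i>)"
proof -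
  have "((\<lambda>t. f (circlepath 0 r t) * vector_derivative (circlepath 0 r) (at t within {0..1})) has_integral I) {0..1}"
    using assms by (simp add: has_contour_integral_def)
  also have "?this \<longleftrightarrow> ((\<lambda>t. (2 * pi * \<i>) * (f (circlepath 0 r t) * circlepath 0 r t)) has_integral I) {0..1}"
    by (intro has_integral_cong, subst vector_derivative_circlepath01) (auto simp: circlepath)
  finally have "((\<lambda>t. (2 * pi * \<i>) * (f (circlepath 0 r t) * circlepath 0 r t) / (2 * pi * \<i>)) has_integral I / (2 * pi * \<i>)) {0..1}"
    by (rule has_integral_divide)
  hence "((\<lambda>t. (f (circlepath 0 r t) * circlepath 0 r t)) has_integral I / (2 * pi * \<i>)) {0..1}"
    by simp
  thus ?thesis
    by (simp add: cmean_def integral_unique)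
qed

lemma cmean_holomorphic:
  assumes "f holomorphic_on ball 0 R" "0 < r" "r < R"
  shows   "cmean r f = f 0"
proof -
  have "f holomorphic_on cball 0 r"
    by (rule holomorphic_on_subset[OF assms(1)]) (use assms in auto)
  from Cauchy_integral_circlepath_simple[OF this, of 0]
  have "((\<lambda>u. f u / (u - 0)) has_contour_integral 2 * of_real pi * \<i> * f 0) (circlepath 0 r)"
    using assms by simp
  from has_contour_integral_circlepath_imp_cmean[OF this]
  have "cmean r (\<lambda>z. f z / z * z) = f 0"
    by simp
  also have "cmean r (\<lambda>z. f z / z * z) = cmean r f"
    using assms by (intro cmean_cong) auto
  finally show ?thesis .
qed

section \<open>Means of logarithms of moduli\<close>

lemma holomorphic_log_ball:
  assumes "f holomorphic_on ball 0 R" "\<And>z. norm z < R \<Longrightarrow> f z \<noteq> 0"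
  obtains g where "g holomorphic_on ball 0 R" "\<And>z. norm z < R \<Longrightarrow> f z = exp (g z)"
proof (cases "R > 0")
  case True
  show thesis
    by (rule holomorphic_logarithm_exists[of "ball 0 R" f 0]) (use assms True in \<open>auto intro!: that[OF _ sym]\<close>)
next
  case False
  show thesis
  proof (rule that[of "\<lambda>_. 0"])
    fix z :: complex assume "norm z < R"
    thus "f z = exp 0" using False norm_ge_zero[of z] by linarith
  qed auto
qed

lemma cmean_ln_norm_nonzero:
  assumes "f holomorphic_on ball 0 R" "\<And>z. norm z < R \<Longrightarrow> f z \<noteq> 0" "0 < r" "r < R"
  shows   "cmean r (\<lambda>z. ln (norm (f z))) = ln (norm (f 0))"
proof -
  obtain g where g: "g holomorphic_on ball 0 R" "\<And>z. norm z < R \<Longrightarrow> f z = exp (g z)"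
    using holomorphic_log_ball[OF assms(1,2)] by blast
  have cont: "continuous_on (sphere 0 r) g"
    by (rule continuous_on_subset[OF holomorphic_on_imp_continuous_on[OF g(1)]]) (use assms in auto)
  have "cmean r (\<lambda>z. ln (norm (f z))) = cmean r (\<lambda>z. Re (g z))"
    using assms by (intro cmean_cong) (auto simp: g(2))
  also have "\<dots> = Re (g 0)"
    using assms cont by (simp add: Re_cmean [symmetric] cmean_holomorphic[OF g(1)])
  also have "\<dots> = ln (norm (f 0))"
    using assms by (simp add: g(2))
  finally show ?thesis .
qed

text \<open>For \<open>a\<close> inside the circle, \<open>z - a\<close> is replaced by
  \<open>r - cnj a * z / r\<close>. It has the same modulus on the circle, but its only zero is the
  reflected point outside, so the mean value property applies. For \<open>a = 0\<close> there is no
  reflected point, whence the separate case.\<close>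

lemma cmean_ln_norm_linear:
  assumes "0 < r" "norm a \<noteq> r"
  shows   "cmean r (\<lambda>z. ln (norm (z - a))) = ln (max r (norm a))"
proof (cases "norm a < r")
  case False
  with assms have "norm a > r" by auto
  have "cmean r (\<lambda>z. ln (norm (z - a))) = ln (norm (0 - a))"
    by (rule cmean_ln_norm_nonzero[where R = "norm a"])
       (use assms \<open>norm a > r\<close> in \<open>auto intro!: holomorphic_intros\<close>)
  thus ?thesis using \<open>norm a > r\<close> by (simp add: max_def)
next
  case True
  show ?thesis
  proof (cases "a = 0")
    case True
    have "cmean r (\<lambda>z. ln (norm (z - a))) = cmean r (\<lambda>z. ln r)"
      by (rule cmean_cong) (use assms True in auto)
    thus ?thesis using True assms by simp
  next
    case [simp]: False
    have R: "r\<^sup>2 / norm a > r"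
      using \<open>norm a < r\<close> assms by (simp add: field_simps power2_eq_square)
    have "cmean r (\<lambda>z. ln (norm (z - a))) = cmean r (\<lambda>z. ln (norm (of_real r - cnj a * z / of_real r)))"
    proof (rule cmean_cong)
      fix z :: complex assume z: "norm z = r"
      have "norm (of_real r - cnj a * z / of_real r) = norm (of_real r - a * cnj z / of_real r)"
        using complex_mod_cnj[of "of_real r - cnj a * z / of_real r"] by simp
      also have "\<dots> * r = norm (of_real (r\<^sup>2) - a * cnj z)"
      proof -
        have "norm (of_real r - a * cnj z / of_real r) * norm (complex_of_real r)
                = norm (of_real (r\<^sup>2) - a * cnj z)"
          unfolding norm_mult[symmetric] using assms by (simp add: power2_eq_square left_diff_distrib)
        thus ?thesis using assms by simp
      qed
      also have "of_real (r\<^sup>2) = z * cnj z"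
        using z complex_norm_square[of z] by simp
      also have "norm (z * cnj z - a * cnj z) = norm (z - a) * r"
        by (simp add: z norm_mult flip: left_diff_distrib)
      finally show "ln (norm (z - a)) = ln (norm (of_real r - cnj a * z / of_real r))"
        using assms by simp
    qed (use assms in auto)
    also have "\<dots> = ln (norm (of_real r - cnj a * 0 / of_real r))"
    proof (rule cmean_ln_norm_nonzero[where R = "r\<^sup>2 / norm a"])
      fix z :: complex assume z: "norm z < r\<^sup>2 / norm a"
      hence "norm (cnj a * z / of_real r) < norm (complex_of_real r)"
        using assms by (simp add: norm_mult norm_divide field_simps power2_eq_square)
      thus "of_real r - cnj a * z / of_real r \<noteq> 0" by force
    qed (use assms R in \<open>auto intro!: holomorphic_intros\<close>)
    finally show ?thesis using assms \<open>norm a < r\<close> by (simp add: max_def)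
  qed
qed

text \<open>The derivative of the Schwarz integral: only the real part of \<open>g\<close> on the circle enters,
  because the conjugate of \<open>g\<close> contributes nothing to the Cauchy integral for \<open>g'\<close>.\<close>
lemma norm_deriv_le_cmean_Re:
  assumes g: "g holomorphic_on ball 0 R'" and R: "0 < R" "R < R'" and z: "norm z \<le> r" "r < R"
  shows   "norm (deriv g z) \<le> 2 * R / (R - r)\<^sup>2 * cmean R (\<lambda>w. \<bar>Re (g w)\<bar>)"
proof -
  have contg: "continuous_on (sphere 0 R) g"
    by (rule continuous_on_subset[OF holomorphic_on_imp_continuous_on[OF g]]) (use R in auto)
  have nz: "w - z \<noteq> 0" if "norm w = R" for w
    using that z by auto
  have holg: "g holomorphic_on cball 0 R"
    by (rule holomorphic_on_subset[OF g]) (use R in auto)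
  have "((\<lambda>u. g u / (u - z) ^ Suc 1) has_contour_integral (2 * pi * \<i>) / fact 1 * (deriv ^^ 1) g z) (circlepath 0 R)"
    by (rule Cauchy_has_contour_integral_higher_derivative_circlepath)
       (use holg z R in \<open>auto intro: holomorphic_on_imp_continuous_on holomorphic_on_subset\<close>)
  from has_contour_integral_circlepath_imp_cmean[OF this]
  have 1: "cmean R (\<lambda>w. g w / (w - z)\<^sup>2 * w) = deriv g z"
    by (simp add: numeral_2_eq_2)
  have nz2: "of_real (R\<^sup>2) - cnj z * w \<noteq> 0" if "norm w < R\<^sup>2 / r'" "norm z \<le> r'" "r' > 0" for w r'
  proof -
    have "norm (cnj z * w) \<le> r' * norm w"
      using that by (simp add: norm_mult mult_right_mono)
    also have "\<dots> < R\<^sup>2" using that by (simp add: field_simps)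
    finally have "norm (cnj z * w) < norm (complex_of_real (R\<^sup>2))"
      by (simp add: norm_power)
    thus ?thesis by force
  qed
  \<comment> \<open>A positive bound for \<open>norm z\<close> strictly below \<open>R\<close>: the
    zeros of \<open>R^2 - cnj z * w\<close> then stay outside a disc of radius
    \<open>R^2 / r' > R\<close>, also when \<open>z = 0\<close>.\<close>
  define r' where "r' = (r + R) / 2"
  have r': "r' > 0" "norm z \<le> r'" "r' < R"
    using z R order_trans[OF norm_ge_zero[of z] z(1)] unfolding r'_def by auto
  have R2: "R < R\<^sup>2 / r'" using r' R by (simp add: field_simps power2_eq_square)
  have nz3: "of_real (R\<^sup>2) - cnj z * w \<noteq> 0" if "norm w < R\<^sup>2 / r'" for w
    by (rule nz2[OF that r'(2,1)])
  define R2 where "R2 = min R' (R\<^sup>2 / r')"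
  \<comment> \<open>On the circle \<open>R^2 = w * cnj w\<close>, so the conjugate of this integrand
    is \<open>cnj (g w) / (w - z)^2 * w\<close>. The integrand itself is holomorphic and vanishes at
    the origin, hence has mean 0.\<close>
  have "cmean R (\<lambda>w. g w * (of_real (R\<^sup>2) * w / (of_real (R\<^sup>2) - cnj z * w)\<^sup>2)) =
        g 0 * (of_real (R\<^sup>2) * 0 / (of_real (R\<^sup>2) - cnj z * 0)\<^sup>2)"
    by (rule cmean_holomorphic[where R = R2 and f = "\<lambda>w. g w * (of_real (R\<^sup>2) * w / (of_real (R\<^sup>2) - cnj z * w)\<^sup>2)"])
       (use R R2 nz3 in \<open>simp_all add: R2_def del: of_real_power, intro holomorphic_intros holomorphic_on_subset[OF g], auto simp del: of_real_power\<close>)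
  also have "\<dots> = 0"
    by simp
  finally have 2: "cmean R (\<lambda>w. g w * (of_real (R\<^sup>2) * w / (of_real (R\<^sup>2) - cnj z * w)\<^sup>2)) = 0" .
  have "0 = cnj (cmean R (\<lambda>w. g w * (of_real (R\<^sup>2) * w / (of_real (R\<^sup>2) - cnj z * w)\<^sup>2)))"
    unfolding 2 by simp
  also have "\<dots> = cmean R (\<lambda>w. cnj (g w * (of_real (R\<^sup>2) * w / (of_real (R\<^sup>2) - cnj z * w)\<^sup>2)))"
  proof (rule cnj_cmean)
    show "continuous_on (sphere 0 R) (\<lambda>w. g w * (of_real (R\<^sup>2) * w / (of_real (R\<^sup>2) - cnj z * w)\<^sup>2))"
      using nz3 R2 by (intro continuous_intros contg) (auto simp del: of_real_power)
  qed (use R in auto)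
  also have "\<dots> = cmean R (\<lambda>w. cnj (g w) / (w - z)\<^sup>2 * w)"
  proof (rule cmean_cong)
    fix w :: complex assume w: "norm w = R"
    have [simp]: "w \<noteq> 0" using w R by auto
    have *: "of_real (R\<^sup>2) = w * cnj w"
      using w complex_norm_square[of w] by simp
    have "cnj (g w * (of_real (R\<^sup>2) * w / (of_real (R\<^sup>2) - cnj z * w)\<^sup>2)) =
          cnj (g w) * (w * cnj w * cnj w / (w * cnj w - z * cnj w)\<^sup>2)"
      unfolding * by (simp add: mult_ac)
    also have "(w * cnj w - z * cnj w)\<^sup>2 = (w - z)\<^sup>2 * (cnj w * cnj w)"
      by (simp add: power2_eq_square algebra_simps)
    also have "cnj (g w) * (w * cnj w * cnj w / ((w - z)\<^sup>2 * (cnj w * cnj w))) = cnj (g w) / (w - z)\<^sup>2 * w"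
      using nz[OF w] by (simp add: field_simps)
    finally show "cnj (g w * (of_real (R\<^sup>2) * w / (of_real (R\<^sup>2) - cnj z * w)\<^sup>2)) = cnj (g w) / (w - z)\<^sup>2 * w" .
  qed (use R in auto)
  finally have "deriv g z = cmean R (\<lambda>w. g w / (w - z)\<^sup>2 * w) + cmean R (\<lambda>w. cnj (g w) / (w - z)\<^sup>2 * w)"
    using 1 by simp
  also have "\<dots> = cmean R (\<lambda>w. g w / (w - z)\<^sup>2 * w + cnj (g w) / (w - z)\<^sup>2 * w)"
    using R nz by (intro cmean_add [symmetric] continuous_intros contg) auto
  finally have "norm (deriv g z) = norm (cmean R (\<lambda>w. g w / (w - z)\<^sup>2 * w + cnj (g w) / (w - z)\<^sup>2 * w))"
    by simp
  also have "\<dots> \<le> cmean R (\<lambda>w. 2 * R / (R - r)\<^sup>2 * \<bar>Re (g w)\<bar>)"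
  proof (rule norm_cmean_le)
    fix w :: complex assume w: "norm w = R"
    have "R - r \<le> norm w - norm z" using w z by simp
    also have "\<dots> \<le> norm (w - z)" by (rule norm_triangle_ineq2)
    finally have "R - r \<le> norm (w - z)" .
    hence le: "(R - r)\<^sup>2 \<le> norm (w - z) ^ 2"
      using z by (intro power_mono) auto
    have "g w / (w - z)\<^sup>2 * w + cnj (g w) / (w - z)\<^sup>2 * w = of_real (2 * Re (g w)) * w / (w - z)\<^sup>2"
      unfolding complex_add_cnj[symmetric] by (simp add: add_divide_distrib algebra_simps)
    also have "norm \<dots> = 2 * \<bar>Re (g w)\<bar> * R / norm (w - z) ^ 2"
      by (simp only: norm_mult norm_divide norm_power norm_of_real abs_mult w abs_numeral)
    also have "\<dots> \<le> 2 * \<bar>Re (g w)\<bar> * R / (R - r)\<^sup>2"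
      using le z R by (intro divide_left_mono mult_nonneg_nonneg) (auto intro!: mult_pos_pos zero_less_power simp: nz[OF w])
    finally show "norm (g w / (w - z)\<^sup>2 * w + cnj (g w) / (w - z)\<^sup>2 * w) \<le> 2 * R / (R - r)\<^sup>2 * \<bar>Re (g w)\<bar>"
      by (simp add: mult_ac)
  qed (use R z nz in \<open>auto intro!: continuous_intros contg\<close>)
  also have "\<dots> = 2 * R / (R - r)\<^sup>2 * cmean R (\<lambda>w. \<bar>Re (g w)\<bar>)"
    by (rule cmean_cmul)
  finally show ?thesis .
qed

text \<open>The bound is free of \<open>s\<close> because it only uses the distance to the
  nonnegative real axis: in the right half plane this is the imaginary part, where concavity puts
  the sine above its chord, and in the left half plane the distance is at least
  \<open>r\<close>.\<close>

lemma norm_circlepath_diff_ge: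
  assumes "r > 0" "s \<ge> 0" "\<bar>t\<bar> \<le> 1 / 2"
  shows   "norm (circlepath 0 r t - of_real s) \<ge> 2 * r * \<bar>t\<bar>"
proof -
  define \<theta> where "\<theta> = 2 * pi * t"
  have eq: "circlepath 0 r t = of_real r * cis \<theta>"
    by (simp add: circlepath \<theta>_def cis_conv_exp mult_ac)
  show ?thesis
  proof (cases "\<bar>t\<bar> \<le> 1 / 4")
    case True
    define x where "x = \<bar>\<theta>\<bar>"
    have x: "0 \<le> x" "x \<le> pi / 2"
      using True by (auto simp: x_def \<theta>_def abs_mult)
    have "convex_on {0..pi} (\<lambda>x. - sin x)"
      by (rule convex_on_realI[where f' = "\<lambda>x. - cos x"])
         (auto intro!: derivative_eq_intros simp: cos_mono_le_eq)
    hence "- sin ((1 - 2 * x / pi) *\<^sub>R 0 + (2 * x / pi) *\<^sub>R (pi / 2))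
             \<le> (1 - 2 * x / pi) * (- sin 0) + (2 * x / pi) * (- sin (pi / 2))"
      by (rule convex_onD) (use x in \<open>auto simp: field_simps\<close>)
    hence "sin x \<ge> 2 * x / pi" by simp
    hence "2 * r * \<bar>t\<bar> \<le> r * sin x"
      using \<open>r > 0\<close> by (simp add: x_def \<theta>_def abs_mult)
    also have "\<dots> \<le> \<bar>Im (circlepath 0 r t - of_real s)\<bar>"
    proof -
      have "sin x \<ge> 0" using x by (intro sin_ge_zero) auto
      hence "sin x = \<bar>sin \<theta>\<bar>" by (auto simp: x_def abs_if split: if_splits)
      thus ?thesis using \<open>r > 0\<close> by (simp add: eq abs_mult)
    qed
    also have "\<dots> \<le> norm (circlepath 0 r t - of_real s)"
      by (rule abs_Im_le_cmod)
    finally show ?thesis .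
  next
    case False
    have "cos \<theta> = cos \<bar>\<theta>\<bar>" by (simp add: abs_if)
    also have "\<dots> \<le> cos (pi / 2)"
      using False assms by (intro cos_monotone_0_pi_le) (auto simp: \<theta>_def abs_mult)
    finally have cos: "cos \<theta> \<le> 0" by simp
    have "(2 * r * \<bar>t\<bar>)\<^sup>2 \<le> r\<^sup>2"
      using assms by (intro power_mono) (auto simp: mult_le_cancel_left1)
    also have "\<dots> \<le> r\<^sup>2 + s\<^sup>2 - 2 * r * s * cos \<theta>"
    proof -
      have "2 * r * s * cos \<theta> \<le> 0"
        using cos assms by (intro mult_nonneg_nonpos) auto
      thus ?thesis using zero_le_power2[of s] by linarith
    qed
    also have "\<dots> = (norm (circlepath 0 r t - of_real s))\<^sup>2"
    proof -
      have "(norm (circlepath 0 r t - of_real s))\<^sup>2 = (r * cos \<theta> - s)\<^sup>2 + (r * sin \<theta>)\<^sup>2"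
        by (simp add: eq cmod_power2)
      also have "\<dots> = r\<^sup>2 * ((sin \<theta>)\<^sup>2 + (cos \<theta>)\<^sup>2) + s\<^sup>2 - 2 * r * s * cos \<theta>"
        by algebra
      finally show ?thesis by (simp only: sin_cos_squared_add)
    qed
    finally show ?thesis by (rule power2_le_imp_le) auto
  qed
qed

text \<open>The exponent 1/2 makes the singularity integrable, so that the bound is uniform in
  \<open>a\<close>, however close \<open>a\<close> is to the circle. After a rotation
  \<open>a\<close> is a nonnegative real, and each half circle is compared with the integral of
  \<open>1 / sqrt (2 * t)\<close>, which is 1.\<close>

lemma cmean_inverse_sqrt_le:
  assumes r: "r \<ge> 1" and a: "norm a \<noteq> r"
  shows   "cmean r (\<lambda>z. 1 / sqrt (norm (z - a))) \<le> 2"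
proof -
  have a_eq: "a = cis (Arg a) * of_real (norm a)"
    by (metis mult.commute rcis_cmod_Arg rcis_def)
  define s where "s = norm a"
  have nz: "circlepath 0 r t \<noteq> of_real s" for t
    using norm_circlepath[of r t] r a by (metis abs_of_nonneg norm_ge_zero norm_of_real s_def le_zero_eq order_trans zero_le_one)
  define q where "q = (\<lambda>t. 1 / sqrt (norm (circlepath 0 r t - of_real s)))"
  have contq: "continuous_on A q" for A
    unfolding q_def using nz by (intro continuous_intros) (auto simp: circlepath intro!: continuous_intros)
  have "cmean r (\<lambda>z. 1 / sqrt (norm (z - a))) = cmean r (\<lambda>z. 1 / sqrt (norm (cis (Arg a) * z - a)))"
    using r a by (intro cmean_rotate [symmetric] continuous_intros) auto
  also have "\<dots> = cmean r (\<lambda>z. 1 / sqrt (norm (z - of_real s)))"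
  proof -
    have "norm (cis (Arg a) * z - a) = norm (z - of_real s)" for z
    proof -
      have "cis (Arg a) * z - a = cis (Arg a) * (z - of_real s)"
        unfolding s_def right_diff_distrib by (simp flip: a_eq)
      thus ?thesis by (simp add: norm_mult)
    qed
    thus ?thesis by simp
  qed
  also have "\<dots> = integral {0..1} q"
    by (simp add: cmean_def q_def)
  also have "\<dots> = integral {0..1/2} q + integral {1/2..1} q"
    by (intro Henstock_Kurzweil_Integration.integral_combine [symmetric] integrable_continuous_real contq) auto
  also have "integral {1/2..1} q = integral {-1/2..0} (\<lambda>t. q (t + 1))"
    using integral_shift_Icc_real[of "-1/2" 0 q 1] by (simp add: o_def add.commute)
  also have "(\<lambda>t. q (t + 1)) = q"
    by (simp add: q_def circlepath_add1)
  also have "integral {-1/2..0} q = integral {0..1/2} (\<lambda>t. q (-t))"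
    using Henstock_Kurzweil_Integration.integral_reflect_real[of "1/2" 0 "\<lambda>t. q (-t)"] by simp
  finally have eq: "cmean r (\<lambda>z. 1 / sqrt (norm (z - a))) =
    integral {0..1/2} q + integral {0..1/2} (\<lambda>t. q (-t))" .
  have int: "((\<lambda>t. t powr (-1/2) / sqrt 2) has_integral 1) {0..1/2}"
  proof -
    have "((\<lambda>t. t powr (-1/2)) has_integral ((1/2) powr (-1/2+1) / (-1/2 + 1))) {0..1/2::real}"
      by (rule has_integral_powr_from_0) auto
    hence "((\<lambda>t. t powr (-1/2) / sqrt 2) has_integral ((1/2) powr (-1/2+1) / (-1/2 + 1) / sqrt 2)) {0..1/2::real}"
      by (rule has_integral_divide)
    also have "(1/2) powr (-1/2+1) / (-1/2 + 1) / sqrt 2 = (1::real)"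
      by (simp add: powr_half_sqrt real_sqrt_divide)
    finally show ?thesis .
  qed
  have le: "integral {0..1/2} (\<lambda>t. q (\<sigma> * t)) \<le> 1" if \<sigma>: "\<bar>\<sigma>\<bar> = 1" for \<sigma> :: real
  proof -
    \<comment> \<open>\<open>0 powr (-1/2)\<close> is 0 by convention and does not majorise
      \<open>q 0\<close>, so the comparison function is changed at this one point.\<close>
    have int': "((\<lambda>t. if t = 0 then q 0 else t powr (-1/2) / sqrt 2) has_integral 1) {0..1/2}"
      by (rule has_integral_spike_finite[OF _ _ int, of "{0}"]) auto
    have cont: "continuous_on {0..1/2} (\<lambda>t. q (\<sigma> * t))"
      by (rule continuous_on_compose2[OF contq[of UNIV]]) (auto intro!: continuous_intros)
    show ?thesis
    proof (rule has_integral_le[OF integrable_integral[OF integrable_continuous_real[OF cont]] int'])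
      fix t :: real assume t: "t \<in> {0..1/2}"
      show "q (\<sigma> * t) \<le> (if t = 0 then q 0 else t powr (-1/2) / sqrt 2)"
      proof (cases "t = 0")
        case False
        have "2 * t \<le> 2 * r * \<bar>\<sigma> * t\<bar>"
          using r t \<sigma> by (simp add: abs_mult mult_le_cancel_right1)
        also have "\<dots> \<le> norm (circlepath 0 r (\<sigma> * t) - of_real s)"
          by (rule norm_circlepath_diff_ge) (use r t \<sigma> in \<open>auto simp: s_def abs_mult\<close>)
        finally have "q (\<sigma> * t) \<le> 1 / sqrt (2 * t)"
          unfolding q_def using t False by (intro divide_left_mono mult_pos_pos) (auto simp: nz)
        also have "\<dots> = t powr (-1/2) / sqrt 2"
          using t False by (simp add: powr_minus powr_half_sqrt real_sqrt_mult field_simps)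
        finally show ?thesis using False by simp
      qed auto
    qed
  qed
  have "integral {0..1/2} q + integral {0..1/2} (\<lambda>t. q (-t)) \<le> 1 + 1"
    using le[of 1] le[of "-1"] by (intro add_mono) auto
  with eq show ?thesis by simp
qed

section \<open>Zeros, poles and Jensen's formula\<close>

text \<open>Excluding the zero function makes \<open>zorder\<close> and logarithms meaningful.
  Values at single points are left free, since products, quotients and derivatives formed pointwise
  need not be normalised at singularities.\<close>

definition mero :: "(complex \<Rightarrow> complex) \<Rightarrow> bool" where
  "mero h \<longleftrightarrow> h meromorphic_on UNIV \<and> (\<forall>z. \<forall>\<^sub>F w in at z. h w \<noteq> 0)"

lemma meroI:
  assumes "h meromorphic_on UNIV" "\<not>(\<forall>\<^sub>\<approx>z\<in>UNIV. h z = 0)"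
  shows   "mero h"
  using meromorphic_imp_constant_or_avoid[OF assms(1), of 0] assms
  by (auto simp: mero_def eventually_cosparse_open_eq)

lemma meroI':
  assumes "h meromorphic_on UNIV" "h analytic_on {z}" "h z \<noteq> 0"
  shows   "mero h"
proof (rule meroI)
  show "\<not>(\<forall>\<^sub>\<approx>z\<in>UNIV. h z = 0)"
  proof
    assume "\<forall>\<^sub>\<approx>z\<in>UNIV. h z = 0"
    hence "eventually (\<lambda>w. h w = 0) (at z)"
      by (auto simp: eventually_cosparse_open_eq)
    moreover have "eventually (\<lambda>w. h w \<noteq> 0) (at z)"
      using assms(2,3) non_zero_neighbour_alt by (simp add: analytic_at_neq_imp_eventually_neq)
    ultimately have "eventually (\<lambda>_. False) (at z)"
      by eventually_elim auto
    thus False by simp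
  qed
qed fact

lemma mero_meromorphic: "mero h \<Longrightarrow> h meromorphic_on A"
  by (auto simp: mero_def intro: meromorphic_on_subset)

lemma mero_eventually: "mero h \<Longrightarrow> \<forall>\<^sub>F w in at z. h w \<noteq> 0"
  by (auto simp: mero_def)

lemma mero_frequently: "mero h \<Longrightarrow> \<exists>\<^sub>F w in at z. h w \<noteq> 0"
  using mero_eventually[of h z] by (simp add: eventually_frequently)

lemma mero_const [intro]: "c \<noteq> 0 \<Longrightarrow> mero (\<lambda>_. c)"
  by (auto simp: mero_def intro!: meromorphic_intros)

lemma mero_mult: "mero f \<Longrightarrow> mero g \<Longrightarrow> mero (\<lambda>z. f z * g z)"
  unfolding mero_def by (auto intro!: meromorphic_intros intro: eventually_conj)

lemma mero_inverse: "mero f \<Longrightarrow> mero (\<lambda>z. inverse (f z))"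
  unfolding mero_def by (auto intro!: meromorphic_intros)

lemma mero_divide: "mero f \<Longrightarrow> mero g \<Longrightarrow> mero (\<lambda>z. f z / g z)"
  using mero_mult[OF _ mero_inverse] by (simp add: divide_inverse)

lemma mero_power:
  assumes "mero f"
  shows   "mero (\<lambda>z. f z ^ n)"
  using assms unfolding mero_def
proof (safe intro!: meromorphic_intros)
  fix z
  show "eventually (\<lambda>w. f w ^ n \<noteq> 0) (at z)"
    using mero_eventually[OF assms, of z] by eventually_elim auto
qed

lemma mero_powi:
  assumes "mero f"
  shows   "mero (\<lambda>z. f z powi n)"
  using assms unfolding mero_def
proof (safe intro!: meromorphic_intros)
  fix z
  show "eventually (\<lambda>w. f w powi n \<noteq> 0) (at z)"
    using mero_eventually[OF assms, of z] by eventually_elim auto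
qed

lemma mero_prod: "(\<And>a. a \<in> A \<Longrightarrow> mero (f a)) \<Longrightarrow> mero (\<lambda>z. \<Prod>a\<in>A. f a z)"
  by (induction A rule: infinite_finite_induct) (auto intro!: mero_mult)

lemma mero_linear: "mero (\<lambda>z. z - a)"
  by (rule meroI'[of _ "a + 1"]) (auto intro!: meromorphic_intros analytic_intros)

lemma zorder_mult_mero: "mero f \<Longrightarrow> mero g \<Longrightarrow> zorder (\<lambda>z. f z * g z) z = zorder f z + zorder g z"
  by (intro zorder_mult mero_meromorphic mero_frequently)

lemma zorder_divide_mero: "mero f \<Longrightarrow> mero g \<Longrightarrow> zorder (\<lambda>z. f z / g z) z = zorder f z - zorder g z"
  by (intro zorder_divide mero_meromorphic mero_frequently)

lemma zorder_power_mero: "mero f \<Longrightarrow> zorder (\<lambda>z. f z ^ n) z = n * zorder f z"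
  by (intro zorder_power mero_meromorphic mero_frequently)

lemma zorder_inverse_mero: "mero f \<Longrightarrow> zorder (\<lambda>z. inverse (f z)) z = - zorder f z"
  using zorder_divide_mero[of "\<lambda>_. 1" f z] by (simp add: divide_inverse mero_const)

lemma zorder_linear: "zorder (\<lambda>z. z - a) z = (if z = a then 1 else 0)"
proof (cases "z = a")
  case True
  thus ?thesis by (auto intro!: zorder_eqI[of UNIV _ "\<lambda>_. 1"])
next
  case False
  thus ?thesis by (auto intro!: zorder_eq_0I analytic_intros)
qed

lemma zorder_prod_linear:
  assumes "finite A"
  shows   "zorder (\<lambda>z. \<Prod>a\<in>A. (z - a) powi m a) z = (if z \<in> A then m z else 0)"
  using assms
proof (induction A rule: finite_induct)
  case (insert a A)
  have "zorder (\<lambda>z. (z - a) powi m a * (\<Prod>a\<in>A. (z - a) powi m a)) z =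
        zorder (\<lambda>z. (z - a) powi m a) z + zorder (\<lambda>z. \<Prod>a\<in>A. (z - a) powi m a) z"
    by (intro zorder_mult_mero mero_powi mero_linear mero_prod)
  also have "zorder (\<lambda>z. (z - a) powi m a) z = m a * zorder (\<lambda>z. z - a) z"
    by (intro zorder_power_int mero_meromorphic mero_frequently mero_linear)
  finally show ?case using insert by (auto simp: zorder_linear)
qed auto

lemma remove_sings_zorder_0:
  assumes "mero h" "zorder h z = 0"
  shows   "remove_sings h analytic_on {z}" "remove_sings h z \<noteq> 0"
proof -
  have iso: "isolated_singularity_at h z" "not_essential h z"
    using mero_meromorphic[OF assms(1), of "{z}"] by (auto simp: meromorphic_at_iff)
  have "\<not>is_pole h z"
    using isolated_pole_imp_neg_zorder[of h z] iso assms by auto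
  with iso obtain c where "h \<midarrow>z\<rightarrow> c"
    by (auto simp: not_essential_def)
  thus *: "remove_sings h analytic_on {z}"
    using iso by (intro remove_sings_analytic_at)
  have "eventually (\<lambda>w. remove_sings h w = h w) (at z)"
    using iso eventually_remove_sings_eq_at by blast
  with mero_eventually[OF assms(1), of z] have "eventually (\<lambda>w. remove_sings h w \<noteq> 0) (at z)"
    by eventually_elim auto
  hence "\<exists>\<^sub>F w in at z. remove_sings h w \<noteq> 0"
    by (simp add: eventually_frequently)
  from zorder_eq_0_iff[OF * this] show "remove_sings h z \<noteq> 0"
    using assms iso by simp
qed

lemma sparse_singular_points:
  assumes "mero h"
  shows   "{z. \<not>(h analytic_on {z} \<and> h z \<noteq> 0)} sparse_in UNIV"
proof -
  have "eventually (\<lambda>z. h analytic_on {z}) (cosparse UNIV)"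
    by (intro meromorphic_on_imp_analytic_cosparse mero_meromorphic assms)
  moreover have "eventually (\<lambda>z. h z \<noteq> 0) (cosparse UNIV)"
    using mero_eventually[OF assms] by (auto simp: eventually_cosparse_open_eq)
  ultimately have "eventually (\<lambda>z. h analytic_on {z} \<and> h z \<noteq> 0) (cosparse UNIV)"
    by eventually_elim auto
  thus ?thesis by (simp add: eventually_cosparse)
qed

lemma finite_zorder_nonzero:
  assumes "mero h"
  shows   "finite {z. norm z < r \<and> zorder h z \<noteq> 0}"
proof (rule finite_subset)
  have "{z. \<not>(h analytic_on {z} \<and> h z \<noteq> 0)} sparse_in cball 0 r"
    by (rule sparse_in_subset[OF sparse_singular_points[OF assms]]) auto
  thus "finite (cball 0 r \<inter> {z. \<not>(h analytic_on {z} \<and> h z \<noteq> 0)})"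
    by (rule sparse_in_compact_finite) auto
qed (auto intro: zorder_eq_0I)

lemma countable_singular_points:
  assumes "mero h"
  shows   "countable {z. \<not>(h analytic_on {z} \<and> h z \<noteq> 0)}"
  using sparse_imp_countable[OF _ sparse_singular_points[OF assms]] by simp

lemma eventually_analytic_nonzero:
  assumes "mero h"
  shows   "eventually (\<lambda>w. h analytic_on {w} \<and> h w \<noteq> 0) (at z)"
proof -
  have "eventually (\<lambda>w. h analytic_on {w} \<and> h w \<noteq> 0) (cosparse UNIV)"
    using sparse_singular_points[OF assms] by (simp add: eventually_cosparse)
  thus ?thesis by (simp add: eventually_cosparse_open_eq)
qed

text \<open>Dividing by the finitely many zeros and poles leaves a function without zeros on the
  closed disc once its singularities are removed. By compactness this persists on a slightly larger
  disc, where a logarithm exists. Zeros and poles on the circle itself would not be divided out, so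
  they are excluded.\<close>

lemma mero_factor:
  assumes h: "mero h" and r: "r > 0" "\<And>z. norm z = r \<Longrightarrow> zorder h z = 0"
  defines "A \<equiv> {z. norm z < r \<and> zorder h z \<noteq> 0}"
  obtains R g where "R > r" "g holomorphic_on ball 0 R"
    "\<And>z. norm z \<le> r \<Longrightarrow> h analytic_on {z} \<Longrightarrow> h z \<noteq> 0 \<Longrightarrow>
       z \<notin> A \<and> h z = exp (g z) * (\<Prod>a\<in>A. (z - a) powi zorder h a)"
proof -
  have fin: "finite A"
    unfolding A_def by (rule finite_zorder_nonzero[OF h])
  define p where "p = (\<lambda>z. \<Prod>a\<in>A. (z - a) powi zorder h a)"
  define k where "k = remove_sings (\<lambda>z. h z / p z)"
  have p: "mero p"
    unfolding p_def by (intro mero_prod mero_powi mero_linear)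
  have "zorder (\<lambda>z. h z / p z) z = 0" if "norm z \<le> r" for z
  proof -
    have "zorder (\<lambda>z. h z / p z) z = zorder h z - zorder p z"
      by (intro zorder_divide_mero h p)
    also have "zorder p z = (if z \<in> A then zorder h z else 0)"
      unfolding p_def by (rule zorder_prod_linear[OF fin])
    finally show ?thesis using that r(2)[of z] by (auto simp: A_def)
  qed
  hence k: "k analytic_on {z}" "k z \<noteq> 0" if "norm z \<le> r" for z
    using remove_sings_zorder_0[OF mero_divide[OF h p], of z] that by (auto simp: k_def)
  define U where "U = {z. k analytic_on {z} \<and> k z \<noteq> 0}"
  have "open U"
  proof (subst open_subopen, rule ballI)
    fix z assume z: "z \<in> U"
    then obtain V where V: "open V" "z \<in> V" "k holomorphic_on V"
      by (auto simp: U_def analytic_at)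
    have "open (k -` (-{0}) \<inter> V)"
      using V by (intro continuous_on_open_vimage[THEN iffD1, rule_format] holomorphic_on_imp_continuous_on) auto
    moreover have "k -` (-{0}) \<inter> V \<subseteq> U"
      using V by (auto simp: U_def analytic_at)
    moreover have "z \<in> k -` (-{0}) \<inter> V"
      using z V by (auto simp: U_def)
    ultimately show "\<exists>T. open T \<and> z \<in> T \<and> T \<subseteq> U" by blast
  qed
  moreover have "cball 0 r \<subseteq> U" using k by (auto simp: U_def)
  ultimately obtain e where e: "e > 0" "{x. infdist x (cball 0 r) \<le> e} \<subseteq> U"
    using compact_in_open_separated[of "cball 0 r" U] r by auto
  have U: "ball 0 (r + e) \<subseteq> U"
  proof
    fix x :: complex assume x: "x \<in> ball 0 (r + e)"
    show "x \<in> U"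
    proof (cases "norm x \<le> r")
      case False
      define y where "y = of_real (r / norm x) * x"
      have "norm y = r" using r False by (auto simp: y_def norm_mult norm_divide)
      hence "infdist x (cball 0 r) \<le> dist x y"
        by (intro infdist_le) auto
      also have "x - y = of_real (1 - r / norm x) * x"
        by (simp add: y_def algebra_simps)
      hence "dist x y = \<bar>1 - r / norm x\<bar> * norm x"
        by (simp add: dist_norm norm_mult del: of_real_diff of_real_divide)
      also have "\<bar>1 - r / norm x\<bar> = 1 - r / norm x"
        using False r order.strict_trans2[of 0 r "norm x"]
        by (intro abs_of_nonneg) (simp add: divide_le_eq_1_pos)
      also have "(1 - r / norm x) * norm x = norm x - r" using False r by (auto simp: field_simps)
      also have "\<dots> \<le> e" using x by auto
      finally show ?thesis using e by auto
    qed (use \<open>cball 0 r \<subseteq> U\<close> in auto)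
  qed
  have "k holomorphic_on ball 0 (r + e)"
    using U by (intro analytic_imp_holomorphic, subst analytic_on_analytic_at) (auto simp: U_def)
  then obtain g where g: "g holomorphic_on ball 0 (r + e)" "\<And>z. norm z < r + e \<Longrightarrow> k z = exp (g z)"
  proof (rule holomorphic_log_ball)
    show "k z \<noteq> 0" if "norm z < r + e" for z using U that by (auto simp: U_def)
  qed (use that in auto)
  show thesis
  proof (rule that[of "r + e" g])
    fix z assume z: "norm z \<le> r" "h analytic_on {z}" "h z \<noteq> 0"
    have "z \<notin> A" using zorder_eq_0I[OF z(2,3)] by (auto simp: A_def)
    moreover from this have "p analytic_on {z}"
      unfolding p_def by (auto intro!: analytic_intros)
    moreover have "p z \<noteq> 0"
      using fin \<open>z \<notin> A\<close> by (auto simp: p_def)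
    ultimately have "k z = h z / p z"
      unfolding k_def using z by (intro remove_sings_at_analytic analytic_intros) auto
    moreover have "k z = exp (g z)" using z e by (intro g) auto
    ultimately show "z \<notin> A \<and> h z = exp (g z) * (\<Prod>a\<in>A. (z - a) powi zorder h a)"
      using \<open>p z \<noteq> 0\<close> \<open>z \<notin> A\<close> by (auto simp: p_def field_simps)
  qed (use e g in auto)
qed

lemma ln_powi: "x > 0 \<Longrightarrow> ln (x powi n) = of_int n * ln (x :: real)"
  by (cases "n \<ge> 0") (auto simp: power_int_def ln_realpow ln_inverse)

lemma ln_norm_factor:
  assumes "finite A" "z \<notin> A"
  shows   "ln (norm (exp w * (\<Prod>a\<in>A. (z - a) powi m a))) = Re w + (\<Sum>a\<in>A. of_int (m a) * ln (norm (z - a)))"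
proof -
  have "ln (norm (exp w * (\<Prod>a\<in>A. (z - a) powi m a))) = Re w + ln (\<Prod>a\<in>A. norm (z - a) powi m a)"
    using assms by (subst norm_mult, subst ln_mult) (auto simp: norm_power_int prod_norm[symmetric])
  also have "ln (\<Prod>a\<in>A. norm (z - a) powi m a) = (\<Sum>a\<in>A. ln (norm (z - a) powi m a))"
    using assms by (intro ln_prod) (auto intro!: zero_less_power_int)
  also have "\<dots> = (\<Sum>a\<in>A. of_int (m a) * ln (norm (z - a)))"
    using assms by (intro sum.cong ln_powi) auto
  finally show ?thesis .
qed

text \<open>Orders are real-valued so that divisors can be combined with fractional weights. For
  \<open>zer h\<close> and \<open>pol h\<close> the sum \<open>nav r\<close> below is the integrated
  counting function \<open>N(r)\<close> of zeros and poles in Nevanlinna theory.\<close>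

definition ordv :: "(complex \<Rightarrow> complex) \<Rightarrow> complex \<Rightarrow> real" where "ordv h z = of_int (zorder h z)"
definition zer :: "(complex \<Rightarrow> complex) \<Rightarrow> complex \<Rightarrow> real" where "zer h z = max 0 (ordv h z)"
definition pol :: "(complex \<Rightarrow> complex) \<Rightarrow> complex \<Rightarrow> real" where "pol h z = max 0 (- ordv h z)"

definition loc_finite :: "(complex \<Rightarrow> real) \<Rightarrow> bool" where
  "loc_finite D \<longleftrightarrow> (\<forall>r. finite {z. norm z < r \<and> D z \<noteq> 0})"

text \<open>Since \<open>ln 0 = 0\<close>, the origin gets weight \<open>ln r\<close>, as it should.\<close>
definition nav :: "real \<Rightarrow> (complex \<Rightarrow> real) \<Rightarrow> real" where
  "nav r D = (\<Sum>z | norm z < r \<and> D z \<noteq> 0. D z * (ln r - ln (norm z)))"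

lemma loc_finite_ordv [intro]: "mero h \<Longrightarrow> loc_finite (ordv h)"
  using finite_zorder_nonzero[of h] by (auto simp: loc_finite_def ordv_def)

lemma loc_finite_subset: "loc_finite D \<Longrightarrow> (\<And>z. E z \<noteq> 0 \<Longrightarrow> D z \<noteq> 0) \<Longrightarrow> loc_finite E"
  unfolding loc_finite_def by (intro allI, rule finite_subset[of _ "{z. norm z < _ \<and> D z \<noteq> 0}"]) auto

lemma loc_finite_zer [intro]: "mero h \<Longrightarrow> loc_finite (zer h)"
  by (rule loc_finite_subset[OF loc_finite_ordv]) (auto simp: zer_def)

lemma loc_finite_pol [intro]: "mero h \<Longrightarrow> loc_finite (pol h)"
  by (rule loc_finite_subset[OF loc_finite_ordv]) (auto simp: pol_def)

lemma loc_finite_Un: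
  assumes "loc_finite D" "loc_finite E" "\<And>z. F z \<noteq> 0 \<Longrightarrow> D z \<noteq> 0 \<or> E z \<noteq> 0"
  shows   "loc_finite F"
  unfolding loc_finite_def
proof safe
  fix r
  have "finite ({z. norm z < r \<and> D z \<noteq> 0} \<union> {z. norm z < r \<and> E z \<noteq> 0})"
    using assms by (auto simp: loc_finite_def)
  thus "finite {z. norm z < r \<and> F z \<noteq> 0}"
    by (rule finite_subset[rotated]) (use assms in blast)
qed

lemma loc_finite_add [intro]: "loc_finite D \<Longrightarrow> loc_finite E \<Longrightarrow> loc_finite (\<lambda>z. D z + E z)"
  by (rule loc_finite_Un[of D E]) auto

lemma loc_finite_diff [intro]: "loc_finite D \<Longrightarrow> loc_finite E \<Longrightarrow> loc_finite (\<lambda>z. D z - E z)"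
  by (rule loc_finite_Un[of D E]) auto

lemma loc_finite_cmult [intro]: "loc_finite D \<Longrightarrow> loc_finite (\<lambda>z. c * D z)"
  by (rule loc_finite_subset) auto

lemma nav_eq_sum:
  assumes "finite A" "A \<subseteq> {z. norm z < r}" "{z. norm z < r \<and> D z \<noteq> 0} \<subseteq> A"
  shows   "nav r D = (\<Sum>z\<in>A. D z * (ln r - ln (norm z)))"
  unfolding nav_def using assms by (intro sum.mono_neutral_left) auto

lemma nav_add:
  assumes "loc_finite D" "loc_finite E"
  shows   "nav r (\<lambda>z. D z + E z) = nav r D + nav r E"
proof -
  define A where "A = {z. norm z < r \<and> D z \<noteq> 0} \<union> {z. norm z < r \<and> E z \<noteq> 0}"
  have "finite A" using assms by (auto simp: loc_finite_def A_def)
  hence "nav r F = (\<Sum>z\<in>A. F z * (ln r - ln (norm z)))" if "\<And>z. F z \<noteq> 0 \<Longrightarrow> D z \<noteq> 0 \<or> E z \<noteq> 0" for F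
    using that by (intro nav_eq_sum) (auto simp: A_def)
  from this[of D] this[of E] this[of "\<lambda>z. D z + E z"] show ?thesis
    by (auto simp: distrib_right simp flip: sum.distrib)
qed

lemma nav_cmult: "nav r (\<lambda>z. c * D z) = c * nav r D"
  by (cases "c = 0") (auto simp: nav_def sum_distrib_left mult_ac)

lemma nav_diff:
  assumes "loc_finite D" "loc_finite E"
  shows   "nav r (\<lambda>z. D z - E z) = nav r D - nav r E"
  using nav_add[OF assms(1) loc_finite_cmult[OF assms(2), of "-1"], of r] nav_cmult[of r "-1" E] by simp

text \<open>The bound \<open>r \<ge> 1\<close> is for the origin, whose weight is
  \<open>ln r\<close>.\<close>

lemma nav_weight_nonneg: "r \<ge> 1 \<Longrightarrow> norm z < r \<Longrightarrow> ln r - ln (norm z) \<ge> 0"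
  by (cases "z = 0") auto

lemma nav_nonneg:
  assumes "r \<ge> 1" "\<And>z. D z \<ge> 0"
  shows   "nav r D \<ge> 0"
  unfolding nav_def using assms nav_weight_nonneg[of r] by (intro sum_nonneg mult_nonneg_nonneg) auto

lemma nav_mono:
  assumes "loc_finite D" "loc_finite E" "r \<ge> 1" "\<And>z. D z \<le> E z"
  shows   "nav r D \<le> nav r E"
proof -
  have "0 \<le> nav r (\<lambda>z. E z - D z)"
    using assms by (intro nav_nonneg) auto
  thus ?thesis using assms by (simp add: nav_diff)
qed

lemma nav_radius_mono:
  assumes "loc_finite D" "1 \<le> r" "r \<le> R" "\<And>z. D z \<ge> 0"
  shows   "nav r D \<le> nav R D"
proof -
  have "nav r D \<le> (\<Sum>z | norm z < r \<and> D z \<noteq> 0. D z * (ln R - ln (norm z)))"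
    unfolding nav_def using assms by (intro sum_mono mult_left_mono) auto
  also have "\<dots> \<le> nav R D"
    unfolding nav_def using assms
    by (intro sum_mono2) (auto simp: loc_finite_def intro!: mult_nonneg_nonneg nav_weight_nonneg)
  finally show ?thesis .
qed

text \<open>The limit does not involve the radius; it is the logarithm of the modulus of the leading
  Laurent coefficient at the origin.\<close>
definition jensen_const :: "(complex \<Rightarrow> complex) \<Rightarrow> real" where
  "jensen_const h = Lim (at 0) (\<lambda>z. ln (norm (h z)) - ordv h 0 * ln (norm z))"

text \<open>In the factorisation of \<open>h\<close> as \<open>exp g\<close> times a finite product,
  the mean of the first part is \<open>Re (g 0)\<close>, and a zero or pole inside contributes its
  order times \<open>ln r\<close>. Both \<open>g\<close> and the product depend on the radius, so
  the constant that remains has to be identified separately.\<close>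

theorem jensen_formula:
  assumes h: "mero h" and r: "r > 0" "\<And>z. norm z = r \<Longrightarrow> h analytic_on {z} \<and> h z \<noteq> 0"
  shows   "cmean r (\<lambda>z. ln (norm (h z))) = nav r (ordv h) + jensen_const h"
proof -
  define A where "A = {z. norm z < r \<and> zorder h z \<noteq> 0}"
  have fin: "finite A"
    unfolding A_def by (rule finite_zorder_nonzero[OF h])
  obtain R g where R: "R > r" and g: "g holomorphic_on ball 0 R"
    "\<And>z. norm z \<le> r \<Longrightarrow> h analytic_on {z} \<Longrightarrow> h z \<noteq> 0 \<Longrightarrow>
       z \<notin> A \<and> h z = exp (g z) * (\<Prod>a\<in>A. (z - a) powi zorder h a)"
    by (rule mero_factor[OF h r(1), folded A_def]) (use r(2) zorder_eq_0I in \<open>blast\<close>)+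
  have ln_h: "ln (norm (h z)) = Re (g z) + (\<Sum>a\<in>A. ordv h a * ln (norm (z - a)))"
    if "norm z \<le> r" "h analytic_on {z}" "h z \<noteq> 0" for z
    using g(2)[OF that] ln_norm_factor[OF fin, of z "g z" "zorder h"] by (simp add: ordv_def)
  have contg: "continuous_on (sphere 0 r) g"
    by (rule continuous_on_subset[OF holomorphic_on_imp_continuous_on[OF g(1)]]) (use R in auto)
  have "cmean r (\<lambda>z. ln (norm (h z))) = cmean r (\<lambda>z. Re (g z) + (\<Sum>a\<in>A. ordv h a * ln (norm (z - a))))"
    using r ln_h by (intro cmean_cong) auto
  also have "\<dots> = cmean r (\<lambda>z. Re (g z)) + (\<Sum>a\<in>A. cmean r (\<lambda>z. ordv h a * ln (norm (z - a))))"
    using r fin contg by (subst cmean_add; (subst cmean_sum)?) (auto simp: A_def intro!: continuous_intros)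
  also have "cmean r (\<lambda>z. Re (g z)) = Re (g 0)"
    using R r contg cmean_holomorphic[OF g(1)] by (simp flip: Re_cmean)
  also have "(\<Sum>a\<in>A. cmean r (\<lambda>z. ordv h a * ln (norm (z - a)))) = (\<Sum>a\<in>A. ordv h a * ln r)"
    using r by (intro sum.cong) (auto simp: cmean_cmul cmean_ln_norm_linear A_def max_def)
  also have "\<dots> = nav r (ordv h) + (\<Sum>a\<in>A. ordv h a * ln (norm a))"
    unfolding sum.distrib[symmetric] nav_def A_def by (simp add: ordv_def flip: sum.distrib) (simp add: algebra_simps)
  also have "Re (g 0) + (nav r (ordv h) + (\<Sum>a\<in>A. ordv h a * ln (norm a))) =
             nav r (ordv h) + (Re (g 0) + (\<Sum>a\<in>A-{0}. ordv h a * ln (norm a)))"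
    using fin by (simp add: sum_diff1)
  also have "Re (g 0) + (\<Sum>a\<in>A-{0}. ordv h a * ln (norm a)) = jensen_const h"
  proof -
    \<comment> \<open>The remaining constant is the limit at the origin after the factor belonging
      to the origin has been split off; this limit no longer refers to \<open>g\<close> or
      \<open>r\<close>.\<close>
    have "((\<lambda>z. Re (g z) + (\<Sum>a\<in>A-{0}. ordv h a * ln (norm (z - a)))) \<longlongrightarrow>
             Re (g 0) + (\<Sum>a\<in>A-{0}. ordv h a * ln (norm (0 - a)))) (at 0)"
    proof (intro tendsto_intros)
      have "isCont g 0"
        using holomorphic_on_imp_continuous_on[OF g(1)] R r
        by (simp add: continuous_on_eq_continuous_at)
      thus "(g \<longlongrightarrow> g 0) (at 0)" by (simp add: isCont_def)
    qed auto
    also have "?this \<longleftrightarrow> ((\<lambda>z. ln (norm (h z)) - ordv h 0 * ln (norm z)) \<longlongrightarrow>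
                 Re (g 0) + (\<Sum>a\<in>A-{0}. ordv h a * ln (norm (0 - a)))) (at 0)"
    proof (rule filterlim_cong[OF refl refl])
      have "eventually (\<lambda>z. z \<in> ball 0 r - {0}) (at 0)"
        using r by (intro eventually_at_in_open) auto
      with eventually_analytic_nonzero[OF h, of 0]
      show "\<forall>\<^sub>F z in at 0. Re (g z) + (\<Sum>a\<in>A-{0}. ordv h a * ln (norm (z - a))) =
               ln (norm (h z)) - ordv h 0 * ln (norm z)"
      proof eventually_elim
        case (elim z)
        have "(\<Sum>a\<in>A. ordv h a * ln (norm (z - a))) =
                (\<Sum>a\<in>A-{0}. ordv h a * ln (norm (z - a))) + ordv h 0 * ln (norm z)"
        proof (cases "0 \<in> A")
          case False
          hence "ordv h 0 = 0" using r by (auto simp: A_def ordv_def)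
          thus ?thesis using False by simp
        qed (use sum.remove[OF fin, of 0 "\<lambda>a. ordv h a * ln (norm (z - a))"] in simp)
        moreover have "ln (norm (h z)) = Re (g z) + (\<Sum>a\<in>A. ordv h a * ln (norm (z - a)))"
          using elim by (intro ln_h) auto
        ultimately show ?case by linarith
      qed
    qed
    finally show ?thesis
      unfolding jensen_const_def by (intro tendsto_Lim [symmetric]) auto
  qed
  finally show ?thesis .
qed

section \<open>The characteristic and the logarithmic derivative\<close>

definition lnp :: "real \<Rightarrow> real" where "lnp x = ln (max 1 x)"

lemma lnp_nonneg [simp]: "lnp x \<ge> 0"
  by (simp add: lnp_def)

lemma lnp_mono: "x \<le> y \<Longrightarrow> lnp x \<le> lnp y"
  by (simp add: lnp_def)

lemma lnp_ge_1: "x \<ge> 1 \<Longrightarrow> lnp x = ln x"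
  by (simp add: lnp_def max_def)

lemma lnp_le_1 [simp]: "x \<le> 1 \<Longrightarrow> lnp x = 0"
  by (simp add: lnp_def max_def)

lemma continuous_on_lnp [continuous_intros]:
  "continuous_on A f \<Longrightarrow> continuous_on A (\<lambda>x. lnp (f x))"
  unfolding lnp_def by (intro continuous_intros) auto

lemma ln_eq_lnp_diff: "x > 0 \<Longrightarrow> ln x = lnp x - lnp (inverse x)"
proof (cases "x \<ge> 1")
  case True
  thus ?thesis by (simp add: lnp_ge_1 inverse_le_1_iff)
next
  case False
  assume "x > 0"
  with False show ?thesis by (simp add: lnp_ge_1 one_le_inverse ln_inverse)
qed

lemma ln_le_lnp: "x > 0 \<Longrightarrow> ln x \<le> lnp x"
  by (simp add: lnp_def)

lemma abs_ln_eq: "x > 0 \<Longrightarrow> \<bar>ln x\<bar> = 2 * lnp x - ln x"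
  by (cases "x \<ge> 1") (auto simp: lnp_def max_def ln_ge_zero_iff)

lemma lnp_mult_le:
  assumes "x \<ge> 0" "y \<ge> 0"
  shows   "lnp (x * y) \<le> lnp x + lnp y"
proof -
  have "max 1 (x * y) \<le> max 1 x * max 1 y"
    using assms mult_mono[of 1 "max 1 x" 1 "max 1 y"] mult_mono[of x "max 1 x" y "max 1 y"] by auto
  hence "lnp (x * y) \<le> ln (max 1 x * max 1 y)"
    unfolding lnp_def by (subst ln_le_cancel_iff) (auto intro: mult_pos_pos)
  also have "\<dots> = lnp x + lnp y"
    unfolding lnp_def by (rule ln_mult_pos) auto
  finally show ?thesis .
qed

lemma lnp_add_le:
  assumes "x \<ge> 0" "y \<ge> 0"
  shows   "lnp (x + y) \<le> lnp x + lnp y + ln 2"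
proof -
  have "1 * 1 \<le> max 1 x * max 1 y" "x * 1 \<le> max 1 x * max 1 y" "1 * y \<le> max 1 x * max 1 y"
    using assms by (intro mult_mono; simp)+
  hence "max 1 (x + y) \<le> max 1 x * max 1 y * 2"
    by (auto simp: max_def)
  hence "lnp (x + y) \<le> ln (max 1 x * max 1 y * 2)"
    unfolding lnp_def by (subst ln_le_cancel_iff) (auto intro!: mult_pos_pos)
  also have "\<dots> = ln (max 1 x * max 1 y) + ln 2"
    by (rule ln_mult_pos) (auto intro!: mult_pos_pos)
  also have "ln (max 1 x * max 1 y) = lnp x + lnp y"
    unfolding lnp_def by (rule ln_mult_pos) auto
  finally show ?thesis .
qed

lemma lnp_power: "x \<ge> 0 \<Longrightarrow> lnp (x ^ n) = n * lnp x"
  by (cases "x \<ge> 1") (auto simp: lnp_ge_1 one_le_power power_le_one ln_realpow)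

lemma lnp_le_ln_1_plus: "x \<ge> 0 \<Longrightarrow> lnp x \<le> ln (1 + x)"
  unfolding lnp_def by (subst ln_le_cancel_iff) auto

text \<open>The Nevanlinna characteristic \<open>T(r, h) = m(r, h) + N(r, h)\<close>; the first
  summand is the proximity function.\<close>

definition nchar :: "real \<Rightarrow> (complex \<Rightarrow> complex) \<Rightarrow> real" where
  "nchar r h = cmean r (\<lambda>z. lnp (norm (h z))) + nav r (pol h)"

lemma zorder_add_const:
  assumes "mero h" "mero (\<lambda>z. h z + c)" "c \<noteq> 0"
  shows   "zorder h z < 0 \<and> zorder (\<lambda>z. h z + c) z = zorder h z \<or>
           zorder h z = 0 \<and> zorder (\<lambda>z. h z + c) z \<ge> 0 \<or>
           zorder h z > 0 \<and> zorder (\<lambda>z. h z + c) z = 0"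
proof -
  have c: "(\<lambda>_. c) meromorphic_on {z}" "\<exists>\<^sub>F w in at z. c \<noteq> 0"
    using assms by (auto simp: frequently_const)
  note h = mero_meromorphic[OF assms(1)] mero_frequently[OF assms(1)]
  consider "zorder h z < 0" | "zorder h z = 0" | "zorder h z > 0" by linarith
  thus ?thesis
  proof cases
    case 1
    thus ?thesis using zorder_add1[OF h c] assms by simp
  next
    case 2
    thus ?thesis using zorder_add_ge[OF h c, of 0] mero_frequently[OF assms(2)] assms by simp
  next
    case 3
    thus ?thesis using zorder_add2[OF h c] assms by simp
  qed
qed

lemma pol_add_const:
  assumes "mero h" "mero (\<lambda>z. h z + c)"
  shows   "pol (\<lambda>z. h z + c) = pol h"
proof (cases "c = 0")
  case False
  show ?thesis
  proof
    fix z show "pol (\<lambda>z. h z + c) z = pol h z"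
      using zorder_add_const[OF assms False, of z] by (auto simp: pol_def ordv_def)
  qed
qed auto

section \<open>Estimates behind the lemma on the logarithmic derivative\<close>

lemma has_field_derivative_prod_powi:
  assumes "finite A" "z \<notin> A"
  shows   "((\<lambda>w. \<Prod>a\<in>A. (w - a) powi m a) has_field_derivative
             (\<Prod>a\<in>A. (z - a) powi m a) * (\<Sum>a\<in>A. of_int (m a) / (z - a))) (at z)"
  using assms
proof (induction A rule: finite_induct)
  case (insert a A)
  have "z \<noteq> a" "z \<notin> A" using insert by auto
  have "((\<lambda>w. (w - a) powi m a) has_field_derivative of_int (m a) * (z - a) powi (m a - 1)) (at z)"
    using \<open>z \<noteq> a\<close> by (auto intro!: derivative_eq_intros)
  also have "(z - a) powi (m a - 1) = (z - a) powi m a / (z - a)"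
    using \<open>z \<noteq> a\<close> by (simp add: power_int_diff)
  finally have "((\<lambda>w. (w - a) powi m a * (\<Prod>a\<in>A. (w - a) powi m a)) has_field_derivative
     of_int (m a) * ((z - a) powi m a / (z - a)) * (\<Prod>a\<in>A. (z - a) powi m a) +
     (\<Prod>a\<in>A. (z - a) powi m a) * (\<Sum>a\<in>A. of_int (m a) / (z - a)) * (z - a) powi m a) (at z)"
    by (rule DERIV_mult[OF _ insert.IH[OF \<open>z \<notin> A\<close>]])
  moreover have "of_int (m a) * ((z - a) powi m a / (z - a)) * (\<Prod>a\<in>A. (z - a) powi m a) +
     (\<Prod>a\<in>A. (z - a) powi m a) * (\<Sum>a\<in>A. of_int (m a) / (z - a)) * (z - a) powi m a =
     (z - a) powi m a * (\<Prod>a\<in>A. (z - a) powi m a) * (of_int (m a) / (z - a) + (\<Sum>a\<in>A. of_int (m a) / (z - a)))"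
    by (simp add: algebra_simps)
  ultimately show ?case using insert.hyps by simp
qed auto

text \<open>The mean of \<open>ln (norm (z - a) / R)\<close> is 0 and the quotient is at most 2, so
  \<open>2 * lnp - ln\<close>, which is the absolute value, has mean at most
  \<open>2 * ln 2\<close>. Dividing by \<open>R\<close> is what makes the bound independent of the
  scale.\<close>

lemma cmean_abs_ln_linear_le:
  assumes "norm a < R"
  shows   "cmean R (\<lambda>z. \<bar>ln (norm (z - a) / R)\<bar>) \<le> 2 * ln 2"
proof -
  have R: "R > 0" using assms norm_ge_zero[of a] by linarith
  have nz: "z - a \<noteq> 0" if "norm z = R" for z :: complex using that assms by auto
  have cont: "continuous_on (sphere 0 R) (\<lambda>z. ln (norm (z - a)))"
    using nz by (auto intro!: continuous_intros)
  have "cmean R (\<lambda>z. \<bar>ln (norm (z - a) / R)\<bar>) \<le> cmean R (\<lambda>z. 2 * ln 2 - (ln (norm (z - a)) - ln R))"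
  proof (rule cmean_mono)
    fix z :: complex assume z: "norm z = R"
    have "norm (z - a) \<le> norm z + norm a" by (rule norm_triangle_ineq4)
    hence "norm (z - a) / R \<le> 2" using z assms R by (simp add: field_simps)
    hence "lnp (norm (z - a) / R) \<le> ln 2" using lnp_mono[of _ 2] by (simp add: lnp_ge_1)
    moreover have "ln (norm (z - a) / R) = ln (norm (z - a)) - ln R"
      using nz[OF z] R by (simp add: ln_div)
    ultimately show "\<bar>ln (norm (z - a) / R)\<bar> \<le> 2 * ln 2 - (ln (norm (z - a)) - ln R)"
      using abs_ln_eq[of "norm (z - a) / R"] nz[OF z] R by simp
  qed (use R nz in \<open>auto intro!: continuous_intros\<close>)
  also have "\<dots> = 2 * ln 2 - (cmean R (\<lambda>z. ln (norm (z - a))) - ln R)"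
    using R cont by (subst cmean_diff; (subst cmean_diff)?) (auto intro!: continuous_intros)
  also have "\<dots> = 2 * ln 2"
    using assms R by (simp add: cmean_ln_norm_linear max_def)
  finally show ?thesis .
qed

text \<open>Jensen's inequality: the tangent of \<open>ln (1 + y)\<close> at the mean of
  \<open>Y\<close> lies above the graph, and its linear part integrates to 0.\<close>

lemma cmean_ln_1_plus_le:
  assumes "r \<ge> 0" "continuous_on (sphere 0 r) Y" "\<And>z. norm z = r \<Longrightarrow> Y z \<ge> (0::real)"
  shows   "cmean r (\<lambda>z. ln (1 + Y z)) \<le> ln (1 + cmean r Y)"
proof -
  define \<mu> where "\<mu> = cmean r Y"
  have \<mu>: "\<mu> \<ge> 0" unfolding \<mu>_def using assms by (intro cmean_ge) auto
  have "cmean r (\<lambda>z. ln (1 + Y z)) \<le> cmean r (\<lambda>z. ln (1 + \<mu>) + (1 / (1 + \<mu>)) * (Y z - \<mu>))"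
  proof (rule cmean_mono)
    fix z :: complex assume z: "norm z = r"
    have "ln (1 + Y z) - ln (1 + \<mu>) \<le> ((1 + Y z) - (1 + \<mu>)) / (1 + \<mu>)"
      using assms(3)[OF z] \<mu> by (intro ln_diff_le) auto
    thus "ln (1 + Y z) \<le> ln (1 + \<mu>) + (1 / (1 + \<mu>)) * (Y z - \<mu>)" by simp
  next
    show "continuous_on (sphere 0 r) (\<lambda>z. ln (1 + Y z))"
      using assms by (intro continuous_intros) force+
  next
    show "continuous_on (sphere 0 r) (\<lambda>z. ln (1 + \<mu>) + 1 / (1 + \<mu>) * (Y z - \<mu>))"
      using assms \<mu> by (intro continuous_intros) auto
  qed (use assms in auto)
  also have "\<dots> = ln (1 + \<mu>) + (1 / (1 + \<mu>)) * (\<mu> - \<mu>)"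
    using assms \<mu> unfolding \<mu>_def
    by (subst cmean_add; (subst cmean_cmul)?; (subst cmean_diff)?) (auto intro!: continuous_intros)
  finally show ?thesis by (simp add: \<mu>_def)
qed

text \<open>Concavity of the logarithm is applied to \<open>norm q powr (1/2)\<close>, since \<open>1 / norm (z - a)\<close> has no
  bounded mean but its square root has.\<close>
lemma cmean_lnp_le_ln_sum:
  assumes r: "r \<ge> 1" and q: "continuous_on (sphere 0 r) q" and A: "finite A" "\<And>a. a \<in> A \<Longrightarrow> norm a \<noteq> r"
    and c: "\<And>a. a \<in> A \<Longrightarrow> c a \<ge> 1" and K: "K \<ge> 0"
    and le: "\<And>z. norm z = r \<Longrightarrow> norm (q z) \<le> K + (\<Sum>a\<in>A. c a / norm (z - a))"
  shows   "cmean r (\<lambda>z. lnp (norm (q z))) \<le> 2 * ln (1 + (sqrt K + 2 * (\<Sum>a\<in>A. c a)))"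
proof -
  define Y where "Y = (\<lambda>z. sqrt K + (\<Sum>a\<in>A. c a * (1 / sqrt (norm (z - a)))))"
  have c': "c a > 0" if "a \<in> A" for a using c[OF that] by simp
  have contY: "continuous_on (sphere 0 r) Y"
    unfolding Y_def using A by (auto intro!: continuous_intros)
  have Y: "Y z \<ge> 0" for z
    unfolding Y_def using K c' by (intro add_nonneg_nonneg sum_nonneg mult_nonneg_nonneg) (auto simp: less_imp_le)
  have "cmean r (\<lambda>z. lnp (norm (q z))) \<le> cmean r (\<lambda>z. 2 * ln (1 + Y z))"
  proof (rule cmean_mono)
    fix z :: complex assume z: "norm z = r"
    have sq: "sqrt (sum f B) \<le> (\<Sum>a\<in>B. sqrt (f a))" if "\<And>a. a \<in> B \<Longrightarrow> f a \<ge> 0" for f and B :: "complex set"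
      using that
    proof (induction B rule: infinite_finite_induct)
      case (insert b B)
      have "sqrt (f b + sum f B) \<le> sqrt (f b) + sqrt (sum f B)"
        using insert by (intro sqrt_add_le_add_sqrt sum_nonneg) auto
      thus ?case using insert by fastforce
    qed auto
    have "sqrt (norm (q z)) \<le> sqrt (K + (\<Sum>a\<in>A. c a / norm (z - a)))"
      using le[OF z] by (rule real_sqrt_le_mono)
    also have "\<dots> \<le> sqrt K + sqrt (\<Sum>a\<in>A. c a / norm (z - a))"
      using K c' by (intro sqrt_add_le_add_sqrt sum_nonneg) (auto simp: less_imp_le)
    also have "sqrt (\<Sum>a\<in>A. c a / norm (z - a)) \<le> (\<Sum>a\<in>A. sqrt (c a / norm (z - a)))"
      using c' by (intro sq) (auto simp: less_imp_le)
    also have "\<dots> \<le> (\<Sum>a\<in>A. c a * (1 / sqrt (norm (z - a))))"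
    proof (rule sum_mono)
      fix a assume a: "a \<in> A"
      \<comment> \<open>Because \<open>c a \<ge> 1\<close>, the root of the multiplicity may be
        replaced by the multiplicity; the loss disappears in the logarithm.\<close>
      have "sqrt (c a) \<le> sqrt ((c a)\<^sup>2)"
        using c[OF a] self_le_power[of "c a" 2] by (intro real_sqrt_le_mono) auto
      hence "sqrt (c a) \<le> c a" using c[OF a] by simp
      thus "sqrt (c a / norm (z - a)) \<le> c a * (1 / sqrt (norm (z - a)))"
        by (simp add: real_sqrt_divide divide_right_mono)
    qed
    finally have le': "sqrt (norm (q z)) \<le> Y z" by (simp add: Y_def)
    have "lnp (norm (q z)) = lnp (sqrt (norm (q z)) ^ 2)" by simp
    also have "\<dots> = 2 * lnp (sqrt (norm (q z)))" by (subst lnp_power) auto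
    also have "\<dots> \<le> 2 * lnp (Y z)" using le' by (intro mult_left_mono lnp_mono) auto
    also have "\<dots> \<le> 2 * ln (1 + Y z)" using Y by (intro mult_left_mono lnp_le_ln_1_plus) auto
    finally show "lnp (norm (q z)) \<le> 2 * ln (1 + Y z)" .
  next
    have "1 + Y z \<noteq> 0" for z using Y[of z] by linarith
    thus "continuous_on (sphere 0 r) (\<lambda>z. 2 * ln (1 + Y z))"
      by (intro continuous_intros contY) auto
  qed (use r q in \<open>auto intro!: continuous_intros\<close>)
  also have "\<dots> = 2 * cmean r (\<lambda>z. ln (1 + Y z))" by (rule cmean_cmul)
  also have "\<dots> \<le> 2 * ln (1 + cmean r Y)"
    using cmean_ln_1_plus_le[OF _ contY] Y r by simp
  also have "cmean r Y = sqrt K + (\<Sum>a\<in>A. c a * cmean r (\<lambda>z. 1 / sqrt (norm (z - a))))"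
    unfolding Y_def using r A
    by (subst cmean_add; (subst cmean_sum)?) (auto intro!: continuous_intros simp: cmean_cmul simp del: times_divide_eq_right)
  also have "2 * ln (1 + \<dots>) \<le> 2 * ln (1 + (sqrt K + 2 * (\<Sum>a\<in>A. c a)))"
  proof -
    have 1: "(\<Sum>a\<in>A. c a * cmean r (\<lambda>z. 1 / sqrt (norm (z - a)))) \<le> (\<Sum>a\<in>A. c a * 2)"
      using c' A r by (intro sum_mono mult_left_mono cmean_inverse_sqrt_le) (auto simp: less_imp_le)
    have 2: "(\<Sum>a\<in>A. c a * cmean r (\<lambda>z. 1 / sqrt (norm (z - a)))) \<ge> 0"
      using c' A r by (intro sum_nonneg mult_nonneg_nonneg cmean_ge) (auto simp: less_imp_le intro!: continuous_intros)
    have 3: "sqrt K \<ge> 0" using K by simp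
    have 4: "(\<Sum>a\<in>A. c a * 2) = 2 * (\<Sum>a\<in>A. c a)" by (simp add: mult.commute flip: sum_distrib_right)
    have "ln (1 + (sqrt K + (\<Sum>a\<in>A. c a * cmean r (\<lambda>z. 1 / sqrt (norm (z - a)))))) \<le>
          ln (1 + (sqrt K + 2 * (\<Sum>a\<in>A. c a)))"
      by (subst ln_le_cancel_iff) (use 1 2 3 4 in linarith)+
    thus ?thesis by simp
  qed
  finally show ?thesis .
qed

text \<open>All zeros and poles of the functions under consideration lie on circles with radius in \<open>B\<close>.\<close>
locale circles =
  fixes B :: "real set"
  assumes countable_B: "countable B"
begin

definition good :: "real \<Rightarrow> bool" where "good r \<longleftrightarrow> r \<ge> 1 \<and> r \<notin> B"

definition adm :: "(complex \<Rightarrow> complex) \<Rightarrow> bool" where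
  "adm h \<longleftrightarrow> mero h \<and> (\<forall>z. norm z \<notin> B \<longrightarrow> h analytic_on {z} \<and> h z \<noteq> 0)"

lemma good_ge_1: "good r \<Longrightarrow> r \<ge> 1" by (simp add: good_def)

lemma good_between:
  assumes "1 \<le> a" "a < b"
  obtains r where "good r" "a < r" "r < b"
proof -
  have "uncountable ({a<..<b} - B)"
    using assms countable_B by (intro uncountable_minus_countable) (auto simp: uncountable_open_interval)
  hence "{a<..<b} - B \<noteq> {}" by (metis countable_empty)
  then obtain r where "r \<in> {a<..<b} - B" by blast
  thus ?thesis using that[of r] assms by (auto simp: good_def)
qed

lemma adm_mero: "adm h \<Longrightarrow> mero h" by (simp add: adm_def)

lemma adm_good: "adm h \<Longrightarrow> good r \<Longrightarrow> norm z = r \<Longrightarrow> h analytic_on {z} \<and> h z \<noteq> 0"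
  by (auto simp: adm_def good_def)

lemma adm_continuous_on:
  assumes "adm h" "good r"
  shows   "continuous_on (sphere 0 r) h"
proof -
  have "h analytic_on sphere 0 r"
    using adm_good[OF assms] by (subst analytic_on_analytic_at) auto
  thus ?thesis by (intro holomorphic_on_imp_continuous_on analytic_imp_holomorphic)
qed

lemma adm_continuous_on_deriv:
  assumes "adm h" "good r"
  shows   "continuous_on (sphere 0 r) (deriv h)"
proof -
  have "h analytic_on sphere 0 r"
    using adm_good[OF assms] by (subst analytic_on_analytic_at) auto
  thus ?thesis by (intro holomorphic_on_imp_continuous_on analytic_imp_holomorphic analytic_deriv)
qed

lemma adm_continuous_on_lnp:
  "adm h \<Longrightarrow> good r \<Longrightarrow> continuous_on (sphere 0 r) (\<lambda>z. lnp (norm (h z)))"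
  by (intro continuous_intros adm_continuous_on)

lemma adm_continuous_on_ln:
  "adm h \<Longrightarrow> good r \<Longrightarrow> continuous_on (sphere 0 r) (\<lambda>z. ln (norm (h z)))"
  using adm_good by (intro continuous_intros adm_continuous_on) auto

lemma adm_zorder_good: "adm h \<Longrightarrow> good r \<Longrightarrow> norm z = r \<Longrightarrow> zorder h z = 0"
  using adm_good zorder_eq_0I by blast

lemma adm_jensen:
  "adm h \<Longrightarrow> good r \<Longrightarrow> cmean r (\<lambda>z. ln (norm (h z))) = nav r (ordv h) + jensen_const h"
  using adm_good[of h r] good_ge_1[of r] by (intro jensen_formula adm_mero) auto

lemma adm_mult: "adm f \<Longrightarrow> adm g \<Longrightarrow> adm (\<lambda>z. f z * g z)"
  by (auto simp: adm_def intro!: mero_mult analytic_intros)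

lemma adm_inverse: "adm f \<Longrightarrow> adm (\<lambda>z. inverse (f z))"
  by (auto simp: adm_def intro!: mero_inverse analytic_intros)

lemma adm_divide: "adm f \<Longrightarrow> adm g \<Longrightarrow> adm (\<lambda>z. f z / g z)"
  by (auto simp: adm_def intro!: mero_divide analytic_intros)

lemma adm_const: "c \<noteq> 0 \<Longrightarrow> adm (\<lambda>_. c)"
  by (auto simp: adm_def intro!: mero_const analytic_intros)

lemma proximity_nonneg: "adm h \<Longrightarrow> good r \<Longrightarrow> cmean r (\<lambda>z. lnp (norm (h z))) \<ge> 0"
  using adm_continuous_on_lnp[of h r] good_ge_1[of r] by (intro cmean_ge) auto

lemma nav_pol_nonneg: "good r \<Longrightarrow> nav r (pol h) \<ge> 0"
  using good_ge_1 by (intro nav_nonneg) (auto simp: pol_def)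

lemma nav_zer_nonneg: "good r \<Longrightarrow> nav r (zer h) \<ge> 0"
  using good_ge_1 by (intro nav_nonneg) (auto simp: zer_def)

lemma nchar_nonneg: "adm h \<Longrightarrow> good r \<Longrightarrow> nchar r h \<ge> 0"
  unfolding nchar_def using proximity_nonneg nav_pol_nonneg by (intro add_nonneg_nonneg)

lemma nav_pol_le_nchar: "adm h \<Longrightarrow> good r \<Longrightarrow> nav r (pol h) \<le> nchar r h"
  using proximity_nonneg[of h r] by (simp add: nchar_def)

section \<open>First main theorem\<close>

lemma nav_ordv: "mero h \<Longrightarrow> nav r (ordv h) = nav r (zer h) - nav r (pol h)"
proof -
  assume h: "mero h"
  have "ordv h = (\<lambda>z. zer h z - pol h z)"
    by (auto simp: zer_def pol_def fun_eq_iff)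
  thus ?thesis using h by (simp add: nav_diff loc_finite_zer loc_finite_pol)
qed

text \<open>Jensen's formula after splitting \<open>ln\<close> into
  \<open>lnp x - lnp (inverse x)\<close>. Zeros are thus counted by the characteristic, less the
  proximity to 0; the second main theorem bounds the sum of such proximities.\<close>

lemma nav_zer:
  assumes "adm h" "good r"
  shows   "nav r (zer h) = nchar r h - jensen_const h - cmean r (\<lambda>z. lnp (norm (inverse (h z))))"
proof -
  have "cmean r (\<lambda>z. ln (norm (h z))) = cmean r (\<lambda>z. lnp (norm (h z)) - lnp (norm (inverse (h z))))"
    using adm_good[OF assms] good_ge_1[OF assms(2)] by (intro cmean_cong) (auto simp: ln_eq_lnp_diff norm_inverse)
  also have "\<dots> = cmean r (\<lambda>z. lnp (norm (h z))) - cmean r (\<lambda>z. lnp (norm (inverse (h z))))"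
    using assms good_ge_1[OF assms(2)] by (intro cmean_diff adm_continuous_on_lnp adm_inverse) auto
  finally show ?thesis
    using adm_jensen[OF assms] nav_ordv[OF adm_mero[OF assms(1)], of r] by (simp add: nchar_def)
qed

theorem nchar_inverse:
  assumes "adm h" "good r"
  shows   "nchar r (\<lambda>z. inverse (h z)) = nchar r h - jensen_const h"
proof -
  have "pol (\<lambda>z. inverse (h z)) = zer h"
    using zorder_inverse_mero[OF adm_mero[OF assms(1)]] by (auto simp: pol_def zer_def ordv_def fun_eq_iff)
  thus ?thesis using nav_zer[OF assms] by (simp add: nchar_def)
qed

lemma nav_zer_le:
  assumes "adm h" "good r"
  shows   "nav r (zer h) \<le> nchar r h - jensen_const h"
  using nav_zer[OF assms] proximity_nonneg[OF adm_inverse[OF assms(1)] assms(2)] by simp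

lemma nchar_mult_le:
  assumes "adm f" "adm g" "good r"
  shows   "nchar r (\<lambda>z. f z * g z) \<le> nchar r f + nchar r g"
proof -
  have "cmean r (\<lambda>z. lnp (norm (f z * g z))) \<le> cmean r (\<lambda>z. lnp (norm (f z)) + lnp (norm (g z)))"
    using assms good_ge_1[of r]
    by (intro cmean_mono adm_continuous_on_lnp adm_mult continuous_intros) (auto simp: norm_mult intro: lnp_mult_le)
  also have "\<dots> = cmean r (\<lambda>z. lnp (norm (f z))) + cmean r (\<lambda>z. lnp (norm (g z)))"
    using assms good_ge_1[of r] by (intro cmean_add adm_continuous_on_lnp) auto
  finally have 1: "cmean r (\<lambda>z. lnp (norm (f z * g z))) \<le> cmean r (\<lambda>z. lnp (norm (f z))) + cmean r (\<lambda>z. lnp (norm (g z)))" .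
  have "nav r (pol (\<lambda>z. f z * g z)) \<le> nav r (\<lambda>z. pol f z + pol g z)"
    using assms good_ge_1[of r] zorder_mult_mero[of f g]
    by (intro nav_mono loc_finite_add loc_finite_pol mero_mult) (auto simp: adm_mero pol_def ordv_def)
  also have "\<dots> = nav r (pol f) + nav r (pol g)"
    using assms by (intro nav_add loc_finite_pol) (auto simp: adm_mero)
  finally show ?thesis using 1 by (simp add: nchar_def)
qed

lemma nchar_add_const_le:
  assumes "adm h" "adm (\<lambda>z. h z + c)" "good r"
  shows   "nchar r (\<lambda>z. h z + c) \<le> nchar r h + (lnp (norm c) + ln 2)"
proof -
  have "cmean r (\<lambda>z. lnp (norm (h z + c))) \<le> cmean r (\<lambda>z. lnp (norm (h z)) + (lnp (norm c) + ln 2))"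
  proof (rule cmean_mono)
    fix z
    have "lnp (norm (h z + c)) \<le> lnp (norm (h z) + norm c)"
      by (intro lnp_mono norm_triangle_ineq)
    also have "\<dots> \<le> lnp (norm (h z)) + lnp (norm c) + ln 2" by (rule lnp_add_le) auto
    finally show "lnp (norm (h z + c)) \<le> lnp (norm (h z)) + (lnp (norm c) + ln 2)" by simp
  qed (use assms good_ge_1[of r] in \<open>auto intro!: adm_continuous_on_lnp continuous_intros adm_continuous_on\<close>)
  also have "\<dots> = cmean r (\<lambda>z. lnp (norm (h z))) + (lnp (norm c) + ln 2)"
    using assms good_ge_1[of r] by (subst cmean_add) (auto intro!: adm_continuous_on_lnp)
  finally show ?thesis
    using pol_add_const[of h c] assms by (simp add: nchar_def adm_mero)
qed

text \<open>In \<open>nav R2\<close> a zero or pole inside radius \<open>R\<close> weighs at least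
  \<open>ln (R2 / R)\<close>, so an unweighted count on the smaller disc is bought with the
  characteristic on the larger one. Zeros plus poles are \<open>ordv\<close> plus twice the poles,
  and Jensen's formula controls \<open>ordv\<close>.\<close>

lemma sum_ordv_le:
  assumes h: "adm h" and R: "1 \<le> R" "R < R2" "good R2"
  shows   "(\<Sum>a | norm a < R \<and> zorder h a \<noteq> 0. \<bar>ordv h a\<bar>) * ln (R2 / R) \<le> 2 * nchar R2 h + \<bar>jensen_const h\<bar>"
proof -
  have "(\<Sum>a | norm a < R \<and> zorder h a \<noteq> 0. \<bar>ordv h a\<bar>) * ln (R2 / R) \<le>
        (\<Sum>a | norm a < R \<and> zorder h a \<noteq> 0. \<bar>ordv h a\<bar> * (ln R2 - ln (norm a)))"
    unfolding sum_distrib_right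
  proof (intro sum_mono mult_left_mono)
    fix a assume a: "a \<in> {a. norm a < R \<and> zorder h a \<noteq> 0}"
    have "ln (norm a) \<le> ln R" using a R by (cases "a = 0") auto
    thus "ln (R2 / R) \<le> ln R2 - ln (norm a)" using R by (simp add: ln_div)
  qed auto
  also have "\<dots> \<le> nav R2 (\<lambda>z. \<bar>ordv h z\<bar>)"
    unfolding nav_def using R loc_finite_ordv[OF adm_mero[OF h]]
    by (intro sum_mono2) (auto simp: ordv_def loc_finite_def intro!: mult_nonneg_nonneg nav_weight_nonneg)
  also have "nav R2 (\<lambda>z. \<bar>ordv h z\<bar>) = nav R2 (\<lambda>z. ordv h z + 2 * pol h z)"
    by (rule arg_cong[of _ _ "nav R2"]) (auto simp: pol_def fun_eq_iff)
  also have "\<dots> = nav R2 (ordv h) + 2 * nav R2 (pol h)"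
    using adm_mero[OF h] by (subst nav_add) (auto simp: nav_cmult)
  also have "nav R2 (ordv h) \<le> cmean R2 (\<lambda>z. lnp (norm (h z))) - jensen_const h"
  proof -
    have "cmean R2 (\<lambda>z. ln (norm (h z))) \<le> cmean R2 (\<lambda>z. lnp (norm (h z)))"
      using R h adm_good[OF h R(3)] by (intro cmean_mono adm_continuous_on_ln adm_continuous_on_lnp ln_le_lnp) auto
    thus ?thesis using adm_jensen[OF h R(3)] by simp
  qed
  finally show ?thesis
    using proximity_nonneg[OF h R(3)] by (simp add: nchar_def)
qed

lemma cmean_abs_ln_le:
  assumes h: "adm h" and R: "good R"
  shows   "cmean R (\<lambda>z. \<bar>ln (norm (h z))\<bar>) \<le> 2 * nchar R h + \<bar>jensen_const h\<bar>"
proof -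
  have "cmean R (\<lambda>z. \<bar>ln (norm (h z))\<bar>) = cmean R (\<lambda>z. 2 * lnp (norm (h z)) - ln (norm (h z)))"
    using adm_good[OF h R] good_ge_1[OF R] by (intro cmean_cong abs_ln_eq) auto
  also have "\<dots> = 2 * cmean R (\<lambda>z. lnp (norm (h z))) - cmean R (\<lambda>z. ln (norm (h z)))"
    using good_ge_1[OF R] adm_continuous_on_lnp[OF h R] adm_continuous_on_ln[OF h R]
    by (subst cmean_diff) (auto simp: cmean_cmul intro!: continuous_intros)
  also have "\<dots> \<le> 2 * nchar R h + \<bar>jensen_const h\<bar>"
    using adm_jensen[OF h R] nav_ordv[OF adm_mero[OF h], of R] nav_zer_nonneg[OF R, of h] nav_pol_nonneg[OF R, of h]
    by (simp add: nchar_def)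
  finally show ?thesis .
qed

text \<open>Takes the place of the differentiated Poisson-Jensen formula: the zeros and poles give
  the explicit fractions, and the zero-free factor \<open>exp g\<close> gives
  \<open>deriv g\<close>, which is controlled by the real part of \<open>g\<close> on the larger
  circle.\<close>

lemma norm_log_deriv_le:
  assumes h: "adm h" and R: "good R" "good r" "r < R" and z: "norm z = r"
  defines "A \<equiv> {a. norm a < R \<and> zorder h a \<noteq> 0}"
  shows   "norm (deriv h z / h z) \<le> 2 * R / (R - r)\<^sup>2 *
             (cmean R (\<lambda>w. \<bar>ln (norm (h w))\<bar>) + 2 * ln 2 * (\<Sum>a\<in>A. \<bar>ordv h a\<bar>)) +
             (\<Sum>a\<in>A. \<bar>ordv h a\<bar> / norm (z - a))"
proof -
  have R0: "R > 0" "r \<ge> 1" using good_ge_1 R by fastforce+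
  have fin: "finite A"
    unfolding A_def by (rule finite_zorder_nonzero[OF adm_mero[OF h]])
  obtain R' g where R': "R' > R" and g: "g holomorphic_on ball 0 R'"
    "\<And>z. norm z \<le> R \<Longrightarrow> h analytic_on {z} \<Longrightarrow> h z \<noteq> 0 \<Longrightarrow>
       z \<notin> A \<and> h z = exp (g z) * (\<Prod>a\<in>A. (z - a) powi zorder h a)"
    by (rule mero_factor[OF adm_mero[OF h] R0(1), folded A_def]) (use adm_zorder_good[OF h R(1)] in \<open>blast\<close>)+
  have hz: "h analytic_on {z}" "h z \<noteq> 0" using adm_good[OF h R(2) z] by auto
  have "z \<notin> A" using g(2)[OF _ hz] z R by auto
  define p where "p = (\<lambda>z. \<Prod>a\<in>A. (z - a) powi zorder h a)"
  have "eventually (\<lambda>w. w \<in> ball 0 R) (nhds z)"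
    using R z by (intro eventually_nhds_in_open) auto
  moreover have "eventually (\<lambda>w. h analytic_on {w} \<and> h w \<noteq> 0) (nhds z)"
    using eventually_analytic_nonzero[OF adm_mero[OF h], of z] hz by (simp add: eventually_nhds_conv_at)
  ultimately have ev: "eventually (\<lambda>w. h w = exp (g w) * p w) (nhds z)"
    by eventually_elim (use g(2) in \<open>auto simp: p_def\<close>)
  have dg: "(g has_field_derivative deriv g z) (at z)"
    using z R R' by (intro holomorphic_derivI[OF g(1)]) auto
  have "((\<lambda>w. exp (g w) * p w) has_field_derivative
          (exp (g z) * deriv g z) * p z + (p z * (\<Sum>a\<in>A. of_int (zorder h a) / (z - a))) * exp (g z)) (at z)"
    unfolding p_def by (intro DERIV_mult has_field_derivative_prod_powi fin \<open>z \<notin> A\<close> DERIV_chain'[OF dg] DERIV_exp)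
  also have "?this \<longleftrightarrow> (h has_field_derivative
          (exp (g z) * deriv g z) * p z + (p z * (\<Sum>a\<in>A. of_int (zorder h a) / (z - a))) * exp (g z)) (at z)"
    using ev by (intro DERIV_cong_ev refl) (auto elim: eventually_mono)
  finally have "deriv h z = (exp (g z) * deriv g z) * p z + (p z * (\<Sum>a\<in>A. of_int (zorder h a) / (z - a))) * exp (g z)"
    by (rule DERIV_imp_deriv)
  also have "\<dots> = h z * (deriv g z + (\<Sum>a\<in>A. of_int (zorder h a) / (z - a)))"
    using g(2)[OF _ hz] z R by (simp add: p_def algebra_simps)
  finally have "deriv h z / h z = deriv g z + (\<Sum>a\<in>A. of_int (zorder h a) / (z - a))"
    using hz by simp
  hence "norm (deriv h z / h z) \<le> norm (deriv g z) + norm (\<Sum>a\<in>A. of_int (zorder h a) / (z - a))"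
    by (simp only: norm_triangle_ineq)
  also have "norm (\<Sum>a\<in>A. of_int (zorder h a) / (z - a)) \<le> (\<Sum>a\<in>A. norm (of_int (zorder h a) / (z - a)))"
    by (rule norm_sum)
  also have "\<dots> = (\<Sum>a\<in>A. \<bar>ordv h a\<bar> / norm (z - a))"
    by (simp add: norm_divide ordv_def)
  finally have 1: "norm (deriv h z / h z) \<le> norm (deriv g z) + (\<Sum>a\<in>A. \<bar>ordv h a\<bar> / norm (z - a))"
    by simp
  \<comment> \<open>A constant shift does not affect the derivative, but it replaces each factor
    \<open>w - a\<close> by \<open>(w - a) / R\<close>, whose logarithm has an absolute mean bounded
    independently of \<open>R\<close>.\<close>
  define g1 where "g1 = (\<lambda>w. g w + of_real (\<Sum>a\<in>A. ordv h a * ln R))"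
  have g1: "g1 holomorphic_on ball 0 R'"
    unfolding g1_def by (intro holomorphic_intros g)
  have contg1: "continuous_on (sphere 0 R) g1"
    by (rule continuous_on_subset[OF holomorphic_on_imp_continuous_on[OF g1]]) (use R' in auto)
  have "deriv g z = deriv g1 z"
    unfolding g1_def using DERIV_add[OF dg DERIV_const] by (intro DERIV_imp_deriv [symmetric]) simp
  also have "norm \<dots> \<le> 2 * R / (R - r)\<^sup>2 * cmean R (\<lambda>w. \<bar>Re (g1 w)\<bar>)"
    by (rule norm_deriv_le_cmean_Re[OF g1]) (use R R' R0 z in auto)
  also have "cmean R (\<lambda>w. \<bar>Re (g1 w)\<bar>) \<le> cmean R (\<lambda>w. \<bar>ln (norm (h w))\<bar> + (\<Sum>a\<in>A. \<bar>ordv h a\<bar> * \<bar>ln (norm (w - a) / R)\<bar>))"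
  proof (rule cmean_mono)
    fix w :: complex assume w: "norm w = R"
    have hw: "h analytic_on {w}" "h w \<noteq> 0" using adm_good[OF h R(1) w] by auto
    have wA: "w \<notin> A" using w by (auto simp: A_def)
    have "ln (norm (h w)) = Re (g w) + (\<Sum>a\<in>A. ordv h a * ln (norm (w - a)))"
      using ln_norm_factor[OF fin wA, of "g w" "zorder h"] g(2)[OF _ hw] w by (simp add: ordv_def)
    hence "Re (g1 w) = ln (norm (h w)) - (\<Sum>a\<in>A. ordv h a * (ln (norm (w - a)) - ln R))"
      by (simp add: g1_def right_diff_distrib sum_subtractf)
    also have "(\<Sum>a\<in>A. ordv h a * (ln (norm (w - a)) - ln R)) = (\<Sum>a\<in>A. ordv h a * ln (norm (w - a) / R))"
      using wA R0 by (intro sum.cong) (auto simp: ln_div)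
    also have "\<bar>ln (norm (h w)) - \<dots>\<bar> \<le> \<bar>ln (norm (h w))\<bar> + (\<Sum>a\<in>A. \<bar>ordv h a * ln (norm (w - a) / R)\<bar>)"
      using sum_abs[of "\<lambda>a. ordv h a * ln (norm (w - a) / R)" A] by linarith
    finally show "\<bar>Re (g1 w)\<bar> \<le> \<bar>ln (norm (h w))\<bar> + (\<Sum>a\<in>A. \<bar>ordv h a\<bar> * \<bar>ln (norm (w - a) / R)\<bar>)"
      by (simp add: abs_mult)
  qed (use R0 contg1 adm_continuous_on_ln[OF h R(1)] in \<open>auto intro!: continuous_intros simp: A_def\<close>)
  also have "\<dots> = cmean R (\<lambda>w. \<bar>ln (norm (h w))\<bar>) + (\<Sum>a\<in>A. \<bar>ordv h a\<bar> * cmean R (\<lambda>w. \<bar>ln (norm (w - a) / R)\<bar>))"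
    using R0 fin adm_continuous_on_ln[OF h R(1)]
    by (subst cmean_add; (subst cmean_sum)?) (auto intro!: continuous_intros simp: A_def cmean_cmul)
  also have "(\<Sum>a\<in>A. \<bar>ordv h a\<bar> * cmean R (\<lambda>w. \<bar>ln (norm (w - a) / R)\<bar>)) \<le> (\<Sum>a\<in>A. \<bar>ordv h a\<bar> * (2 * ln 2))"
    by (intro sum_mono mult_left_mono cmean_abs_ln_linear_le) (auto simp: A_def)
  also have "\<dots> = 2 * ln 2 * (\<Sum>a\<in>A. \<bar>ordv h a\<bar>)"
    by (simp add: sum_distrib_left mult_ac)
  finally have "norm (deriv g z) \<le> 2 * R / (R - r)\<^sup>2 * (cmean R (\<lambda>w. \<bar>ln (norm (h w))\<bar>) + 2 * ln 2 * (\<Sum>a\<in>A. \<bar>ordv h a\<bar>))"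
    using R0 by (simp add: mult_left_mono divide_right_mono)
  with 1 show ?thesis by linarith
qed

text \<open>The growth of \<open>h\<close> enters only through a bound \<open>\<tau>\<close> on a
  window of relative width \<open>\<delta>\<close>, and \<open>C\<close> does not depend on
  \<open>r\<close>. Keeping both parameters free allows later uses with windows that shrink as the
  characteristic grows.\<close>

theorem log_derivative:
  assumes h: "adm h"
  obtains C where "C \<ge> 0" "\<And>r \<delta> \<tau>. \<lbrakk>good r; 0 < \<delta>; \<delta> \<le> 1; \<tau> \<ge> 1;
      \<And>R. good R \<Longrightarrow> r \<le> R \<Longrightarrow> R \<le> r * (1 + \<delta>) \<Longrightarrow> nchar R h \<le> \<tau>\<rbrakk> \<Longrightarrow>
      cmean r (\<lambda>z. lnp (norm (deriv h z / h z))) \<le> C * (1 + ln \<tau> + ln (1 / \<delta>))"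
proof -
  define M where "M = 2 + \<bar>jensen_const h\<bar>"
  have M: "M \<ge> 2" by (simp add: M_def)
  define C where "C = 2 * ln (2000 * M) + 6"
  have C: "C \<ge> 6" using M by (simp add: C_def)
  have "cmean r (\<lambda>z. lnp (norm (deriv h z / h z))) \<le> C * (1 + ln \<tau> + ln (1 / \<delta>))"
    if r: "good r" and \<delta>: "0 < \<delta>" "\<delta> \<le> 1" and \<tau>: "\<tau> \<ge> 1"
      and bound: "\<And>R. good R \<Longrightarrow> r \<le> R \<Longrightarrow> R \<le> r * (1 + \<delta>) \<Longrightarrow> nchar R h \<le> \<tau>" for r \<delta> \<tau>
  proof -
    have r1: "r \<ge> 1" using good_ge_1[OF r] .
    \<comment> \<open>Two radii in separate parts of the window:
      \<open>R - r \<ge> r * \<delta> / 4\<close> keeps the kernel for \<open>deriv g\<close>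
      bounded, and \<open>R2 / R \<ge> 1 + \<delta> / 6\<close> is the gap needed to count zeros and
      poles.\<close>
    obtain R where R: "good R" "r * (1 + \<delta> / 4) < R" "R < r * (1 + \<delta> / 2)"
    proof (rule good_between[of "r * (1 + \<delta> / 4)" "r * (1 + \<delta> / 2)"])
      show "1 \<le> r * (1 + \<delta> / 4)" using mult_mono[of 1 r 1 "1 + \<delta> / 4"] r1 \<delta> by simp
    qed (use r1 \<delta> in auto)
    obtain R2 where R2: "good R2" "r * (1 + 3 * \<delta> / 4) < R2" "R2 < r * (1 + \<delta>)"
    proof (rule good_between[of "r * (1 + 3 * \<delta> / 4)" "r * (1 + \<delta>)"])
      show "1 \<le> r * (1 + 3 * \<delta> / 4)" using mult_mono[of 1 r 1 "1 + 3 * \<delta> / 4"] r1 \<delta> by simp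
    qed (use r1 \<delta> in auto)
    have rR: "r < R"
    proof -
      have "r * \<delta> > 0" using r1 \<delta> by (intro mult_pos_pos) auto
      thus ?thesis using R(2) by (simp add: algebra_simps)
    qed
    have Rr: "R - r \<ge> r * \<delta> / 4" using R(2) by (simp add: algebra_simps)
    have R2r: "R \<le> 2 * r"
    proof -
      have "r * (1 + \<delta> / 2) \<le> r * 2" using \<delta> r1 by (intro mult_left_mono) auto
      thus ?thesis using R(3) by linarith
    qed
    have "r * (1 + \<delta> / 2) * (1 + \<delta> / 6) \<le> r * (1 + 3 * \<delta> / 4)"
    proof -
      have "\<delta> * \<delta> \<le> \<delta> * 1" using \<delta> by (intro mult_left_mono) auto
      moreover have "(1 + \<delta> / 2) * (1 + \<delta> / 6) = 1 + 2 * \<delta> / 3 + \<delta> * \<delta> / 12"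
        by (simp add: field_simps)
      ultimately have "(1 + \<delta> / 2) * (1 + \<delta> / 6) \<le> 1 + 3 * \<delta> / 4"
        by linarith
      thus ?thesis using r1 by (simp only: mult.assoc) (intro mult_left_mono, auto)
    qed
    moreover have "R * (1 + \<delta> / 6) < r * (1 + \<delta> / 2) * (1 + \<delta> / 6)"
      using R(3) \<delta> by (intro mult_strict_right_mono) auto
    ultimately have ratio: "R * (1 + \<delta> / 6) \<le> R2" using R2(2) by linarith
    have R0: "R \<ge> 1" using good_ge_1[OF R(1)] .
    have RR2: "R < R2"
    proof -
      have "R * \<delta> > 0" using R0 \<delta> by (intro mult_pos_pos) auto
      thus ?thesis using ratio by (simp add: algebra_simps)
    qed
    have "\<delta> / 12 \<le> \<delta> / 6 - (\<delta> / 6)\<^sup>2"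
    proof -
      have "\<delta> * \<delta> \<le> \<delta> * 1" using \<delta> by (intro mult_left_mono) auto
      thus ?thesis using \<delta> by (simp add: power2_eq_square)
    qed
    also have "\<dots> \<le> ln (1 + \<delta> / 6)"
      using \<delta> by (intro ln_one_plus_pos_lower_bound) auto
    also have "\<dots> \<le> ln (R2 / R)"
      using ratio R0 RR2 \<delta> by (subst ln_le_cancel_iff) (auto simp: field_simps)
    finally have ln_ge: "\<delta> / 12 \<le> ln (R2 / R)" .
    define A where "A = {a. norm a < R \<and> zorder h a \<noteq> 0}"
    have fin: "finite A"
      unfolding A_def by (rule finite_zorder_nonzero[OF adm_mero[OF h]])
    define N where "N = (\<Sum>a\<in>A. \<bar>ordv h a\<bar>)"
    have N0: "N \<ge> 0" by (auto simp: N_def intro!: sum_nonneg)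
    have M\<tau>: "2 * \<tau> + \<bar>jensen_const h\<bar> \<le> M * \<tau>"
      using mult_left_mono[OF \<tau>, of "\<bar>jensen_const h\<bar>"] by (simp add: M_def algebra_simps)
    have "N * (\<delta> / 12) \<le> N * ln (R2 / R)"
      using ln_ge N0 by (intro mult_left_mono) auto
    also have "\<dots> \<le> 2 * nchar R2 h + \<bar>jensen_const h\<bar>"
      unfolding N_def A_def by (rule sum_ordv_le[OF h R0 RR2 R2(1)])
    also have "\<dots> \<le> 2 * \<tau> + \<bar>jensen_const h\<bar>"
      using bound[OF R2(1)] rR RR2 R2(3) by simp
    finally have "N * (\<delta> / 12) \<le> M * \<tau>" using M\<tau> by linarith
    hence N: "N \<le> 12 * (M * \<tau>) / \<delta>" using \<delta> by (simp add: field_simps)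
    have L: "cmean R (\<lambda>w. \<bar>ln (norm (h w))\<bar>) \<le> M * \<tau>"
      using cmean_abs_ln_le[OF h R(1)] bound[OF R(1)] rR RR2 R2(3) M\<tau> by linarith
    have L0: "cmean R (\<lambda>w. \<bar>ln (norm (h w))\<bar>) \<ge> 0"
      using R0 adm_continuous_on_ln[OF h R(1)] by (intro cmean_ge) (auto intro!: continuous_intros)
    define K where "K = 2 * R / (R - r)\<^sup>2 * (cmean R (\<lambda>w. \<bar>ln (norm (h w))\<bar>) + 2 * ln 2 * N)"
    have K0: "K \<ge> 0"
      unfolding K_def using R0 L0 N0 by (intro mult_nonneg_nonneg add_nonneg_nonneg divide_nonneg_nonneg) auto
    \<comment> \<open>Two factors \<open>1 / \<delta>\<close> come from the kernel
      \<open>2 * R / (R - r)^2\<close>, the third from the count of zeros and poles. Together with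
      the factor 2 in front of the logarithm, the cube accounts for the 6 in
      \<open>C\<close>.\<close>
    define X where "X = M * \<tau> / \<delta> ^ 3"
    have "M * \<tau> \<ge> 2" using M \<tau> mult_mono[of 2 M 1 \<tau>] by simp
    have X1: "M * \<tau> \<le> X" "M * \<tau> / \<delta> \<le> X"
    proof -
      have "\<delta> ^ 3 \<le> \<delta> ^ 1" using \<delta> by (intro power_decreasing) auto
      thus "M * \<tau> / \<delta> \<le> X" unfolding X_def using \<delta> \<open>M * \<tau> \<ge> 2\<close> by (intro divide_left_mono) auto
      have "\<delta> ^ 3 \<le> 1" using \<delta> by (simp add: power_le_one)
      hence "M * \<tau> * \<delta> ^ 3 \<le> M * \<tau> * 1" using \<open>M * \<tau> \<ge> 2\<close> by (intro mult_left_mono) auto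
      thus "M * \<tau> \<le> X" using \<delta> by (simp add: X_def field_simps)
    qed
    have "K \<le> 64 / \<delta>\<^sup>2 * (25 * (M * \<tau>) / \<delta>)"
      unfolding K_def
    proof (intro mult_mono)
      have "2 * R / (R - r)\<^sup>2 \<le> 2 * (2 * r) / (r * \<delta> / 4)\<^sup>2"
        using R2r Rr r1 \<delta> by (intro frac_le power_mono) auto
      also have "\<dots> = 64 / \<delta>\<^sup>2 / r" using r1 by (simp add: power2_eq_square field_simps)
      also have "\<dots> \<le> 64 / \<delta>\<^sup>2 / 1" using r1 \<delta> by (intro divide_left_mono) auto
      finally show "2 * R / (R - r)\<^sup>2 \<le> 64 / \<delta>\<^sup>2" by simp
      have "2 * ln 2 * N \<le> 2 * 1 * N" using N0 ln_2_less_1 by (intro mult_right_mono) auto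
      moreover have "M * \<tau> / 1 \<le> M * \<tau> / \<delta>"
        using \<delta> \<open>M * \<tau> \<ge> 2\<close> by (intro divide_left_mono) auto
      ultimately show "cmean R (\<lambda>w. \<bar>ln (norm (h w))\<bar>) + 2 * ln 2 * N \<le> 25 * (M * \<tau>) / \<delta>"
        using L N by simp
    qed (use L0 N0 in auto)
    also have "\<dots> = 1600 * X" by (simp add: X_def power2_eq_square power3_eq_cube)
    finally have K: "K \<le> 1600 * X" .
    have "sqrt K \<le> 1 + K"
      using K0 by (intro real_le_lsqrt) (auto simp: power2_eq_square algebra_simps)
    hence le: "1 + (sqrt K + 2 * N) \<le> 2000 * X"
      using K N X1 \<open>M * \<tau> \<ge> 2\<close> by simp
    have "cmean r (\<lambda>z. lnp (norm (deriv h z / h z))) \<le> 2 * ln (1 + (sqrt K + 2 * (\<Sum>a\<in>A. \<bar>ordv h a\<bar>)))"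
    proof (rule cmean_lnp_le_ln_sum)
      show "continuous_on (sphere 0 r) (\<lambda>z. deriv h z / h z)"
        using adm_good[OF h r] by (intro continuous_intros adm_continuous_on adm_continuous_on_deriv h r) auto
      show "norm a \<noteq> r" if "a \<in> A" for a
        using that adm_zorder_good[OF h r] by (auto simp: A_def)
      show "\<bar>ordv h a\<bar> \<ge> 1" if "a \<in> A" for a
        using that by (auto simp: A_def ordv_def abs_if simp flip: of_int_minus)
      show "norm (deriv h z / h z) \<le> K + (\<Sum>a\<in>A. \<bar>ordv h a\<bar> / norm (z - a))" if "norm z = r" for z
        using norm_log_deriv_le[OF h R(1) r rR that] by (simp add: K_def N_def A_def)
    qed (use r1 fin K0 in auto)
    also have "\<dots> \<le> 2 * ln (2000 * X)"
      using le K0 N0 X1 \<open>M * \<tau> \<ge> 2\<close> unfolding N_def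
      by (intro mult_left_mono, subst ln_le_cancel_iff) (auto intro: add_pos_nonneg add_nonneg_nonneg)
    also have "ln (2000 * X) = ln (2000 * M) + ln \<tau> + 3 * ln (1 / \<delta>)"
      using M \<tau> \<delta> by (simp add: X_def ln_mult ln_div ln_realpow)
    also have "2 * \<dots> \<le> C * (1 + ln \<tau> + ln (1 / \<delta>))"
    proof -
      have "ln \<tau> \<ge> 0" "ln (1 / \<delta>) \<ge> 0" using \<tau> \<delta> by auto
      hence "6 * ln \<tau> \<le> C * ln \<tau>" "6 * ln (1 / \<delta>) \<le> C * ln (1 / \<delta>)"
        using C by (intro mult_right_mono; simp)+
      moreover have "2 * ln (2000 * M) \<le> C" by (simp add: C_def)
      ultimately show ?thesis using \<open>ln \<tau> \<ge> 0\<close> by (simp add: distrib_left)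
    qed
    finally show ?thesis .
  qed
  thus thesis using C that[of C] by auto
qed

end

section \<open>The second main theorem\<close>

lemma lnp_le_abs_ln: "x > 0 \<Longrightarrow> lnp x \<le> \<bar>ln x\<bar>"
  by (cases "x \<ge> 1") (auto simp: lnp_ge_1)

lemma zorder_deriv_nonzero:
  assumes "mero h" "zorder h z \<noteq> 0"
  shows   "zorder (deriv h) z = zorder h z - 1"
  using mero_meromorphic[OF assms(1), of "{z}"] mero_frequently[OF assms(1)] assms(2)
  by (intro zorder_deriv_minus_1) (auto simp: meromorphic_at_iff)

text \<open>Order 0 is the delicate case: \<open>h\<close> may carry an arbitrary value at
  \<open>z\<close>, so the argument passes to the function with removed singularity.\<close>

lemma zorder_deriv_nonneg:
  assumes "mero h" "mero (deriv h)" "zorder h z \<ge> 0"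
  shows   "zorder (deriv h) z \<ge> 0"
proof (cases "zorder h z = 0")
  case True
  define k where "k = remove_sings h"
  have k: "k analytic_on {z}"
    using remove_sings_zorder_0[OF assms(1) True] by (simp add: k_def)
  have ev: "eventually (\<lambda>w. deriv k w = deriv h w) (at z)"
    using eventually_analytic_nonzero[OF assms(1), of z] by eventually_elim (auto simp: k_def)
  have "eventually (\<lambda>w. deriv k w \<noteq> 0) (at z)"
    using ev mero_eventually[OF assms(2), of z] by eventually_elim auto
  hence "zorder (deriv k) z \<ge> 0"
    by (intro zorder_ge_0 analytic_deriv k) (simp add: eventually_frequently)
  also have "zorder (deriv k) z = zorder (deriv h) z"
    using ev by (intro zorder_cong) auto
  finally show ?thesis .
qed (use assms zorder_deriv_nonzero[of h z] in auto)

lemma pol_deriv_le: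
  assumes "mero h" "mero (deriv h)"
  shows   "pol (deriv h) z \<le> 2 * pol h z"
  using zorder_deriv_nonzero[OF assms(1), of z] zorder_deriv_nonneg[OF assms, of z]
  by (cases "zorder h z \<ge> 0") (auto simp: pol_def ordv_def)

text \<open>An equation of functions, valid also at singular points: \<open>deriv\<close> is a
  choice from the derivative relation, and this relation is the same for both sides.\<close>

lemma deriv_add_const: "deriv (\<lambda>z. f z + c) = deriv f"
proof -
  have "((\<lambda>z. f z + c) has_field_derivative D) (at x) \<longleftrightarrow> (f has_field_derivative D) (at x)" for x D
    using DERIV_add[OF _ DERIV_const[of "-c"], of "\<lambda>z. f z + c" D x UNIV]
          DERIV_add[OF _ DERIV_const[of c], of f D x UNIV] by auto
  thus ?thesis by (simp add: deriv_def fun_eq_iff)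
qed

context circles
begin

text \<open>One factorisation on a larger circle serves all radii up to \<open>\<rho>\<close>; the
  absolute means of \<open>ln (norm (z - a))\<close> stay bounded even as the circles approach
  \<open>a\<close>. This prevents the iteration in the growth lemma from running on forever.\<close>

lemma nchar_bounded:
  assumes h: "adm h"
  shows   "\<exists>K. \<forall>r. good r \<and> r \<le> \<rho> \<longrightarrow> nchar r h \<le> K"
proof -
  obtain R where R: "good R" "max 1 \<rho> < R" "R < max 1 \<rho> + 1"
    by (rule good_between[of "max 1 \<rho>" "max 1 \<rho> + 1"]) auto
  have R0: "R > 0" using good_ge_1[OF R(1)] by simp
  define A where "A = {a. norm a < R \<and> zorder h a \<noteq> 0}"
  have fin: "finite A"
    unfolding A_def by (rule finite_zorder_nonzero[OF adm_mero[OF h]])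
  obtain R' g where R': "R' > R" and g: "g holomorphic_on ball 0 R'"
    "\<And>z. norm z \<le> R \<Longrightarrow> h analytic_on {z} \<Longrightarrow> h z \<noteq> 0 \<Longrightarrow>
       z \<notin> A \<and> h z = exp (g z) * (\<Prod>a\<in>A. (z - a) powi zorder h a)"
    by (rule mero_factor[OF adm_mero[OF h] R0(1), folded A_def]) (use adm_zorder_good[OF h R(1)] in \<open>blast\<close>)+
  have "compact (g ` cball 0 R)"
    by (intro compact_continuous_image holomorphic_on_imp_continuous_on holomorphic_on_subset[OF g(1)]) (use R' in auto)
  hence "bounded (g ` cball 0 R)" by (rule compact_imp_bounded)
  then obtain G where "\<forall>x\<in>g ` cball 0 R. norm x \<le> G"
    unfolding bounded_iff by blast
  hence G: "norm (g z) \<le> G" if "norm z \<le> R" for z using that by auto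
  define K where "K = G + (\<Sum>a\<in>A. \<bar>ordv h a\<bar> * (2 * lnp (2 * R)))"
  have "nchar r h \<le> K + nav R (pol h)" if r: "good r" "r \<le> \<rho>" for r
  proof -
    have r1: "r \<ge> 1" "r \<le> R" using good_ge_1[OF r(1)] r R by auto
    have ner: "norm a \<noteq> r" if "a \<in> A" for a
      using that adm_zorder_good[OF h r(1)] by (auto simp: A_def)
    have *: "cmean r (\<lambda>z. \<bar>ln (norm (z - a))\<bar>) \<le> 2 * lnp (2 * R)" if a: "a \<in> A" for a
    proof -
      have nz: "z - a \<noteq> 0" if "norm z = r" for z using that ner[OF a] by auto
      have cont: "continuous_on (sphere 0 r) (\<lambda>z. ln (norm (z - a)))"
        using nz by (auto intro!: continuous_intros)
      have "cmean r (\<lambda>z. \<bar>ln (norm (z - a))\<bar>) \<le> cmean r (\<lambda>z. 2 * lnp (2 * R) - ln (norm (z - a)))"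
      proof (rule cmean_mono)
        fix z :: complex assume z: "norm z = r"
        have "norm (z - a) \<le> norm z + norm a" by (rule norm_triangle_ineq4)
        hence "lnp (norm (z - a)) \<le> lnp (2 * R)"
          using a z r1 by (intro lnp_mono) (auto simp: A_def)
        thus "\<bar>ln (norm (z - a))\<bar> \<le> 2 * lnp (2 * R) - ln (norm (z - a))"
          using abs_ln_eq[of "norm (z - a)"] nz[OF z] by simp
      qed (use r1 cont in \<open>auto intro!: continuous_intros\<close>)
      also have "\<dots> = 2 * lnp (2 * R) - ln (max r (norm a))"
        using r1 cont ner[OF a] by (subst cmean_diff) (auto simp: cmean_ln_norm_linear)
      also have "\<dots> \<le> 2 * lnp (2 * R)" using r1 by simp
      finally show ?thesis .
    qed
    have "cmean r (\<lambda>z. lnp (norm (h z))) \<le> cmean r (\<lambda>z. G + (\<Sum>a\<in>A. \<bar>ordv h a\<bar> * \<bar>ln (norm (z - a))\<bar>))"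
    proof (rule cmean_mono)
      fix z :: complex assume z: "norm z = r"
      have hz: "h analytic_on {z}" "h z \<noteq> 0" using adm_good[OF h r(1) z] by auto
      have zA: "z \<notin> A" using ner z by auto
      have "lnp (norm (h z)) \<le> \<bar>ln (norm (h z))\<bar>" using hz by (intro lnp_le_abs_ln) auto
      also have "ln (norm (h z)) = Re (g z) + (\<Sum>a\<in>A. ordv h a * ln (norm (z - a)))"
        using ln_norm_factor[OF fin zA, of "g z" "zorder h"] g(2)[OF _ hz] z r1 by (simp add: ordv_def)
      also have "\<bar>\<dots>\<bar> \<le> \<bar>Re (g z)\<bar> + (\<Sum>a\<in>A. \<bar>ordv h a * ln (norm (z - a))\<bar>)"
        using sum_abs[of "\<lambda>a. ordv h a * ln (norm (z - a))" A] by linarith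
      also have "\<bar>Re (g z)\<bar> \<le> G" using abs_Re_le_cmod[of "g z"] G[of z] z r1 by linarith
      finally show "lnp (norm (h z)) \<le> G + (\<Sum>a\<in>A. \<bar>ordv h a\<bar> * \<bar>ln (norm (z - a))\<bar>)"
        by (simp add: abs_mult)
    qed (use r1 ner adm_continuous_on_lnp[OF h r(1)] in \<open>auto intro!: continuous_intros\<close>)
    also have "\<dots> = G + (\<Sum>a\<in>A. \<bar>ordv h a\<bar> * cmean r (\<lambda>z. \<bar>ln (norm (z - a))\<bar>))"
      using r1 fin ner by (subst cmean_add; (subst cmean_sum)?) (auto intro!: continuous_intros simp: cmean_cmul)
    also have "\<dots> \<le> K"
      unfolding K_def using * by (intro add_left_mono sum_mono mult_left_mono) auto
    finally have "cmean r (\<lambda>z. lnp (norm (h z))) \<le> K" .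
    moreover have "nav r (pol h) \<le> nav R (pol h)"
      using r1 adm_mero[OF h] by (intro nav_radius_mono) (auto simp: pol_def)
    ultimately show ?thesis by (simp add: nchar_def)
  qed
  thus ?thesis by blast
qed

text \<open>A single zero of \<open>h + c\<close> contributes \<open>ln r - ln (norm z0)\<close> to
  a counting function that the characteristic dominates up to a constant.\<close>

lemma nchar_unbounded:
  assumes h: "adm h" "adm (\<lambda>z. h z + c)" "zorder (\<lambda>z. h z + c) z0 > 0"
  shows   "\<exists>r. good r \<and> nchar r h \<ge> M"
proof -
  define D where "D = (\<lambda>z. if z = z0 then 1 else 0 :: real)"
  define L where "L = lnp (norm c) + ln 2 - jensen_const (\<lambda>z. h z + c)"
  define a where "a = 1 + norm z0 + exp (M + L + ln (norm z0))"
  obtain r where r: "good r" "a < r"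
    by (rule good_between[of a "a + 1"]) (auto simp: a_def add_nonneg_nonneg)
  have r0: "r > norm z0" "r > 0" using r norm_ge_zero[of z0] exp_gt_zero[of "M + L + ln (norm z0)"]
    unfolding a_def by linarith+
  have "exp (M + L + ln (norm z0)) \<le> r" using r norm_ge_zero[of z0] unfolding a_def by linarith
  hence "M + L + ln (norm z0) \<le> ln r" using r0 by (simp add: ln_ge_iff)
  also have "ln r - ln (norm z0) = nav r D"
    using r0 by (subst nav_eq_sum[of "{z0}"]) (auto simp: D_def split: if_splits)
  hence "ln r = nav r D + ln (norm z0)" by simp
  finally have "M + L \<le> nav r D" by simp
  also have "nav r D \<le> nav r (zer (\<lambda>z. h z + c))"
  proof (rule nav_mono)
    show "loc_finite D" by (auto simp: loc_finite_def D_def intro: finite_subset[of _ "{z0}"] split: if_splits)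
    show "D z \<le> zer (\<lambda>z. h z + c) z" for z
      using h(3) by (auto simp: D_def zer_def ordv_def)
  qed (use h r good_ge_1 in \<open>auto simp: adm_mero\<close>)
  also have "\<dots> \<le> nchar r h + L"
    using nav_zer_le[OF h(2) r(1)] nchar_add_const_le[OF h(1,2) r(1)] by (simp add: L_def)
  finally show ?thesis using r by auto
qed

text \<open>A substitute for Borel's growth lemma that does not need \<open>\<Phi>\<close> to be monotone: otherwise one could
  iterate, doubling \<open>\<Phi>\<close> each time while the radii stay bounded.\<close>
lemma growth_lemma:
  fixes \<Phi> :: "real \<Rightarrow> real"
  assumes bdd: "\<And>\<rho>. \<exists>K. \<forall>r. good r \<and> r \<le> \<rho> \<longrightarrow> \<Phi> r \<le> K"
      and unbdd: "\<And>M. \<exists>r. good r \<and> \<Phi> r \<ge> M"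
  shows "\<exists>r. good r \<and> \<Phi> r \<ge> M \<and> (\<forall>R. good R \<and> r \<le> R \<and> R \<le> r * (1 + 1 / \<Phi> r) \<longrightarrow> \<Phi> R \<le> 2 * \<Phi> r)"
proof (rule ccontr)
  assume neg: "\<not>?thesis"
  define M' where "M' = max 1 M"
  have M': "M' \<ge> 1" "M' \<ge> M" by (auto simp: M'_def)
  have "\<forall>r. good r \<and> \<Phi> r \<ge> M' \<longrightarrow> (\<exists>R. good R \<and> r \<le> R \<and> R \<le> r * (1 + 1 / \<Phi> r) \<and> \<Phi> R > 2 * \<Phi> r)"
    using neg M' by force
  then obtain s where s: "\<And>r. good r \<Longrightarrow> \<Phi> r \<ge> M' \<Longrightarrow>
      good (s r) \<and> r \<le> s r \<and> s r \<le> r * (1 + 1 / \<Phi> r) \<and> \<Phi> (s r) > 2 * \<Phi> r"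
    by metis
  obtain r0 where r0: "good r0" "\<Phi> r0 \<ge> M'" using unbdd by blast
  define r where "r = (\<lambda>j. (s ^^ j) r0)"
  have inv: "good (r j) \<and> \<Phi> (r j) \<ge> 2 ^ j * M' \<and> r j \<le> r0 * exp (\<Sum>i<j. (1/2) ^ i)" for j
  proof (induction j)
    case 0
    thus ?case using r0 by (simp add: r_def)
  next
    case (Suc j)
    have rS: "r (Suc j) = s (r j)" by (simp add: r_def)
    have le: "(2::real) ^ j \<le> 2 ^ j * M'" using mult_left_mono[OF M'(1), of "2 ^ j"] by simp
    have "(1::real) \<le> 2 ^ j" by simp
    hence "M' \<le> 2 ^ j * M'" using mult_right_mono[of 1 "2 ^ j" M'] M' by simp
    with Suc have "\<Phi> (r j) \<ge> M'" by linarith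
    note step = s[OF _ this]
    have rj: "r j \<ge> 1" using Suc good_ge_1 by auto
    have "r (Suc j) \<le> r j * (1 + 1 / \<Phi> (r j))" using step Suc rS by auto
    also have "\<dots> \<le> r j * (1 + (1/2) ^ j)"
    proof -
      have "2 ^ j \<le> \<Phi> (r j)" using Suc le by linarith
      hence "1 / \<Phi> (r j) \<le> 1 / 2 ^ j"
        by (intro divide_left_mono) (auto intro!: mult_pos_pos order.strict_trans2[of 0 "2 ^ j" "\<Phi> (r j)"])
      thus ?thesis using rj by (intro mult_left_mono) (auto simp: power_one_over)
    qed
    also have "\<dots> \<le> r j * exp ((1/2) ^ j)"
      using rj exp_ge_add_one_self[of "(1/2) ^ j"] by (intro mult_left_mono) auto
    also have "\<dots> \<le> r0 * exp (\<Sum>i<j. (1/2) ^ i) * exp ((1/2) ^ j)"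
      using Suc by (intro mult_right_mono) auto
    also have "\<dots> = r0 * exp (\<Sum>i<Suc j. (1/2) ^ i)"
      by (simp add: exp_add)
    finally show ?case using step Suc rS by auto
  qed
  have "r j \<le> r0 * exp 2" for j
  proof -
    have "(\<Sum>i<j. (1/2::real) ^ i) \<le> 2"
      using sum_gp_strict[of "1/2::real" j] by simp
    hence "r0 * exp (\<Sum>i<j. (1/2) ^ i) \<le> r0 * exp 2"
      using good_ge_1[OF r0(1)] by (intro mult_left_mono) auto
    thus ?thesis using inv[of j] by linarith
  qed
  moreover obtain K where "\<And>r. good r \<Longrightarrow> r \<le> r0 * exp 2 \<Longrightarrow> \<Phi> r \<le> K"
    using bdd[of "r0 * exp 2"] by blast
  ultimately have "\<Phi> (r j) \<le> K" for j using inv by blast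
  hence "2 ^ j \<le> K" for j :: nat
  proof -
    have "(2::real) ^ j \<le> 2 ^ j * M'" using mult_left_mono[OF M'(1), of "2 ^ j"] by simp
    thus ?thesis using inv[of j] \<open>\<Phi> (r j) \<le> K\<close> by linarith
  qed
  moreover obtain j :: nat where "K < 2 ^ j" using real_arch_pow[of 2 K] by auto
  ultimately show False by (metis not_less)
qed

text \<open>The set depends on \<open>\<Phi>\<close> alone, so estimates for different functions
  hold at the same radii and can be added and chained. The growth lemma supplies members with
  arbitrarily large \<open>\<Phi>\<close>.\<close>

definition growth_radii :: "(real \<Rightarrow> real) \<Rightarrow> real set" where
  "growth_radii \<Phi> = {r. good r \<and> \<Phi> r \<ge> 1 \<and>
     (\<forall>R. good R \<and> r \<le> R \<and> R \<le> r * (1 + 1 / \<Phi> r) \<longrightarrow> \<Phi> R \<le> 2 * \<Phi> r)}"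

text \<open>Inequality up to the error term \<open>S(r) = O(1 + ln \<Phi>(r))\<close> of the theory.\<close>
definition asym_le :: "(real \<Rightarrow> real) \<Rightarrow> (real \<Rightarrow> real) \<Rightarrow> (real \<Rightarrow> real) \<Rightarrow> bool" where
  "asym_le \<Phi> X Y \<longleftrightarrow> (\<exists>C. \<forall>r\<in>growth_radii \<Phi>. X r \<le> Y r + C * (1 + ln (\<Phi> r)))"

section \<open>Calculus of inequalities up to error terms\<close>

lemma growth_radiiD: "r \<in> growth_radii \<Phi> \<Longrightarrow> good r" "r \<in> growth_radii \<Phi> \<Longrightarrow> \<Phi> r \<ge> 1"
  by (auto simp: growth_radii_def)

lemma asym_leI:
  assumes "\<And>r. good r \<Longrightarrow> X r \<le> Y r + C"
  shows   "asym_le \<Phi> X Y"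
  unfolding asym_le_def
proof (intro exI ballI)
  fix r assume r: "r \<in> growth_radii \<Phi>"
  have "\<bar>C\<bar> * 1 \<le> \<bar>C\<bar> * (1 + ln (\<Phi> r))"
    using growth_radiiD[OF r] by (intro mult_left_mono) auto
  thus "X r \<le> Y r + \<bar>C\<bar> * (1 + ln (\<Phi> r))"
    using assms[OF growth_radiiD(1)[OF r]] by linarith
qed

lemma asym_le_trans [trans]:
  assumes "asym_le \<Phi> X Y" "asym_le \<Phi> Y Z"
  shows   "asym_le \<Phi> X Z"
proof -
  obtain C D where "\<forall>r\<in>growth_radii \<Phi>. X r \<le> Y r + C * (1 + ln (\<Phi> r))" "\<forall>r\<in>growth_radii \<Phi>. Y r \<le> Z r + D * (1 + ln (\<Phi> r))"
    using assms by (auto simp: asym_le_def)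
  hence "\<forall>r\<in>growth_radii \<Phi>. X r \<le> Z r + (C + D) * (1 + ln (\<Phi> r))"
    by (fastforce simp: distrib_right)
  thus ?thesis unfolding asym_le_def by blast
qed

lemma asym_le_add:
  assumes "asym_le \<Phi> X Y" "asym_le \<Phi> X' Y'"
  shows   "asym_le \<Phi> (\<lambda>r. X r + X' r) (\<lambda>r. Y r + Y' r)"
proof -
  obtain C D where "\<forall>r\<in>growth_radii \<Phi>. X r \<le> Y r + C * (1 + ln (\<Phi> r))" "\<forall>r\<in>growth_radii \<Phi>. X' r \<le> Y' r + D * (1 + ln (\<Phi> r))"
    using assms by (auto simp: asym_le_def)
  hence "\<forall>r\<in>growth_radii \<Phi>. X r + X' r \<le> Y r + Y' r + (C + D) * (1 + ln (\<Phi> r))"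
    by (fastforce simp: distrib_right)
  thus ?thesis unfolding asym_le_def by blast
qed

lemma asym_le_cmult:
  assumes "asym_le \<Phi> X Y" "c \<ge> 0"
  shows   "asym_le \<Phi> (\<lambda>r. c * X r) (\<lambda>r. c * Y r)"
proof -
  obtain C where C: "\<forall>r\<in>growth_radii \<Phi>. X r \<le> Y r + C * (1 + ln (\<Phi> r))"
    using assms by (auto simp: asym_le_def)
  have "c * X r \<le> c * Y r + (c * C) * (1 + ln (\<Phi> r))" if "r \<in> growth_radii \<Phi>" for r
    using mult_left_mono[OF C[rule_format, OF that] assms(2)] by (simp add: algebra_simps)
  thus ?thesis unfolding asym_le_def by blast
qed

text \<open>The form in which every counting argument ends: a positive multiple of
  \<open>\<Phi>\<close> cannot be an error term, because \<open>(1 + ln x) / x\<close> tends to 0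
  and \<open>\<Phi>\<close> takes large values on \<open>growth_radii\<close>.\<close>

lemma asym_le_absurd:
  assumes bdd: "\<And>\<rho>. \<exists>K. \<forall>r. good r \<and> r \<le> \<rho> \<longrightarrow> \<Phi> r \<le> K"
      and unbdd: "\<And>M. \<exists>r. good r \<and> \<Phi> r \<ge> M"
      and le: "asym_le \<Phi> (\<lambda>r. c * \<Phi> r) (\<lambda>_. 0)" and c: "c > 0"
  shows   False
proof -
  obtain C where C: "\<And>r. r \<in> growth_radii \<Phi> \<Longrightarrow> c * \<Phi> r \<le> C * (1 + ln (\<Phi> r))"
    using le by (auto simp: asym_le_def)
  have "((\<lambda>x. (1 + ln x) / x) \<longlongrightarrow> (0::real)) at_top" by real_asymp
  hence "((\<lambda>x. C * ((1 + ln x) / x)) \<longlongrightarrow> C * 0) at_top" by (intro tendsto_intros)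
  hence "eventually (\<lambda>x. C * ((1 + ln x) / x) < c) at_top"
    using c by (intro order_tendstoD[where y = 0]) auto
  then obtain M where M: "\<And>x. x \<ge> M \<Longrightarrow> C * ((1 + ln x) / x) < c"
    unfolding eventually_at_top_linorder by blast
  obtain r where r: "good r" "\<Phi> r \<ge> max 1 M"
    "\<forall>R. good R \<and> r \<le> R \<and> R \<le> r * (1 + 1 / \<Phi> r) \<longrightarrow> \<Phi> R \<le> 2 * \<Phi> r"
    using growth_lemma[OF bdd unbdd, of "max 1 M"] by blast
  have "C * ((1 + ln (\<Phi> r)) / \<Phi> r) < c" using r by (intro M) auto
  hence "C * (1 + ln (\<Phi> r)) < c * \<Phi> r" using r by (simp add: field_simps)
  moreover have "r \<in> growth_radii \<Phi>" using r by (auto simp: growth_radii_def)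
  ultimately show False using C by fastforce
qed

text \<open>Polynomial domination on the window \<open>[r, r (1 + 1 / (s \<Phi>(r)))]\<close>; every application of the
  lemma on the logarithmic derivative costs a larger \<open>s\<close>.\<close>
definition poly_dominated :: "(real \<Rightarrow> real) \<Rightarrow> real \<Rightarrow> (complex \<Rightarrow> complex) \<Rightarrow> bool" where
  "poly_dominated \<Phi> s h \<longleftrightarrow> (\<exists>K p. \<forall>r\<in>growth_radii \<Phi>. \<forall>R. good R \<longrightarrow> r \<le> R \<longrightarrow> R \<le> r * (1 + 1 / (s * \<Phi> r)) \<longrightarrow>
      nchar R h \<le> K * \<Phi> r ^ p)"

lemma poly_dominatedI:
  assumes "\<And>R. good R \<Longrightarrow> nchar R h \<le> K * \<Phi> R + L" "K \<ge> 0"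
  shows   "poly_dominated \<Phi> 1 h"
  unfolding poly_dominated_def
proof (intro exI ballI allI impI)
  fix r R assume r: "r \<in> growth_radii \<Phi>" "good R" "r \<le> R" "R \<le> r * (1 + 1 / (1 * \<Phi> r))"
  have "nchar R h \<le> K * \<Phi> R + L" using assms r by auto
  also have "K * \<Phi> R \<le> K * (2 * \<Phi> r)" using r assms(2) by (intro mult_left_mono) (auto simp: growth_radii_def)
  also have "L \<le> \<bar>L\<bar> * \<Phi> r" using mult_left_mono[OF growth_radiiD(2)[OF r(1)], of "\<bar>L\<bar>"] by auto
  finally show "nchar R h \<le> (2 * K + \<bar>L\<bar>) * \<Phi> r ^ 1" by (simp add: algebra_simps)
qed

lemma poly_dominated_obtain:
  assumes "poly_dominated \<Phi> s h"
  obtains K p where "K \<ge> 1" "\<And>r R. r \<in> growth_radii \<Phi> \<Longrightarrow> good R \<Longrightarrow> r \<le> R \<Longrightarrow> R \<le> r * (1 + 1 / (s * \<Phi> r)) \<Longrightarrow> nchar R h \<le> K * \<Phi> r ^ p"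
proof -
  obtain K p where K: "\<And>r R. r \<in> growth_radii \<Phi> \<Longrightarrow> good R \<Longrightarrow> r \<le> R \<Longrightarrow> R \<le> r * (1 + 1 / (s * \<Phi> r)) \<Longrightarrow> nchar R h \<le> K * \<Phi> r ^ p"
    using assms(1) unfolding poly_dominated_def by blast
  show thesis
  proof (rule that[of "max 1 K"])
    fix r R assume r: "r \<in> growth_radii \<Phi>" "good R" "r \<le> R" "R \<le> r * (1 + 1 / (s * \<Phi> r))"
    have "K * \<Phi> r ^ p \<le> max 1 K * \<Phi> r ^ p"
      using growth_radiiD[OF r(1)] by (intro mult_right_mono) auto
    thus "nchar R h \<le> max 1 K * \<Phi> r ^ p" using K[OF r] by linarith
  qed auto
qed

lemma poly_dominated_mult:
  assumes "adm f" "adm g" "poly_dominated \<Phi> s f" "poly_dominated \<Phi> s g"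
  shows   "poly_dominated \<Phi> s (\<lambda>z. f z * g z)"
proof -
  obtain K p where K: "K \<ge> 1" "\<And>r R. r \<in> growth_radii \<Phi> \<Longrightarrow> good R \<Longrightarrow> r \<le> R \<Longrightarrow> R \<le> r * (1 + 1 / (s * \<Phi> r)) \<Longrightarrow> nchar R f \<le> K * \<Phi> r ^ p"
    using assms(3) by (rule poly_dominated_obtain) blast
  obtain L q where L: "L \<ge> 1" "\<And>r R. r \<in> growth_radii \<Phi> \<Longrightarrow> good R \<Longrightarrow> r \<le> R \<Longrightarrow> R \<le> r * (1 + 1 / (s * \<Phi> r)) \<Longrightarrow> nchar R g \<le> L * \<Phi> r ^ q"
    using assms(4) by (rule poly_dominated_obtain) blast
  show ?thesis unfolding poly_dominated_def
  proof (intro exI ballI allI impI)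
    fix r R assume r: "r \<in> growth_radii \<Phi>" "good R" "r \<le> R" "R \<le> r * (1 + 1 / (s * \<Phi> r))"
    have "nchar R (\<lambda>z. f z * g z) \<le> nchar R f + nchar R g" using assms r by (intro nchar_mult_le)
    also have "\<dots> \<le> K * \<Phi> r ^ p + L * \<Phi> r ^ q" using K(2)[OF r] L(2)[OF r] by simp
    also have "\<dots> \<le> K * \<Phi> r ^ (p + q) + L * \<Phi> r ^ (p + q)"
      using growth_radiiD[OF r(1)] K L by (intro add_mono mult_left_mono power_increasing) auto
    finally show "nchar R (\<lambda>z. f z * g z) \<le> (K + L) * \<Phi> r ^ (p + q)" by (simp add: distrib_right)
  qed
qed

lemma poly_dominated_const_shift:
  assumes "poly_dominated \<Phi> s f" "\<And>R. good R \<Longrightarrow> nchar R g \<le> nchar R f + L"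
  shows   "poly_dominated \<Phi> s g"
proof -
  obtain K p where K: "K \<ge> 1" "\<And>r R. r \<in> growth_radii \<Phi> \<Longrightarrow> good R \<Longrightarrow> r \<le> R \<Longrightarrow> R \<le> r * (1 + 1 / (s * \<Phi> r)) \<Longrightarrow> nchar R f \<le> K * \<Phi> r ^ p"
    using assms(1) by (rule poly_dominated_obtain) blast
  show ?thesis unfolding poly_dominated_def
  proof (intro exI ballI allI impI)
    fix r R assume r: "r \<in> growth_radii \<Phi>" "good R" "r \<le> R" "R \<le> r * (1 + 1 / (s * \<Phi> r))"
    have "nchar R g \<le> nchar R f + L" using assms r by auto
    also have "\<dots> \<le> K * \<Phi> r ^ p + L" using K(2)[OF r] by simp
    also have "L \<le> \<bar>L\<bar> * \<Phi> r ^ p"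
      using growth_radiiD[OF r(1)] mult_left_mono[OF one_le_power, of "\<Phi> r" "\<bar>L\<bar>" p] by auto
    finally show "nchar R g \<le> (K + \<bar>L\<bar>) * \<Phi> r ^ p" by (simp add: distrib_right)
  qed
qed

lemma poly_dominated_inverse: "adm f \<Longrightarrow> poly_dominated \<Phi> s f \<Longrightarrow> poly_dominated \<Phi> s (\<lambda>z. inverse (f z))"
  by (rule poly_dominated_const_shift[where L = "- jensen_const f"]) (auto simp: nchar_inverse)

lemma poly_dominated_divide: "adm f \<Longrightarrow> adm g \<Longrightarrow> poly_dominated \<Phi> s f \<Longrightarrow> poly_dominated \<Phi> s g \<Longrightarrow> poly_dominated \<Phi> s (\<lambda>z. f z / g z)"
  unfolding divide_inverse by (intro poly_dominated_mult adm_inverse poly_dominated_inverse)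

lemma poly_dominated_add_const: "adm f \<Longrightarrow> adm (\<lambda>z. f z + c) \<Longrightarrow> poly_dominated \<Phi> s f \<Longrightarrow> poly_dominated \<Phi> s (\<lambda>z. f z + c)"
  by (rule poly_dominated_const_shift[where L = "lnp (norm c) + ln 2"]) (auto intro: nchar_add_const_le)

text \<open>With \<open>\<tau> = K * \<Phi> r ^ p\<close> and
  \<open>\<delta> = 1 / (s * \<Phi> r)\<close> both logarithms in the general bound are multiples of
  \<open>ln (\<Phi> r)\<close> up to constants. Polynomial domination is therefore as good as a
  linear one.\<close>

lemma log_derivative_asym:
  assumes h: "adm h" and dom: "poly_dominated \<Phi> s h" "s \<ge> 1"
  shows   "asym_le \<Phi> (\<lambda>r. cmean r (\<lambda>z. lnp (norm (deriv h z / h z)))) (\<lambda>_. 0)"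
proof -
  obtain K p where K: "K \<ge> 1" "\<And>r R. r \<in> growth_radii \<Phi> \<Longrightarrow> good R \<Longrightarrow> r \<le> R \<Longrightarrow> R \<le> r * (1 + 1 / (s * \<Phi> r)) \<Longrightarrow> nchar R h \<le> K * \<Phi> r ^ p"
    using dom(1) by (rule poly_dominated_obtain) blast
  obtain C where C: "C \<ge> 0" "\<And>r \<delta> \<tau>. \<lbrakk>good r; 0 < \<delta>; \<delta> \<le> 1; \<tau> \<ge> 1;
      \<And>R. good R \<Longrightarrow> r \<le> R \<Longrightarrow> R \<le> r * (1 + \<delta>) \<Longrightarrow> nchar R h \<le> \<tau>\<rbrakk> \<Longrightarrow>
      cmean r (\<lambda>z. lnp (norm (deriv h z / h z))) \<le> C * (1 + ln \<tau> + ln (1 / \<delta>))"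
    using log_derivative[OF h] by blast
  show ?thesis unfolding asym_le_def
  proof (intro exI ballI)
    fix r assume r: "r \<in> growth_radii \<Phi>"
    note r' = growth_radiiD[OF r]
    have "cmean r (\<lambda>z. lnp (norm (deriv h z / h z))) \<le> C * (1 + ln (K * \<Phi> r ^ p) + ln (1 / (1 / (s * \<Phi> r))))"
    proof (rule C(2))
      show "1 \<le> K * \<Phi> r ^ p" using K r' mult_mono[of 1 K 1 "\<Phi> r ^ p"] by (simp add: one_le_power)
      show "1 / (s * \<Phi> r) \<le> 1" using r' dom mult_mono[of 1 s 1 "\<Phi> r"] by simp
    qed (use r' r K dom in auto)
    also have "1 + ln (K * \<Phi> r ^ p) + ln (1 / (1 / (s * \<Phi> r))) = 1 + ln K + ln s + (p + 1) * ln (\<Phi> r)"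
      using K r' dom by (simp add: ln_mult ln_realpow algebra_simps)
    also have "\<dots> \<le> (1 + ln K + ln s) * (1 + ln (\<Phi> r)) + (p + 1) * (1 + ln (\<Phi> r))"
      using K r' dom mult_left_mono[of 1 "1 + ln (\<Phi> r)" "1 + ln K + ln s"]
      by (intro add_mono mult_left_mono) auto
    also have "\<dots> = (2 + ln K + ln s + p) * (1 + ln (\<Phi> r))" by (simp add: algebra_simps)
    finally show "cmean r (\<lambda>z. lnp (norm (deriv h z / h z))) \<le> 0 + C * (2 + ln K + ln s + p) * (1 + ln (\<Phi> r))"
      using C(1) by (simp add: mult_left_mono mult.assoc)
  qed
qed

lemma nchar_deriv_le:
  assumes h: "adm h" "adm (deriv h)" "good r"
  shows   "nchar r (deriv h) \<le> cmean r (\<lambda>z. lnp (norm (deriv h z / h z))) + cmean r (\<lambda>z. lnp (norm (h z))) + nav r (pol (deriv h))"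
proof -
  have "cmean r (\<lambda>z. lnp (norm (deriv h z))) \<le> cmean r (\<lambda>z. lnp (norm (deriv h z / h z)) + lnp (norm (h z)))"
  proof (rule cmean_mono)
    fix z :: complex assume z: "norm z = r"
    have "lnp (norm (deriv h z)) = lnp (norm (deriv h z / h z) * norm (h z))"
      using adm_good[OF h(1,3) z] by (simp flip: norm_mult)
    also have "\<dots> \<le> lnp (norm (deriv h z / h z)) + lnp (norm (h z))" by (rule lnp_mult_le) auto
    finally show "lnp (norm (deriv h z)) \<le> lnp (norm (deriv h z / h z)) + lnp (norm (h z))" .
  qed (use h good_ge_1[OF h(3)] in \<open>auto intro!: continuous_intros adm_continuous_on_lnp adm_divide adm_continuous_on\<close>)
  also have "\<dots> = cmean r (\<lambda>z. lnp (norm (deriv h z / h z))) + cmean r (\<lambda>z. lnp (norm (h z)))"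
    using h good_ge_1[OF h(3)] by (intro cmean_add adm_continuous_on_lnp adm_divide) auto
  finally show ?thesis by (simp add: nchar_def)
qed

text \<open>The logarithmic derivative at \<open>R\<close> requires a window to the right of
  \<open>R\<close>, inside the window of \<open>r\<close>. Two windows of one third fit, as
  \<open>(1 + x/3)^2 \<le> 1 + x\<close> for \<open>0 \<le> x \<le> 1\<close>; hence the 3.\<close>

lemma poly_dominated_deriv:
  assumes h: "adm h" "adm (deriv h)" and dom: "poly_dominated \<Phi> 1 h"
  shows   "poly_dominated \<Phi> 3 (deriv h)"
proof -
  obtain K p where K: "K \<ge> 1" "\<And>r R. r \<in> growth_radii \<Phi> \<Longrightarrow> good R \<Longrightarrow> r \<le> R \<Longrightarrow> R \<le> r * (1 + 1 / (1 * \<Phi> r)) \<Longrightarrow> nchar R h \<le> K * \<Phi> r ^ p"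
    using dom(1) by (rule poly_dominated_obtain) blast
  obtain C where C: "C \<ge> 0" "\<And>r \<delta> \<tau>. \<lbrakk>good r; 0 < \<delta>; \<delta> \<le> 1; \<tau> \<ge> 1;
      \<And>R. good R \<Longrightarrow> r \<le> R \<Longrightarrow> R \<le> r * (1 + \<delta>) \<Longrightarrow> nchar R h \<le> \<tau>\<rbrakk> \<Longrightarrow>
      cmean r (\<lambda>z. lnp (norm (deriv h z / h z))) \<le> C * (1 + ln \<tau> + ln (1 / \<delta>))"
    using log_derivative[OF h(1)] by blast
  show ?thesis unfolding poly_dominated_def
  proof (intro exI ballI allI impI)
    fix r R assume r: "r \<in> growth_radii \<Phi>" "good R" "r \<le> R" "R \<le> r * (1 + 1 / (3 * \<Phi> r))"
    note r' = growth_radiiD[OF r(1)]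
    have r1: "r \<ge> 1" using r' good_ge_1 by auto
    define x where "x = 1 / \<Phi> r"
    have x: "0 < x" "x \<le> 1" using r' by (auto simp: x_def)
    have xeq: "1 / (3 * \<Phi> r) = x / 3" by (simp add: x_def)
    have window: "R' \<le> r * (1 + 1 / (1 * \<Phi> r))" if "R' \<le> R * (1 + x / 3)" for R'
    proof -
      have "R * (1 + x / 3) \<le> r * (1 + x / 3) * (1 + x / 3)"
        using r(4) x unfolding xeq by (intro mult_right_mono) auto
      also have "\<dots> = r * ((1 + x / 3) * (1 + x / 3))" by simp
      also have "(1 + x / 3) * (1 + x / 3) \<le> 1 + x"
      proof -
        have "x * x \<le> x * 1" using x by (intro mult_left_mono) auto
        moreover have "(1 + x / 3) * (1 + x / 3) = 1 + 2 * x / 3 + x * x / 9" by (simp add: field_simps)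
        ultimately show ?thesis using x by linarith
      qed
      hence "r * ((1 + x / 3) * (1 + x / 3)) \<le> r * (1 + x)" using r1 by (intro mult_left_mono) auto
      finally show ?thesis using that by (simp add: x_def)
    qed
    define y where "y = \<Phi> r"
    have y: "y \<ge> 1" using r' by (simp add: y_def)
    have y_le: "1 \<le> y ^ (p + 1)" "y ^ p \<le> y ^ (p + 1)" "y \<le> y ^ (p + 1)"
      using y power_increasing[of 1 "p + 1" y] by (auto intro!: one_le_power power_increasing simp del: power_Suc)
    have yp: "1 \<le> K * y ^ p" using K y mult_mono[of 1 K 1 "y ^ p"] by (simp add: one_le_power)
    have "R \<le> R * (1 + x / 3)" using good_ge_1[OF r(2)] x by simp
    hence hR: "nchar R h \<le> K * y ^ p" unfolding y_def using r by (intro K(2) window) auto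
    have "cmean R (\<lambda>z. lnp (norm (deriv h z / h z))) \<le> C * (1 + ln (K * y ^ p) + ln (1 / (x / 3)))"
    proof (rule C(2))
      fix R' assume R': "good R'" "R \<le> R'" "R' \<le> R * (1 + x / 3)"
      show "nchar R' h \<le> K * y ^ p" unfolding y_def using r R' by (intro K(2) window) auto
    qed (use r x yp in auto)
    also have "\<dots> \<le> C * (y ^ (p+1) + K * y ^ (p+1) + 3 * y ^ (p+1))"
    proof (intro mult_left_mono add_mono y_le C(1))
      have "ln (K * y ^ p) \<le> K * y ^ p - 1" using yp by (intro ln_le_minus_one) auto
      also have "\<dots> \<le> K * y ^ p" by simp
      also have "\<dots> \<le> K * y ^ (p+1)" using K y_le by (intro mult_left_mono) auto
      finally show "ln (K * y ^ p) \<le> K * y ^ (p+1)" .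
      have "ln (1 / (x / 3)) \<le> 1 / (x / 3) - 1" using x by (intro ln_le_minus_one) auto
      also have "\<dots> \<le> 3 * y" by (simp add: x_def y_def)
      also have "\<dots> \<le> 3 * y ^ (p+1)" using y_le by (intro mult_left_mono) auto
      finally show "ln (1 / (x / 3)) \<le> 3 * y ^ (p+1)" .
    qed
    finally have 1: "cmean R (\<lambda>z. lnp (norm (deriv h z / h z))) \<le> C * (4 + K) * y ^ (p+1)"
      by (simp add: algebra_simps)
    have "nav R (pol (deriv h)) \<le> nav R (\<lambda>z. 2 * pol h z)"
      using h pol_deriv_le[of h] good_ge_1[OF r(2)]
      by (intro nav_mono loc_finite_cmult loc_finite_pol) (auto simp: adm_mero)
    hence 2: "nav R (pol (deriv h)) \<le> 2 * nav R (pol h)" by (simp add: nav_cmult)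
    have "nchar R (deriv h) \<le> C * (4 + K) * y ^ (p+1) + cmean R (\<lambda>z. lnp (norm (h z))) + 2 * nav R (pol h)"
      using nchar_deriv_le[OF h r(2)] 1 2 by linarith
    also have "\<dots> \<le> C * (4 + K) * y ^ (p+1) + 2 * nchar R h"
      using proximity_nonneg[OF h(1) r(2)] by (simp add: nchar_def)
    also have "2 * nchar R h \<le> 2 * (K * y ^ (p + 1))"
      using hR K mult_left_mono[OF y_le(2), of K] by linarith
    finally show "nchar R (deriv h) \<le> (C * (4 + K) + 2 * K) * \<Phi> r ^ (p+1)"
      by (simp add: y_def algebra_simps)
  qed
qed

text \<open>By Jensen's formula zeros minus poles are bounded by the proximity function, here an
  error term. This lets a logarithmic derivative be inserted into a counting estimate at no
  cost.\<close>

lemma nav_ordv_log_deriv: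
  assumes "adm X" "adm (\<lambda>z. deriv X z / X z)" "poly_dominated \<Phi> s X" "s \<ge> 1"
  shows   "asym_le \<Phi> (\<lambda>r. nav r (ordv (\<lambda>z. deriv X z / X z))) (\<lambda>_. 0)"
proof -
  let ?q = "\<lambda>z. deriv X z / X z"
  have "asym_le \<Phi> (\<lambda>r. nav r (ordv ?q)) (\<lambda>r. cmean r (\<lambda>z. lnp (norm (?q z))))"
  proof (rule asym_leI)
    fix r assume r: "good r"
    have "cmean r (\<lambda>z. ln (norm (?q z))) \<le> cmean r (\<lambda>z. lnp (norm (?q z)))"
      using adm_good[OF assms(2) r] good_ge_1[OF r] assms(2) r
      by (intro cmean_mono adm_continuous_on_ln adm_continuous_on_lnp ln_le_lnp) auto
    thus "nav r (ordv ?q) \<le> cmean r (\<lambda>z. lnp (norm (?q z))) + (- jensen_const ?q)"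
      using adm_jensen[OF assms(2) r] by simp
  qed
  also have "asym_le \<Phi> \<dots> (\<lambda>_. 0)"
    by (rule log_derivative_asym[OF assms(1,3,4)])
  finally show ?thesis .
qed

text \<open>Nevanlinna's theorem for the values 0, \<open>-c\<close> and infinity. The divisor in
  the hypothesis on \<open>E\<close> is 1 at each zero, \<open>-c\<close>-point and pole, whatever
  the multiplicity, and minus the order of \<open>deriv F\<close> elsewhere. Its majorant is left to
  the caller, who can exploit multiplicities and ramification pointwise.\<close>

theorem second_main_theorem:
  assumes F: "adm F" "adm (\<lambda>z. F z + c)" "adm (deriv F)" and c: "c \<noteq> 0" and dom: "poly_dominated \<Phi> 1 F"
    and E: "loc_finite E" "\<And>z. zer F z + zer (\<lambda>z. F z + c) z - pol F z - ordv (deriv F) z \<le> E z"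
  shows   "asym_le \<Phi> (\<lambda>r. nchar r F) (\<lambda>r. nav r E)"
proof -
  let ?Fc = "\<lambda>z. F z + c"
  define J where "J = lnp (2 / norm c) + (lnp (norm c) + ln 2) + jensen_const F + jensen_const ?Fc - jensen_const (deriv F)"
  define S where "S = (\<lambda>r. cmean r (\<lambda>z. lnp (norm (deriv F z / F z))))"
  define Sc where "Sc = (\<lambda>r. cmean r (\<lambda>z. lnp (norm (deriv F z / ?Fc z))))"
  have S: "asym_le \<Phi> S (\<lambda>_. 0)"
    unfolding S_def by (rule log_derivative_asym[OF F(1) dom]) auto
  have Sc: "asym_le \<Phi> Sc (\<lambda>_. 0)"
    using log_derivative_asym[OF F(2) poly_dominated_add_const[OF F(1,2) dom]] by (simp add: Sc_def deriv_add_const)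
  have "asym_le \<Phi> (\<lambda>r. nchar r F) (\<lambda>r. nav r E + (S r + (S r + Sc r)))"
  proof (rule asym_leI)
    fix r assume r: "good r"
    have r1: "r \<ge> 1" using good_ge_1[OF r] .
    let ?i = "\<lambda>h. cmean r (\<lambda>z. lnp (norm (inverse (h z))))"
    have cont: "continuous_on (sphere 0 r) (\<lambda>z. lnp (norm (inverse (h z))))" if "adm h" for h
      using adm_continuous_on_lnp[OF adm_inverse[OF that] r] .
    have contd: "continuous_on (sphere 0 r) (\<lambda>z. lnp (norm (deriv F z / h z)))" if "adm h" for h
      using adm_continuous_on_lnp[OF adm_divide[OF F(3) that] r] .
    have "?i F + ?i ?Fc = cmean r (\<lambda>z. lnp (norm (inverse (F z))) + lnp (norm (inverse (F z + c))))"
      using r1 F by (intro cmean_add [symmetric] cont) auto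
    also have "\<dots> \<le> cmean r (\<lambda>z. lnp (norm (inverse (deriv F z))) +
                       (lnp (norm (deriv F z / F z)) + (lnp (norm (deriv F z / (F z + c))) + lnp (2 / norm c))))"
    proof (rule cmean_mono)
      fix z :: complex assume z: "norm z = r"
      have nz: "F z \<noteq> 0" "F z + c \<noteq> 0" "deriv F z \<noteq> 0"
        using adm_good[OF F(1) r z] adm_good[OF F(2) r z] adm_good[OF F(3) r z] by auto
      have split: "lnp (norm (inverse w)) \<le> lnp (norm (inverse (deriv F z))) + lnp (norm (deriv F z / w))" for w
      proof -
        have "inverse w = inverse (deriv F z) * (deriv F z / w)" using nz by (simp add: field_simps)
        hence "lnp (norm (inverse w)) = lnp (norm (inverse (deriv F z)) * norm (deriv F z / w))"
          by (simp only: norm_mult)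
        also have "\<dots> \<le> lnp (norm (inverse (deriv F z))) + lnp (norm (deriv F z / w))" by (rule lnp_mult_le) auto
        finally show ?thesis .
      qed
      have large: "lnp (norm (inverse w)) \<le> lnp (2 / norm c)" if "norm w \<ge> norm c / 2" for w :: complex
      proof (rule lnp_mono)
        have "inverse (norm w) \<le> inverse (norm c / 2)"
          using that c by (intro le_imp_inverse_le) auto
        thus "norm (inverse w) \<le> 2 / norm c" by (simp add: norm_inverse)
      qed
      \<comment> \<open>\<open>F z\<close> and \<open>F z + c\<close> cannot both be smaller than
        \<open>norm c / 2\<close>, so one of the two terms is bounded and only the other one is
        charged to \<open>inverse (deriv F)\<close>.\<close>
      have "norm c \<le> norm (F z + c) + norm (F z)"
        using norm_triangle_ineq4[of "F z + c" "F z"] by simp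
      then consider "norm (F z) \<ge> norm c / 2" | "norm (F z + c) \<ge> norm c / 2" by linarith
      thus "lnp (norm (inverse (F z))) + lnp (norm (inverse (F z + c))) \<le> lnp (norm (inverse (deriv F z))) +
                       (lnp (norm (deriv F z / F z)) + (lnp (norm (deriv F z / (F z + c))) + lnp (2 / norm c)))"
      proof cases
        case 1
        show ?thesis using large[OF 1] split[of "F z + c"] lnp_nonneg[of "norm (deriv F z / F z)"] by linarith
      next
        case 2
        show ?thesis using large[OF 2] split[of "F z"] lnp_nonneg[of "norm (deriv F z / (F z + c))"] by linarith
      qed
    qed (use r1 F in \<open>auto intro!: continuous_intros cont contd\<close>)
    also have "\<dots> = ?i (deriv F) + (S r + (Sc r + lnp (2 / norm c)))"
      using r1 F cont[OF F(3)] contd[OF F(1)] contd[OF F(2)] unfolding S_def Sc_def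
      by (subst cmean_add; (subst cmean_add)?; (subst cmean_add)?) (auto intro!: continuous_on_add)
    finally have main: "?i F + ?i ?Fc \<le> ?i (deriv F) + (S r + (Sc r + lnp (2 / norm c)))" .
    have sh: "nchar r F \<le> nchar r ?Fc + (lnp (norm c) + ln 2)"
      using nchar_add_const_le[of ?Fc "-c" r] F r by simp
    have d: "nchar r (deriv F) \<le> S r + (nchar r F - nav r (pol F)) + nav r (pol (deriv F))"
      using nchar_deriv_le[OF F(1,3) r] by (simp add: S_def nchar_def)
    note lf = loc_finite_zer[OF adm_mero[OF F(1)]] loc_finite_zer[OF adm_mero[OF F(2)]] loc_finite_pol[OF adm_mero[OF F(1)]]
              loc_finite_ordv[OF adm_mero[OF F(3)]]
    have "nav r (\<lambda>z. zer F z + zer ?Fc z - pol F z - ordv (deriv F) z) \<le> nav r E"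
      using E r1 lf by (intro nav_mono loc_finite_diff loc_finite_add) auto
    also have "nav r (\<lambda>z. zer F z + zer ?Fc z - pol F z - ordv (deriv F) z) =
                 nav r (zer F) + nav r (zer ?Fc) - nav r (pol F) - nav r (ordv (deriv F))"
      using lf by (simp add: nav_diff nav_add loc_finite_add loc_finite_diff)
    finally have "nav r (zer F) + nav r (zer ?Fc) - nav r (pol F) - (nav r (zer (deriv F)) - nav r (pol (deriv F))) \<le> nav r E"
      using nav_ordv[OF adm_mero[OF F(3)], of r] by simp
    thus "nchar r F \<le> nav r E + (S r + (S r + Sc r)) + J"
      using main sh d nav_zer[OF F(1) r] nav_zer[OF F(2) r] nav_zer[OF F(3) r] unfolding J_def by linarith
  qed
  also have "asym_le \<Phi> \<dots> (\<lambda>r. nav r E + (0 + (0 + 0)))"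
    by (intro asym_le_add S Sc asym_leI[of _ _ 0]) auto
  finally show ?thesis by simp
qed

end

section \<open>Local orders\<close>

text \<open>Quantifying over the shifts provides, for every value, a function to which orders and
  counting functions apply.\<close>

definition nonconst :: "(complex \<Rightarrow> complex) \<Rightarrow> bool" where
  "nonconst h \<longleftrightarrow> (\<forall>c. mero (\<lambda>z. h z + c))"

lemma nonconst_mero: "nonconst h \<Longrightarrow> mero (\<lambda>z. h z + c)" "nonconst h \<Longrightarrow> mero h"
  using spec[of "\<lambda>c. mero (\<lambda>z. h z + c)" 0] by (auto simp: nonconst_def)

lemma nonconst_mero_minus: "nonconst h \<Longrightarrow> mero (\<lambda>z. h z - c)"
  using nonconst_mero(1)[of h "-c"] by simp

lemma mero_cong:
  assumes "mero f" "g meromorphic_on UNIV" "\<And>z. eventually (\<lambda>w. f w = g w) (at z)"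
  shows   "mero g"
  unfolding mero_def
proof (intro conjI allI)
  fix z show "eventually (\<lambda>w. g w \<noteq> 0) (at z)"
    using mero_eventually[OF assms(1), of z] assms(3)[of z] by eventually_elim auto
qed fact

lemma nonconst_imp_mero_deriv:
  assumes h: "nonconst h"
  shows   "mero (deriv h)"
proof (rule meroI)
  show "\<not>(\<forall>\<^sub>\<approx>z\<in>UNIV. deriv h z = 0)"
  proof
    assume "\<forall>\<^sub>\<approx>z\<in>UNIV. deriv h z = 0"
    hence ev: "eventually (\<lambda>w. deriv h w = 0) (at z)" for z
      by (auto simp: eventually_cosparse_open_eq)
    have "eventually (\<lambda>w. h analytic_on {w}) (at 0)"
      using eventually_analytic_nonzero[OF nonconst_mero(2)[OF h], of 0] by eventually_elim auto
    then obtain z0 where "h analytic_on {z0}"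
      using eventually_happens[of _ "at (0::complex)"] by auto
    then obtain r where r: "r > 0" "h holomorphic_on ball z0 r"
      by (auto simp: analytic_on_def)
    have d0: "deriv h w = 0" if "w \<in> ball z0 r" for w
    proof -
      have "deriv h holomorphic_on ball z0 r" using r by (intro holomorphic_deriv) auto
      hence "isCont (deriv h) w"
        using that holomorphic_on_imp_continuous_on continuous_on_eq_continuous_at by blast
      hence "((deriv h) \<longlongrightarrow> deriv h w) (at w)" by (simp add: isCont_def)
      moreover have "((deriv h) \<longlongrightarrow> 0) (at w)" using ev[of w] by (rule tendsto_eventually)
      ultimately show ?thesis using tendsto_unique[of "at w"] by auto
    qed
    have const: "h w = h z0" if "w \<in> ball z0 r" for w
    proof -
      have "h constant_on ball z0 r"
      proof (rule has_field_derivative_0_imp_constant_on)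
        fix w assume "w \<in> ball z0 r"
        thus "(h has_field_derivative 0) (at w)"
          using holomorphic_derivI[OF r(2), of w] d0[of w] by auto
      qed auto
      thus ?thesis using that r by (auto simp: constant_on_def)
    qed
    have "eventually (\<lambda>w. w \<in> ball z0 r) (at z0)"
      using r by (intro eventually_at_in_open') auto
    moreover have "eventually (\<lambda>w. h w + (- h z0) \<noteq> 0) (at z0)"
      using h by (intro mero_eventually nonconst_mero)
    ultimately have "eventually (\<lambda>w. False) (at z0)"
      by eventually_elim (use const in auto)
    thus False by simp
  qed
qed (intro meromorphic_intros mero_meromorphic nonconst_mero h)

lemma mero_deriv_imp_nonconst:
  assumes h: "h meromorphic_on UNIV" "mero (deriv h)"
  shows   "nonconst h"
  unfolding nonconst_def
proof (intro allI meroI meromorphic_intros h)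
  fix c
  show "\<not>(\<forall>\<^sub>\<approx>z\<in>UNIV. h z + c = 0)"
  proof
    assume "\<forall>\<^sub>\<approx>z\<in>UNIV. h z + c = 0"
    hence "eventually (\<lambda>w. h w + c = 0) (at 0)"
      by (auto simp: eventually_cosparse_open_eq)
    then obtain A where A: "open A" "0 \<in> A" "\<And>w. w \<in> A - {0} \<Longrightarrow> h w + c = 0"
      by (auto simp: eventually_at_topological)
    have "eventually (\<lambda>w. w \<in> A - {0}) (at 0)" using A by (intro eventually_at_in_open) auto
    hence "eventually (\<lambda>w. deriv h w = 0) (at 0)"
    proof eventually_elim
      case (elim w)
      have "eventually (\<lambda>w. w \<in> A - {0}) (nhds w)"
        using elim A by (intro eventually_nhds_in_open) auto
      hence "eventually (\<lambda>w. h w = -c) (nhds w)"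
        by eventually_elim (use A in \<open>auto simp: eq_neg_iff_add_eq_0\<close>)
      hence "deriv h w = deriv (\<lambda>_. -c) w" by (intro deriv_cong_ev) auto
      thus ?case by simp
    qed
    with mero_eventually[OF h(2), of 0] have "eventually (\<lambda>w::complex. False) (at 0)"
      by eventually_elim auto
    thus False by simp
  qed
qed

lemma nicely_meromorphic_imp_nonconst:
  assumes "h nicely_meromorphic_on UNIV" "\<not>h constant_on UNIV"
  shows   "nonconst h"
  unfolding nonconst_def
proof (intro allI meroI meromorphic_intros)
  fix c
  have "\<not>(\<forall>x\<in>UNIV. h x = -c)" using assms(2) unfolding constant_on_def by blast
  hence "\<forall>\<^sub>\<approx>x\<in>UNIV. h x \<noteq> -c"
    using nicely_meromorphic_imp_constant_or_avoid[OF assms(1), of "-c"] by auto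
  show "\<not>(\<forall>\<^sub>\<approx>z\<in>UNIV. h z + c = 0)"
  proof
    assume "\<forall>\<^sub>\<approx>z\<in>UNIV. h z + c = 0"
    with \<open>\<forall>\<^sub>\<approx>x\<in>UNIV. h x \<noteq> -c\<close> have "\<forall>\<^sub>\<approx>z\<in>(UNIV :: complex set). False"
      by eventually_elim (auto simp: add_eq_0_iff2)
    thus False by simp
  qed
qed (use assms in \<open>auto simp: nicely_meromorphic_on_def\<close>)

lemma zorder_log_deriv:
  assumes X: "mero X" "mero (deriv X)"
  shows   "zorder (\<lambda>z. deriv X z / X z) z \<ge> -1"
          "zorder X z = 0 \<Longrightarrow> zorder (\<lambda>z. deriv X z / X z) z \<ge> 0"
proof -
  have eq: "zorder (\<lambda>z. deriv X z / X z) z = zorder (deriv X) z - zorder X z"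
    by (intro zorder_divide_mero X)
  show "zorder (\<lambda>z. deriv X z / X z) z \<ge> -1"
    using zorder_deriv_nonzero[OF X(1), of z] zorder_deriv_nonneg[OF X, of z] eq by (cases "zorder X z = 0") auto
  show "zorder (\<lambda>z. deriv X z / X z) z \<ge> 0" if "zorder X z = 0"
    using that zorder_deriv_nonneg[OF X, of z] eq by auto
qed

section \<open>Orders of logarithmic derivatives of quotients\<close>

lemma deriv_laurent_expansion:
  assumes "(\<lambda>w. f (z + w)) has_laurent_expansion L"
  shows   "(\<lambda>w. deriv f (z + w)) has_laurent_expansion fls_deriv L"
proof -
  have "deriv (\<lambda>w. f (z + w)) has_laurent_expansion fls_deriv L"
    using assms by (rule has_laurent_expansion_deriv)
  also have "deriv (\<lambda>w. f (z + w)) = (\<lambda>w. deriv f (z + w))"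
    by (simp add: deriv_shift_0' add_ac o_def fun_eq_iff)
  finally show ?thesis .
qed

lemma mero_laurent_expansion:
  assumes "mero f"
  obtains L where "(\<lambda>w. f (z + w)) has_laurent_expansion L" "L \<noteq> 0" "zorder f z = fls_subdegree L"
proof -
  obtain L where L: "(\<lambda>w. f (z + w)) has_laurent_expansion L"
    using mero_meromorphic[OF assms, of "{z}"] by (auto simp: meromorphic_on_def)
  have "L \<noteq> 0"
    using has_laurent_expansion_frequently_nonzero_iff[OF L] mero_frequently[OF assms] by blast
  thus ?thesis using L has_laurent_expansion_zorder[OF L] that by blast
qed

text \<open>At a common simple pole the derivatives \<open>f'\<close> and \<open>g'\<close> have double poles without residue, so
  their quotient \<open>W\<close> is \<open>w\<^sub>0 + O(t\<^sup>2)\<close>.\<close>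
lemma zorder_log_deriv_quotient_simple_poles:
  assumes f: "mero f" "zorder f z = -1" and g: "mero g" "zorder g z = -1"
    and fg': "mero (deriv f)" "mero (deriv g)"
  defines "W \<equiv> \<lambda>z. deriv f z / deriv g z"
  assumes W: "mero (deriv W)"
  shows   "zorder (\<lambda>z. deriv W z / W z) z \<ge> 1"
proof -
  obtain Lf where Lf: "(\<lambda>w. f (z + w)) has_laurent_expansion Lf" "Lf \<noteq> 0" "fls_subdegree Lf = -1"
    using mero_laurent_expansion[OF f(1)] f(2) by metis
  obtain Lg where Lg: "(\<lambda>w. g (z + w)) has_laurent_expansion Lg" "Lg \<noteq> 0" "fls_subdegree Lg = -1"
    using mero_laurent_expansion[OF g(1)] g(2) by metis
  have zf': "zorder (deriv f) z = -2" and zg': "zorder (deriv g) z = -2"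
    using zorder_deriv_nonzero[OF f(1), of z] zorder_deriv_nonzero[OF g(1), of z] f g by auto
  note Lf' = deriv_laurent_expansion[OF Lf(1)] and Lg' = deriv_laurent_expansion[OF Lg(1)]
  have nz: "fls_deriv Lf \<noteq> 0" "fls_deriv Lg \<noteq> 0"
    using has_laurent_expansion_frequently_nonzero_iff[OF Lf'] has_laurent_expansion_frequently_nonzero_iff[OF Lg']
          mero_frequently fg' by blast+
  have sub: "fls_subdegree (fls_deriv Lf) = -2" "fls_subdegree (fls_deriv Lg) = -2"
    using has_laurent_expansion_zorder[OF Lf' nz(1)] has_laurent_expansion_zorder[OF Lg' nz(2)] zf' zg' by auto
  define LW where "LW = fls_deriv Lf / fls_deriv Lg"
  have LW: "(\<lambda>w. W (z + w)) has_laurent_expansion LW"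
    unfolding W_def LW_def by (intro laurent_expansion_intros Lf' Lg')
  have "LW \<noteq> 0" using nz by (simp add: LW_def)
  have subW: "fls_subdegree LW = 0"
    using nz sub by (simp add: LW_def fls_divide_subdegree)
  have eq: "LW * fls_deriv Lg = fls_deriv Lf" using nz by (simp add: LW_def)
  \<comment> \<open>The coefficient of index -1 vanishes in both derivatives. The first summand
    therefore drops out, and the second forces \<open>fls_nth LW 1 = 0\<close>.\<close>
  have "fls_nth (LW * fls_deriv Lg) (-1) = fls_nth LW 0 * fls_nth (fls_deriv Lg) (-1) + fls_nth LW 1 * fls_nth (fls_deriv Lg) (-2)"
  proof -
    have "{-2..-1::int} = {-2, -1}" by auto
    thus ?thesis using subW sub by (simp add: fls_times_nth(1) add.commute)
  qed
  hence "fls_nth LW 1 * fls_nth (fls_deriv Lg) (-2) = 0"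
    unfolding eq by simp
  moreover have "fls_nth (fls_deriv Lg) (-2) \<noteq> 0"
    using nth_fls_subdegree_nonzero[OF nz(2)] sub by simp
  ultimately have LW1: "fls_nth LW 1 = 0" by simp
  note LW' = deriv_laurent_expansion[OF LW]
  have nzW: "fls_deriv LW \<noteq> 0"
    using has_laurent_expansion_frequently_nonzero_iff[OF LW'] mero_frequently[OF W] by blast
  have "fls_subdegree (fls_deriv LW) \<ge> 1"
  proof (rule fls_subdegree_geI[OF nzW])
    fix k :: int assume k: "k < 1"
    show "fls_nth (fls_deriv LW) k = 0"
    proof (cases "k = 0")
      case True thus ?thesis using LW1 by simp
    next
      case False
      show ?thesis
      proof (cases "k = -1")
        case False
        hence "fls_nth LW (k + 1) = 0" using k \<open>k \<noteq> 0\<close> subW by (intro fls_eq0_below_subdegree) auto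
        thus ?thesis by simp
      qed simp
    qed
  qed
  hence "zorder (deriv W) z \<ge> 1" using has_laurent_expansion_zorder[OF LW' nzW] by simp
  moreover have "zorder W z = 0" using has_laurent_expansion_zorder[OF LW \<open>LW \<noteq> 0\<close>] subW by simp
  moreover have "mero W" unfolding W_def by (intro mero_divide fg')
  ultimately show ?thesis using zorder_divide_mero[OF W \<open>mero W\<close>, of z] by simp
qed

text \<open>Rests on \<open>X'/X = f'/f - g'/g\<close>. It is meant for common zeros of
  \<open>u\<close> and \<open>v\<close>: there \<open>F + b\<close> and \<open>G + b\<close> have
  order 0 while their derivatives vanish to high order.\<close>

lemma zorder_log_deriv_quotient:
  assumes f: "mero f" "mero (deriv f)" and g: "mero g" "mero (deriv g)"
  defines "X \<equiv> \<lambda>z. f z / g z"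
  assumes X: "mero (deriv X)"
    and le: "zorder (deriv f) z - zorder f z \<ge> m" "zorder (deriv g) z - zorder g z \<ge> m"
  shows   "zorder (\<lambda>z. deriv X z / X z) z \<ge> m"
proof -
  have mX: "mero (\<lambda>z. deriv X z / X z)"
    using X f g unfolding X_def by (intro mero_divide)
  have ev: "eventually (\<lambda>w. deriv X w / X w = deriv f w / f w - deriv g w / g w) (at z)"
    using eventually_analytic_nonzero[OF f(1), of z] eventually_analytic_nonzero[OF g(1), of z]
  proof eventually_elim
    case (elim w)
    have "(f has_field_derivative deriv f w) (at w)" "(g has_field_derivative deriv g w) (at w)"
      using elim by (auto intro!: analytic_derivI)
    hence "(X has_field_derivative (deriv f w * g w - f w * deriv g w) / (g w * g w)) (at w)"
      unfolding X_def by (rule DERIV_divide) (use elim in auto)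
    hence "deriv X w = (deriv f w * g w - f w * deriv g w) / (g w * g w)"
      by (rule DERIV_imp_deriv)
    thus ?case using elim by (simp add: X_def field_simps)
  qed
  note mf = mero_divide[OF f(2,1)] and mg = mero_divide[OF g(2,1)]
  have "zorder (\<lambda>z. deriv f z / f z - deriv g z / g z) z \<ge> m"
  proof (rule zorder_diff_ge[OF mero_meromorphic[OF mf] mero_frequently[OF mf] mero_meromorphic[OF mg] mero_frequently[OF mg]])
    have "eventually (\<lambda>w. deriv f w / f w \<noteq> deriv g w / g w) (at z)"
      using ev mero_eventually[OF mX, of z] by eventually_elim auto
    thus "\<exists>\<^sub>F w in at z. deriv f w / f w \<noteq> deriv g w / g w" by (simp add: eventually_frequently)
  qed (use f g le in \<open>auto simp: zorder_divide_mero\<close>)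
  also have "zorder (\<lambda>z. deriv f z / f z - deriv g z / g z) z = zorder (\<lambda>z. deriv X z / X z) z"
    by (intro zorder_cong) (use ev in \<open>auto elim: eventually_mono\<close>)
  finally show ?thesis .
qed

lemma log_deriv_zero_imp_const:
  assumes X: "mero X" and nz: "\<not>mero (\<lambda>z. deriv X z / X z)"
  obtains A where "A \<noteq> 0" "\<forall>\<^sub>\<approx>z\<in>UNIV. X z = A"
proof -
  have "\<not>mero (deriv X)" using nz mero_divide[OF _ X] by blast
  hence "\<not>nonconst X" using nonconst_imp_mero_deriv by blast
  then obtain c where "\<not>mero (\<lambda>z. X z + c)" by (auto simp: nonconst_def)
  hence "\<forall>\<^sub>\<approx>z\<in>UNIV. X z + c = 0"
    using meroI[of "\<lambda>z. X z + c"] meromorphic_on_add[OF mero_meromorphic[OF X] meromorphic_on_const] by blast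
  hence *: "\<forall>\<^sub>\<approx>z\<in>UNIV. X z = -c" by eventually_elim (simp add: add_eq_0_iff2)
  have "c \<noteq> 0"
  proof
    assume "c = 0"
    with * have "eventually (\<lambda>z. X z = 0) (at 0)" by (auto simp: eventually_cosparse_open_eq)
    with mero_eventually[OF X, of 0] have "eventually (\<lambda>w::complex. False) (at 0)"
      by eventually_elim auto
    thus False by simp
  qed
  thus thesis using that[of "-c"] * by auto
qed

lemma deriv_zero_imp_const:
  assumes X: "X meromorphic_on UNIV" and z: "\<forall>\<^sub>\<approx>z\<in>UNIV. deriv X z = 0"
  obtains A where "\<forall>\<^sub>\<approx>z\<in>UNIV. X z = A"
proof -
  have "\<not>mero (deriv X)"
  proof
    assume "mero (deriv X)"
    note this[THEN mero_eventually, of 0]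
    moreover have "eventually (\<lambda>w. deriv X w = 0) (at 0)"
      using z by (auto simp: eventually_cosparse_open_eq)
    ultimately have "eventually (\<lambda>w::complex. False) (at 0)"
      by eventually_elim auto
    thus False by simp
  qed
  hence "\<not>nonconst X" using nonconst_imp_mero_deriv by blast
  then obtain c where "\<not>mero (\<lambda>z. X z + c)" by (auto simp: nonconst_def)
  hence "\<forall>\<^sub>\<approx>z\<in>UNIV. X z + c = 0"
    using meroI[of "\<lambda>z. X z + c"] meromorphic_on_add[OF X meromorphic_on_const] by blast
  hence "\<forall>\<^sub>\<approx>z\<in>UNIV. X z = -c" by eventually_elim (simp add: add_eq_0_iff2)
  thus thesis using that by blast
qed

section \<open>The polynomial without its constant term: local orders and characteristic\<close>

definition pow_shift :: "nat \<Rightarrow> complex \<Rightarrow> (complex \<Rightarrow> complex) \<Rightarrow> complex \<Rightarrow> complex" where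
  "pow_shift n a u = (\<lambda>z. u z ^ (n - 1) * (u z + a))"

lemma deriv_pow_shift:
  assumes "n \<ge> 2" "u analytic_on {z}"
  shows   "deriv (pow_shift n a u) z = u z ^ (n - 2) * (of_nat n * u z + of_nat (n - 1) * a) * deriv u z"
proof -
  obtain m where n: "n = m + 2" using assms(1) by (metis add.commute le_Suc_ex)
  have *: "of_nat m * (x ^ (m - Suc 0) * x) = of_nat m * x ^ m" for x :: complex
    by (cases m) auto
  have "(u has_field_derivative deriv u z) (at z)" using assms by (intro analytic_derivI) auto
  hence "(pow_shift n a u has_field_derivative u z ^ (n - 2) * (of_nat n * u z + of_nat (n - 1) * a) * deriv u z) (at z)"
    unfolding pow_shift_def n using * by (auto intro!: derivative_eq_intros) (cases m; simp add: algebra_simps)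
  thus ?thesis by (rule DERIV_imp_deriv)
qed

lemma pow_shift_nonconst:
  assumes u: "nonconst u" and n: "n \<ge> 2"
  shows   "mero (pow_shift n a u)" "mero (deriv (pow_shift n a u))" "nonconst (pow_shift n a u)"
proof -
  show mp: "mero (pow_shift n a u)"
    unfolding pow_shift_def by (intro mero_mult mero_power nonconst_mero u)
  have "mero (\<lambda>z. of_nat n * (u z + of_nat (n - 1) * a / of_nat n))"
    using n by (intro mero_mult mero_const nonconst_mero(1) u) auto
  also have "(\<lambda>z. of_nat n * (u z + of_nat (n - 1) * a / of_nat n)) = (\<lambda>z. of_nat n * u z + of_nat (n - 1) * a)"
    using n by (auto simp: field_simps fun_eq_iff)
  finally have "mero (\<lambda>z. of_nat n * u z + of_nat (n - 1) * a)" .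
  hence "mero (\<lambda>z. u z ^ (n - 2) * (of_nat n * u z + of_nat (n - 1) * a) * deriv u z)"
    by (intro mero_mult mero_power nonconst_mero(2)[OF u] nonconst_imp_mero_deriv[OF u])
  thus md: "mero (deriv (pow_shift n a u))"
  proof (rule mero_cong)
    fix z
    show "eventually (\<lambda>w. u w ^ (n - 2) * (of_nat n * u w + of_nat (n - 1) * a) * deriv u w = deriv (pow_shift n a u) w) (at z)"
      using eventually_analytic_nonzero[OF nonconst_mero(2)[OF u], of z]
      by eventually_elim (use deriv_pow_shift n in auto)
  qed (intro meromorphic_intros mero_meromorphic mp)
  show "nonconst (pow_shift n a u)"
    by (rule mero_deriv_imp_nonconst[OF mero_meromorphic[OF mp] md])
qed

text \<open>Sorts the points by their contribution \<open>D\<close> to the second main theorem. In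
  the case \<open>other\<close>, which contains the zeros of \<open>u + a\<close> and the remaining
  ramification points, \<open>D\<close> is given exactly and not just bounded, because there the
  order of \<open>deriv F\<close> must later compensate a pole of \<open>H\<close>.\<close>

lemma pow_shift_local_cases:
  fixes F :: "complex \<Rightarrow> complex"
  assumes u: "nonconst u" and n: "n \<ge> 2" and a: "a \<noteq> 0" and b: "b \<noteq> 0"
    and mult: "zorder u z < 0 \<longrightarrow> zorder u z \<le> -2"
  defines "F \<equiv> pow_shift n a u"
  defines "D \<equiv> zer F z + zer (\<lambda>z. F z + b) z - pol F z - ordv (deriv F) z"
  obtains (zero) "zorder u z > 0" "D = 1" "zorder (\<lambda>z. F z + b) z = 0"
      "zorder (deriv F) z = int (n - 1) * zorder u z - 1" "zorder F z > 0" "zorder (\<lambda>z. u z + a) z = 0"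
  | (one) "zorder u z = 0" "D = 1" "zorder (\<lambda>z. F z + b) z > 0"
      "zorder (deriv F) z = zorder (\<lambda>z. F z + b) z - 1" "zorder F z = 0" "zorder (\<lambda>z. u z + a) z = 0"
  | (pole) "zorder u z \<le> -2" "D = 1" "zorder (\<lambda>z. F z + b) z = int n * zorder u z"
      "zorder F z = int n * zorder u z"
      "zorder (\<lambda>z. u z + a) z = zorder u z"
  | (other) "zorder u z = 0" "zorder (\<lambda>z. F z + b) z = 0" "zorder (\<lambda>z. u z + a) z \<ge> 0"
      "zorder (deriv F) z \<ge> 0" "D = of_int (zorder (\<lambda>z. u z + a) z) - of_int (zorder (deriv F) z)"
      "zorder F z = zorder (\<lambda>z. u z + a) z" "D \<le> 1"
proof -
  note F = pow_shift_nonconst[OF u n, of a, folded F_def]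
  have oF: "zorder F z = int (n - 1) * zorder u z + zorder (\<lambda>z. u z + a) z"
    unfolding F_def pow_shift_def using u
    by (subst zorder_mult_mero) (auto intro!: mero_power nonconst_mero(1) simp: zorder_power_mero nonconst_mero(2))
  note ua = zorder_add_const[OF nonconst_mero(2)[OF u] nonconst_mero(1)[OF u] a, of z]
  note Fb = zorder_add_const[OF F(1) nonconst_mero(1)[OF F(3)] b, of z]
  note d1 = zorder_deriv_nonzero[OF F(1), of z]
  note d2 = zorder_deriv_nonzero[OF nonconst_mero(1)[OF F(3)], of b z, unfolded deriv_add_const]
  note d3 = zorder_deriv_nonneg[OF F(1,2), of z]
  consider "zorder u z < 0" | "zorder u z = 0" | "zorder u z > 0" by linarith
  thus thesis
  proof cases
    case 1
    hence a': "zorder (\<lambda>z. u z + a) z = zorder u z" using ua by auto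
    have oF': "zorder F z = int n * zorder u z"
      unfolding oF a' using n by (simp add: of_nat_diff algebra_simps)
    hence neg: "zorder F z < 0" using 1 n by (simp add: mult_pos_neg)
    with Fb have ob: "zorder (\<lambda>z. F z + b) z = zorder F z" by auto
    have "D = 1" using neg ob d1 by (simp add: D_def zer_def pol_def ordv_def)
    thus thesis using mult 1 that(3) ob oF' a' by auto
  next
    case 3
    hence a': "zorder (\<lambda>z. u z + a) z = 0" using ua by auto
    have pos: "zorder F z > 0" unfolding oF a' using 3 n by simp
    with Fb have ob: "zorder (\<lambda>z. F z + b) z = 0" by auto
    have D1: "D = 1" using pos ob d1 by (simp add: D_def zer_def pol_def ordv_def)
    have "zorder (deriv F) z = zorder F z - 1" using pos by (intro d1) auto
    also have "zorder F z = int (n - 1) * zorder u z" unfolding oF a' by simp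
    finally show thesis by (rule that(1)[OF 3 D1 ob _ pos a'])
  next
    case 2
    hence a': "zorder (\<lambda>z. u z + a) z \<ge> 0" "zorder F z = zorder (\<lambda>z. u z + a) z" using ua oF by auto
    show thesis
    proof (cases "zorder (\<lambda>z. F z + b) z > 0")
      case True
      hence "zorder F z = 0" using Fb by auto
      moreover have "D = 1" using True calculation d2 by (simp add: D_def zer_def pol_def ordv_def)
      ultimately show thesis using that(2) True d2 2 a' by auto
    next
      case False
      hence ob: "zorder (\<lambda>z. F z + b) z = 0" using Fb a' by auto
      have "D = of_int (zorder (\<lambda>z. u z + a) z) - of_int (zorder (deriv F) z)"
        using ob a' by (simp add: D_def zer_def pol_def ordv_def)
      moreover have "D \<le> 1"
        unfolding calculation using d1 d3 a' by (cases "zorder F z = 0") auto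
      ultimately show thesis using that(4) 2 ob a' d3 by auto
    qed
  qed
qed

lemma lnp_norm_pow_shift_upper:
  fixes w a :: complex
  assumes "n \<ge> 1"
  shows "lnp (norm (w ^ (n - 1) * (w + a))) \<le> n * lnp (norm w) + (lnp (norm a) + ln 2)"
proof -
  have "lnp (norm (w ^ (n - 1) * (w + a))) \<le> lnp (norm w ^ (n - 1)) + lnp (norm (w + a))"
    unfolding norm_mult norm_power by (rule lnp_mult_le) auto
  also have "lnp (norm w ^ (n - 1)) = real (n - 1) * lnp (norm w)" by (intro lnp_power) auto
  also have "lnp (norm (w + a)) \<le> lnp (norm w + norm a)" by (intro lnp_mono norm_triangle_ineq)
  also have "\<dots> \<le> lnp (norm w) + lnp (norm a) + ln 2" by (intro lnp_add_le) auto
  also have "real (n - 1) * lnp (norm w) + (lnp (norm w) + lnp (norm a) + ln 2) = n * lnp (norm w) + (lnp (norm a) + ln 2)"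
    using assms by (simp add: of_nat_diff algebra_simps)
  finally show ?thesis by simp
qed

text \<open>Beyond the threshold \<open>2 + 2 * norm a\<close> one has
  \<open>norm (w + a) \<ge> norm w / 2\<close>; below it the constant alone suffices.\<close>

lemma lnp_norm_pow_shift_lower:
  fixes w a :: complex
  assumes "n \<ge> 1"
  shows "n * lnp (norm w) \<le> lnp (norm (w ^ (n - 1) * (w + a))) + n * lnp (2 + 2 * norm a)"
proof (cases "norm w \<le> 2 + 2 * norm a")
  case True
  hence "n * lnp (norm w) \<le> n * lnp (2 + 2 * norm a)" by (intro mult_left_mono lnp_mono) auto
  thus ?thesis using lnp_nonneg[of "norm (w ^ (n - 1) * (w + a))"] by linarith
next
  case False
  have "norm w - norm a \<le> norm (w + a)" using norm_diff_ineq[of w a] by simp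
  hence wa: "norm (w + a) \<ge> norm w / 2" using False by simp
  have "norm w ^ n = norm w ^ (n - 1) * norm w"
    using assms by (metis One_nat_def Suc_pred le_simps(3) power_Suc2 zero_less_Suc less_le_trans)
  also have "\<dots> = norm w ^ (n - 1) * (norm w / 2) * 2" by simp
  also have "\<dots> \<le> norm w ^ (n - 1) * norm (w + a) * 2"
    using wa by (intro mult_right_mono mult_left_mono) auto
  finally have "lnp (norm w ^ n) \<le> lnp (norm (w ^ (n - 1) * (w + a)) * 2)"
    unfolding norm_mult norm_power by (rule lnp_mono)
  also have "\<dots> \<le> lnp (norm (w ^ (n - 1) * (w + a))) + lnp 2" by (intro lnp_mult_le) auto
  also have "lnp (norm w ^ n) = n * lnp (norm w)" by (rule lnp_power) auto
  also have "lnp 2 \<le> lnp (2 + 2 * norm a)" by (intro lnp_mono) auto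
  also have "\<dots> \<le> n * lnp (2 + 2 * norm a)"
    using assms mult_right_mono[of 1 "real n" "lnp (2 + 2 * norm a)"] by simp
  finally show ?thesis by simp
qed

context circles
begin

lemma pol_pow_shift:
  assumes u: "nonconst u" and n: "n \<ge> 2"
  shows   "pol (pow_shift n a u) = (\<lambda>z. n * pol u z)"
proof
  fix z
  have oF: "zorder (pow_shift n a u) z = int (n - 1) * zorder u z + zorder (\<lambda>z. u z + a) z"
    unfolding pow_shift_def using u
    by (subst zorder_mult_mero) (auto intro!: mero_power nonconst_mero(1) simp: zorder_power_mero nonconst_mero(2))
  show "pol (pow_shift n a u) z = n * pol u z"
  proof (cases "a = 0")
    case True
    hence "zorder (pow_shift n a u) z = int n * zorder u z"
      using oF n by (simp add: of_nat_diff algebra_simps)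
    hence "ordv (pow_shift n a u) z = n * ordv u z" by (simp add: ordv_def)
    thus ?thesis by (simp add: pol_def max_mult_distrib_left max_def mult_le_0_iff zero_le_mult_iff)
  next
    case False
    note ua = zorder_add_const[OF nonconst_mero(2)[OF u] nonconst_mero(1)[OF u] False, of z]
    consider "zorder u z < 0" | "zorder u z \<ge> 0" by linarith
    thus ?thesis
    proof cases
      case 1
      hence "zorder (pow_shift n a u) z = int n * zorder u z"
        using ua oF n by (auto simp add: of_nat_diff algebra_simps)
      thus ?thesis using 1 by (simp add: pol_def ordv_def mult_nonneg_nonpos)
    next
      case 2
      hence "zorder (pow_shift n a u) z \<ge> 0" unfolding oF using ua by (intro add_nonneg_nonneg mult_nonneg_nonneg) auto
      thus ?thesis using 2 by (simp add: pol_def ordv_def)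
    qed
  qed
qed

lemma nchar_pow_shift:
  assumes u: "nonconst u" "adm u" "adm (pow_shift n a u)" and n: "n \<ge> 2" and r: "good r"
  shows   "nchar r (pow_shift n a u) \<le> n * nchar r u + (lnp (norm a) + ln 2)"
          "n * nchar r u \<le> nchar r (pow_shift n a u) + n * lnp (2 + 2 * norm a)"
proof -
  have r1: "r \<ge> 0" using good_ge_1[OF r] by simp
  note c = adm_continuous_on_lnp[OF u(2) r] adm_continuous_on_lnp[OF u(3) r]
  have "cmean r (\<lambda>z. lnp (norm (pow_shift n a u z))) \<le> cmean r (\<lambda>z. n * lnp (norm (u z)) + (lnp (norm a) + ln 2))"
    using r1 c n lnp_norm_pow_shift_upper[of n _ a] by (intro cmean_mono) (auto simp: pow_shift_def intro!: continuous_intros)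
  also have "\<dots> = n * cmean r (\<lambda>z. lnp (norm (u z))) + (lnp (norm a) + ln 2)"
    using r1 c by (subst cmean_add) (auto intro!: continuous_intros simp: cmean_cmul)
  finally show "nchar r (pow_shift n a u) \<le> n * nchar r u + (lnp (norm a) + ln 2)"
    using n by (simp add: nchar_def pol_pow_shift[OF u(1)] nav_cmult algebra_simps)
  have "cmean r (\<lambda>z. n * lnp (norm (u z))) \<le> cmean r (\<lambda>z. lnp (norm (pow_shift n a u z)) + n * lnp (2 + 2 * norm a))"
    using r1 c n lnp_norm_pow_shift_lower[of n _ a] by (intro cmean_mono) (auto simp: pow_shift_def intro!: continuous_intros)
  also have "\<dots> = cmean r (\<lambda>z. lnp (norm (pow_shift n a u z))) + n * lnp (2 + 2 * norm a)"
    using r1 c by (subst cmean_add) (auto intro!: continuous_intros)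
  finally show "n * nchar r u \<le> nchar r (pow_shift n a u) + n * lnp (2 + 2 * norm a)"
    using n by (simp add: nchar_def pol_pow_shift[OF u(1)] nav_cmult cmean_cmul algebra_simps)
qed

end

section \<open>The generic case\<close>

definition singular_radii :: "(complex \<Rightarrow> complex) \<Rightarrow> real set" where
  "singular_radii h = norm ` {z. \<not>(h analytic_on {z} \<and> h z \<noteq> 0)}"

text \<open>Each counting argument fixes in advance the finitely many functions it integrates, which
  explains the long sets in the applications; finitely many countable sets of singular radii remain
  countable.\<close>

lemma exists_circles:
  assumes "finite Fs" "\<And>h. h \<in> Fs \<Longrightarrow> mero h"
  obtains B where "circles B" "\<And>h. h \<in> Fs \<Longrightarrow> circles.adm B h"
proof -
  define B where "B = (\<Union>h\<in>Fs. singular_radii h)"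
  have "countable B"
    unfolding B_def singular_radii_def using assms
    by (intro countable_UN countable_image countable_singular_points countable_finite) auto
  then interpret circles B by unfold_locales
  show thesis
  proof (rule that[of B])
    fix h assume h: "h \<in> Fs"
    show "adm h" unfolding adm_def
    proof (intro conjI allI impI)
      fix z :: complex assume "norm z \<notin> B"
      hence "norm z \<notin> singular_radii h" using h by (auto simp: B_def)
      thus "h analytic_on {z}" "h z \<noteq> 0" unfolding singular_radii_def by blast+
    qed (use assms h in auto)
  qed unfold_locales
qed

text \<open>Any point of analyticity provides a value that is taken; this is all that the
  unboundedness of the characteristic requires.\<close>

lemma nonconst_takes_value:
  assumes "nonconst h"
  obtains c z0 where "zorder (\<lambda>z. h z + c) z0 > 0"
proof -
  have "eventually (\<lambda>w. h analytic_on {w}) (at 0)"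
    using eventually_analytic_nonzero[OF nonconst_mero(2)[OF assms], of 0] by eventually_elim auto
  then obtain z0 where z0: "h analytic_on {z0}"
    using eventually_happens[of _ "at (0::complex)"] by auto
  have "zorder (\<lambda>z. h z + (- h z0)) z0 > 0"
    using z0 mero_frequently[OF nonconst_mero(1)[OF assms], of "- h z0" z0]
    by (subst zorder_pos_iff') (auto intro!: analytic_intros)
  thus thesis by (rule that)
qed

lemma zorder_deriv_inverse:
  assumes f: "mero f" "mero (deriv f)"
  shows   "zorder (deriv (\<lambda>z. inverse (f z))) z = zorder (deriv f) z - 2 * zorder f z"
          "mero (deriv (\<lambda>z. inverse (f z)))"
proof -
  define q where "q = (\<lambda>z. (-1) * (deriv f z / f z ^ 2))"
  have ev: "eventually (\<lambda>w. q w = deriv (\<lambda>z. inverse (f z)) w) (at z)" for z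
    using eventually_analytic_nonzero[OF f(1), of z]
  proof eventually_elim
    case (elim w)
    have "(f has_field_derivative deriv f w) (at w)" using elim by (auto intro!: analytic_derivI)
    hence "((\<lambda>z. inverse (f z)) has_field_derivative -(inverse (f w) * deriv f w * inverse (f w))) (at w)"
      by (rule DERIV_inverse') (use elim in auto)
    thus ?case by (simp add: q_def DERIV_imp_deriv power2_eq_square divide_inverse mult_ac)
  qed
  have q: "mero q" unfolding q_def using f by (intro mero_mult mero_const mero_divide mero_power) auto
  show "mero (deriv (\<lambda>z. inverse (f z)))"
    by (rule mero_cong[OF q _ ev]) (intro meromorphic_intros mero_meromorphic f)
  have "zorder (deriv (\<lambda>z. inverse (f z))) z = zorder q z"
    by (rule zorder_cong) (use ev[of z] in \<open>auto elim: eventually_mono\<close>)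
  also have "\<dots> = zorder (deriv f) z - 2 * zorder f z"
    unfolding q_def using f
    by (subst zorder_mult_mero) (auto intro!: mero_const mero_divide mero_power simp: zorder_divide_mero zorder_power_mero mero_power)
  finally show "zorder (deriv (\<lambda>z. inverse (f z))) z = zorder (deriv f) z - 2 * zorder f z" .
qed

text \<open>What weighted sharing of \<open>0\<close> and of the roots of \<open>w\<^sup>n + a w\<^sup>n\<^sup>-\<^sup>1 + b\<close> amounts to for the local orders.\<close>
locale sharing_pair =
  fixes n :: nat and a b :: complex and u v :: "complex \<Rightarrow> complex"
  assumes n: "n \<ge> 5" and a: "a \<noteq> 0" and b: "b \<noteq> 0"
    and u: "nonconst u" and v: "nonconst v"
    and mult_u: "\<And>z. zorder u z < 0 \<longrightarrow> zorder u z \<le> -2"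
    and mult_v: "\<And>z. zorder v z < 0 \<longrightarrow> zorder v z \<le> -2"
    and share0: "\<And>z. min (nat (zorder u z)) 2 = min (nat (zorder v z)) 2"
    and share1: "\<And>z. min (nat (zorder (\<lambda>z. pow_shift n a u z + b) z)) 3 = min (nat (zorder (\<lambda>z. pow_shift n a v z + b) z)) 3"
begin

lemma n2: "n \<ge> 2" using n by simp

abbreviation (input) F :: "complex \<Rightarrow> complex" where "F \<equiv> pow_shift n a u"
abbreviation (input) G :: "complex \<Rightarrow> complex" where "G \<equiv> pow_shift n a v"
abbreviation (input) Fb :: "complex \<Rightarrow> complex" where "Fb \<equiv> \<lambda>z. pow_shift n a u z + b"
abbreviation (input) Gb :: "complex \<Rightarrow> complex" where "Gb \<equiv> \<lambda>z. pow_shift n a v z + b"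

lemma meros:
  "mero u" "mero v" "mero (\<lambda>z. u z + c)" "mero (\<lambda>z. v z + c)" "mero F" "mero G" "mero (\<lambda>z. F z + c)" "mero (\<lambda>z. G z + c)"
  "mero (deriv F)" "mero (deriv G)" "mero (deriv u)" "mero (deriv v)"
  using nonconst_mero[OF u] nonconst_mero[OF v] pow_shift_nonconst[OF u n2] pow_shift_nonconst[OF v n2]
    nonconst_mero(1)[OF pow_shift_nonconst(3)[OF u n2]] nonconst_mero(1)[OF pow_shift_nonconst(3)[OF v n2]]
    nonconst_imp_mero_deriv[OF u] nonconst_imp_mero_deriv[OF v] by auto

definition f where "f = (\<lambda>z. inverse (F z + b))"
definition g where "g = (\<lambda>z. inverse (G z + b))"
definition W where "W = (\<lambda>z. deriv f z / deriv g z)"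
definition H where "H = (\<lambda>z. deriv W z / W z)"
definition X where "X = (\<lambda>z. (F z + b) / (G z + b))"
definition \<phi> where "\<phi> = (\<lambda>z. deriv X z / X z)"

lemma meros2: "mero f" "mero g" "mero (deriv f)" "mero (deriv g)" "mero W" "mero X"
proof -
  have d: "mero (deriv (\<lambda>z. F z + b))" "mero (deriv (\<lambda>z. G z + b))" using meros by (simp_all add: deriv_add_const)
  show "mero f" "mero g" unfolding f_def g_def by (intro mero_inverse meros)+
  show fg: "mero (deriv f)" "mero (deriv g)" unfolding f_def g_def
    using zorder_deriv_inverse(2)[OF _ d(1)] zorder_deriv_inverse(2)[OF _ d(2)] meros by auto
  show "mero W" unfolding W_def by (intro mero_divide fg)
  show "mero X" unfolding X_def by (intro mero_divide meros)
qed

lemma zorder_f: "zorder f z = - zorder Fb z" "zorder g z = - zorder Gb z"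
  unfolding f_def g_def using meros by (auto simp: zorder_inverse_mero)

lemma zorder_W: "zorder W z = (zorder (deriv F) z - 2 * zorder Fb z) - (zorder (deriv G) z - 2 * zorder Gb z)"
proof -
  have d: "mero (deriv (\<lambda>z. F z + b))" "mero (deriv (\<lambda>z. G z + b))" using meros by (simp_all add: deriv_add_const)
  have "zorder W z = zorder (deriv f) z - zorder (deriv g) z"
    unfolding W_def by (intro zorder_divide_mero meros2)
  thus ?thesis
    unfolding f_def g_def using zorder_deriv_inverse(1)[OF _ d(1), of z] zorder_deriv_inverse(1)[OF _ d(2), of z] meros
    by (simp add: deriv_add_const)
qed

lemma zorder_X: "zorder X z = zorder Fb z - zorder Gb z"
  unfolding X_def by (intro zorder_divide_mero meros)

lemma share_cases:
  "zorder u z > 0 \<longleftrightarrow> zorder v z > 0" "zorder u z = 1 \<longleftrightarrow> zorder v z = 1"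
  "zorder Fb z > 0 \<longleftrightarrow> zorder Gb z > 0" "zorder Fb z = 1 \<longleftrightarrow> zorder Gb z = 1" "zorder Fb z = 2 \<longleftrightarrow> zorder Gb z = 2"
  using share0[of z] share1[of z] by (auto simp: min_def split: if_splits)

definition D :: "(complex \<Rightarrow> complex) \<Rightarrow> complex \<Rightarrow> real" where
  "D w z = zer (pow_shift n a w) z + zer (\<lambda>z. pow_shift n a w z + b) z - pol (pow_shift n a w) z - ordv (deriv (pow_shift n a w)) z"

text \<open>The weight \<open>\<kappa>\<close> makes the contribution of common simple zeros of \<open>u\<close> and \<open>v\<close> vanish. The constant
  11/21 is dictated by common points of \<open>F + b = 0\<close> with multiplicities 3 and 4 for \<open>n = 5\<close>, where
  the left-hand side minus the auxiliary terms can reach \<open>3 + \<kappa> = 7 * 11/21\<close>.\<close>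
lemma pointwise_estimate:
  assumes H: "mero H" and \<phi>: "mero \<phi>"
  defines "\<kappa> \<equiv> 2 / (real n - 2)"
  shows "D u z + D v z \<le> 11/21 * (zer Fb z + zer Gb z) + (zer (\<lambda>z. u z + a) z + zer (\<lambda>z. v z + a) z) +
           (1 + \<kappa> / 2) * (pol u z + pol v z) + (ordv H z + \<kappa> * ordv \<phi> z)"
proof -
  have l: "0 < \<kappa>" "\<kappa> \<le> 2/3" "\<kappa> * (real n - 2) = 2"
    using n by (auto simp: \<kappa>_def field_simps)
  have dW: "mero (deriv W)"
  proof (rule mero_cong[OF mero_mult[OF H meros2(5)]])
    show "eventually (\<lambda>w. H w * W w = deriv W w) (at z)" for z
      using mero_eventually[OF meros2(5), of z] by eventually_elim (auto simp: H_def)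
  qed (intro meromorphic_intros mero_meromorphic meros2)
  have dX: "mero (deriv X)"
  proof (rule mero_cong[OF mero_mult[OF \<phi> meros2(6)]])
    show "eventually (\<lambda>w. \<phi> w * X w = deriv X w) (at z)" for z
      using mero_eventually[OF meros2(6), of z] by eventually_elim (auto simp: \<phi>_def)
  qed (intro meromorphic_intros mero_meromorphic meros2)
  have H1: "ordv H z \<ge> -1" and H0: "zorder W z = 0 \<Longrightarrow> ordv H z \<ge> 0"
    using zorder_log_deriv[OF meros2(5) dW, of z, folded H_def] unfolding ordv_def by linarith+
  have \<phi>1: "ordv \<phi> z \<ge> -1" and \<phi>0: "zorder X z = 0 \<Longrightarrow> ordv \<phi> z \<ge> 0"
    using zorder_log_deriv[OF meros2(6) dX, of z, folded \<phi>_def] unfolding ordv_def by linarith+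
  define Q where "Q = \<kappa> * ordv \<phi> z"
  define Pu where "Pu = (1 + \<kappa> / 2) * pol u z"
  define Pv where "Pv = (1 + \<kappa> / 2) * pol v z"
  have \<phi>1': "Q \<ge> - \<kappa>" using mult_left_mono[OF \<phi>1, of \<kappa>] l by (simp add: Q_def)
  have \<phi>0': "Q \<ge> 0" if "zorder X z = 0" using \<phi>0[OF that] l by (simp add: Q_def)
  have nonneg: "zer q z \<ge> 0" "pol q z \<ge> 0" for q by (auto simp: zer_def pol_def)
  note nn = nonneg(1)[of Fb] nonneg(1)[of Gb] nonneg(1)[of "\<lambda>z. u z + a"] nonneg(1)[of "\<lambda>z. v z + a"]
  have pnn: "Pu \<ge> 0" "Pv \<ge> 0" unfolding Pu_def Pv_def using nonneg l by (intro mult_nonneg_nonneg add_nonneg_nonneg; simp)+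
  have pole_le: "(1 + \<kappa> / 2) * pol w z \<ge> 2 + \<kappa>" if "zorder w z \<le> -2" for w
  proof -
    have "(1 + \<kappa> / 2) * 2 \<le> (1 + \<kappa> / 2) * pol w z"
      using that l by (intro mult_left_mono) (auto simp: pol_def ordv_def)
    thus ?thesis by simp
  qed
  note pole_u = pole_le[of u, folded Pu_def] and pole_v = pole_le[of v, folded Pv_def]
  have "D u z + D v z \<le> 11/21 * zer Fb z + 11/21 * zer Gb z + (zer (\<lambda>z. u z + a) z + zer (\<lambda>z. v z + a) z) +
           (Pu + Pv) + (ordv H z + Q)"
  proof (cases rule: pow_shift_local_cases[OF u n2 a b mult_u[of z], folded D_def, case_names zero one pole other])
    case zu: zero
    show ?thesis
    proof (cases rule: pow_shift_local_cases[OF v n2 a b mult_v[of z], folded D_def, case_names zero one pole other])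
      case zv: zero
      show ?thesis
      proof (cases "zorder u z = 1")
        case True
        hence p1: "zorder u z = 1" "zorder v z = 1" using share_cases[of z] by auto
        \<comment> \<open>At a simple zero \<open>deriv F\<close> has order
          \<open>(n - 1) - 1\<close>. Weighted with \<open>\<kappa>\<close> this yields 2, exactly
          the charge \<open>D u z + D v z\<close>, while equal orders keep \<open>H\<close> free of
          a pole.\<close>
        have "zorder \<phi> z \<ge> int n - 2"
          unfolding \<phi>_def X_def
          by (rule zorder_log_deriv_quotient) (use meros dX zu zv p1 n in \<open>auto simp: deriv_add_const X_def of_nat_diff\<close>)
        hence "ordv \<phi> z \<ge> real n - 2" unfolding ordv_def by linarith
        hence "Q \<ge> 2" using mult_left_mono[of "real n - 2" "ordv \<phi> z" \<kappa>] l unfolding Q_def by linarith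
        moreover have "ordv H z \<ge> 0" using zu zv p1 by (intro H0) (simp add: zorder_W)
        ultimately show ?thesis using zu(2) zv(2) nn pnn by linarith
      next
        case False
        hence p2: "zorder u z \<ge> 2" "zorder v z \<ge> 2" using share_cases[of z] zu zv by auto
        have *: "int (n - 1) * 2 \<le> int (n - 1) * zorder u z" "int (n - 1) * 2 \<le> int (n - 1) * zorder v z"
          using p2 by (intro mult_left_mono; simp)+
        \<comment> \<open>Weight 1 no longer determines the multiplicities, so \<open>H\<close> may
          have a pole; twice \<open>n - 2\<close> yields 4, which covers the charge 2 and that
          pole.\<close>
        have "zorder \<phi> z \<ge> 2 * int n - 4"
          unfolding \<phi>_def X_def
          by (rule zorder_log_deriv_quotient) (use meros dX zu zv * n in \<open>auto simp: deriv_add_const X_def of_nat_diff\<close>)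
        hence "real_of_int (2 * int n - 4) \<le> ordv \<phi> z" unfolding ordv_def by (simp only: of_int_le_iff)
        hence "ordv \<phi> z \<ge> 2 * (real n - 2)" by simp
        hence "Q \<ge> 4" using mult_left_mono[of "2 * (real n - 2)" "ordv \<phi> z" \<kappa>] l unfolding Q_def by linarith
        thus ?thesis using zu(2) zv(2) nn pnn H1 by linarith
      qed
    qed (use zu share_cases[of z] in auto)
  next
    case ou: one
    show ?thesis
    proof (cases rule: pow_shift_local_cases[OF v n2 a b mult_v[of z], folded D_def, case_names zero one pole other])
      case ov: one
      have zr: "zer Fb z = of_int (zorder Fb z)" "zer Gb z = of_int (zorder Gb z)"
        using ou ov by (auto simp: zer_def ordv_def)
      show ?thesis
      proof (cases "zorder Fb z = zorder Gb z")
        case True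
        have h0: "ordv H z \<ge> 0" using ou ov True by (intro H0) (simp add: zorder_W)
        have p0: "Q \<ge> 0" using True by (intro \<phi>0') (simp add: zorder_X)
        show ?thesis
        proof (cases "zorder Fb z = 1")
          case t: True
          \<comment> \<open>Two simple points contribute only 22/21 to the right-hand side; the zero
            of \<open>H\<close> supplies the rest of the charge 2. From multiplicity 2 on, 44/21 is
            enough.\<close>
          have "zorder H z \<ge> 1"
            unfolding H_def W_def
            by (rule zorder_log_deriv_quotient_simple_poles) (use True t meros2 dW in \<open>auto simp: zorder_f W_def\<close>)
          hence "ordv H z \<ge> 1" unfolding ordv_def by linarith
          moreover have "zer Fb z = 1" "zer Gb z = 1" using zr True t by auto
          ultimately show ?thesis using ou(2) ov(2) nn pnn p0 by linarith
        next
          case False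
          hence "zorder Fb z \<ge> 2" using ou by auto
          hence "zer Fb z \<ge> 2" "zer Gb z \<ge> 2" using zr True by auto
          hence "11/21 * zer Fb z + 11/21 * zer Gb z \<ge> 2" by simp
          thus ?thesis using ou(2) ov(2) nonneg[of "\<lambda>z. u z + a"] nonneg[of "\<lambda>z. v z + a"] pnn p0 h0 by linarith
        qed
      next
        case False
        \<comment> \<open>Weight 2 makes unequal multiplicities both at least 3. The total charge is
          the 2 from \<open>D\<close>, at most 1 from \<open>H\<close> and at most
          \<open>\<kappa>\<close> from \<open>\<phi>\<close>.\<close>
        hence "zorder Fb z + zorder Gb z \<ge> 7" using ou(3) ov(3) share_cases(4,5)[of z] by linarith
        hence "11/21 * zer Fb z + 11/21 * zer Gb z \<ge> 11/3" unfolding zr by linarith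
        thus ?thesis using ou(2) ov(2) nonneg[of "\<lambda>z. u z + a"] nonneg[of "\<lambda>z. v z + a"] pnn \<phi>1' H1 l by linarith
      qed
    qed (use ou share_cases[of z] n in \<open>auto simp: mult_pos_neg zero_less_mult_iff\<close>)
  next
    case pu: pole
    have neg: "int n * zorder u z < 0" using pu n by (intro mult_pos_neg) auto
    show ?thesis
    proof (cases rule: pow_shift_local_cases[OF v n2 a b mult_v[of z], folded D_def, case_names zero one pole other])
      case pv: pole
      show ?thesis
        using pu(2) pv(2) pole_u[OF pu(1)] pole_v[OF pv(1)] nonneg[of "\<lambda>z. u z + a"] nonneg[of "\<lambda>z. v z + a"]
          nonneg(1)[of Fb] nonneg(1)[of Gb] \<phi>1' H1 l pnn by linarith
    next
      \<comment> \<open>A single double pole pays \<open>2 + \<kappa>\<close>: its own unit, a pole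
        of \<open>H\<close> and a pole of \<open>\<phi>\<close>.\<close>
      case ov: other
      have "of_int (zorder (\<lambda>z. v z + a) z) = zer (\<lambda>z. v z + a) z" using ov by (simp add: zer_def ordv_def)
      moreover have "(0::real) \<le> of_int (zorder (deriv G) z)" using ov by simp
      ultimately show ?thesis
        using pu(2) ov(5) pole_u[OF pu(1)] nonneg[of "\<lambda>z. u z + a"]
          nonneg(1)[of Fb] nonneg(1)[of Gb] \<phi>1' H1 l pnn by linarith
    qed (use pu neg share_cases[of z] in auto)
  next
    case ou: other
    have zu: "of_int (zorder (\<lambda>z. u z + a) z) = zer (\<lambda>z. u z + a) z" using ou by (simp add: zer_def ordv_def)
    show ?thesis
    proof (cases rule: pow_shift_local_cases[OF v n2 a b mult_v[of z], folded D_def, case_names zero one pole other])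
      case pv: pole
      have neg: "int n * zorder v z < 0" using pv n by (intro mult_pos_neg) auto
      have "(0::real) \<le> of_int (zorder (deriv F) z)" using ou by simp
      thus ?thesis
        using zu pv(2) ou(5) pole_v[OF pv(1)] nonneg[of "\<lambda>z. v z + a"]
          nonneg(1)[of Fb] nonneg(1)[of Gb] \<phi>1' H1 l pnn by linarith
    next
      case ov: other
      have zv: "of_int (zorder (\<lambda>z. v z + a) z) = zer (\<lambda>z. v z + a) z" using ov by (simp add: zer_def ordv_def)
      have p0: "Q \<ge> 0" using ou ov by (intro \<phi>0') (simp add: zorder_X)
      \<comment> \<open>Here \<open>W\<close> has order
        \<open>zorder (deriv F) z - zorder (deriv G) z\<close>, so a pole of \<open>H\<close>
        requires one of the derivatives to vanish, and this ramification pays for it.\<close>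
      have "of_int (zorder (deriv F) z) + of_int (zorder (deriv G) z) + ordv H z \<ge> 0"
      proof (cases "zorder (deriv F) z = zorder (deriv G) z")
        case True
        have "ordv H z \<ge> 0" using ou ov True by (intro H0) (simp add: zorder_W)
        thus ?thesis using ou(4) ov(4) by simp
      next
        case False
        hence "zorder (deriv F) z + zorder (deriv G) z \<ge> 1" using ou(4) ov(4) by linarith
        hence "of_int (zorder (deriv F) z) + of_int (zorder (deriv G) z) \<ge> (1 :: real)" by linarith
        thus ?thesis using H1 by linarith
      qed
      thus ?thesis using ou(5) ov(5) zu zv p0 pnn nonneg(1)[of Fb] nonneg(1)[of Gb] by simp
    qed (use ou share_cases[of z] in auto)
  qed
  thus ?thesis by (simp add: Q_def Pu_def Pv_def distrib_left)
qed

end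

context circles
begin

lemma nav_zer_asym:
  assumes "adm h" "adm (\<lambda>z. h z + c)"
  shows   "asym_le \<Phi> (\<lambda>r. nav r (zer (\<lambda>z. h z + c))) (\<lambda>r. nchar r h)"
proof (rule asym_leI)
  fix r assume r: "good r"
  show "nav r (zer (\<lambda>z. h z + c)) \<le> nchar r h + (lnp (norm c) + ln 2 - jensen_const (\<lambda>z. h z + c))"
    using nav_zer_le[OF assms(2) r] nchar_add_const_le[OF assms r] by simp
qed

lemma nav_zer_asym_0:
  assumes "adm h"
  shows   "asym_le \<Phi> (\<lambda>r. nav r (zer h)) (\<lambda>r. nchar r h)"
  using nav_zer_asym[of h 0] assms by simp

lemma nav_pol_asym:
  assumes "adm h"
  shows   "asym_le \<Phi> (\<lambda>r. nav r (pol h)) (\<lambda>r. nchar r h)"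
  by (rule asym_leI[where C = 0]) (use nav_pol_le_nchar[OF assms] in auto)

lemma asym_le_refl: "asym_le \<Phi> X X"
  by (rule asym_leI[where C = 0]) auto

lemma asym_le_of_le: "(\<And>r. good r \<Longrightarrow> X r \<le> Y r) \<Longrightarrow> asym_le \<Phi> X Y"
  by (rule asym_leI[where C = 0]) auto

lemma nchar_pow_shift_asym:
  assumes "nonconst u" "adm u" "adm (pow_shift n a u)" "n \<ge> 2"
  shows   "asym_le \<Phi> (\<lambda>r. nchar r (pow_shift n a u)) (\<lambda>r. n * nchar r u)"
          "asym_le \<Phi> (\<lambda>r. n * nchar r u) (\<lambda>r. nchar r (pow_shift n a u))"
  using nchar_pow_shift[OF assms] by (blast intro: asym_leI)+

lemma poly_dominated_pow_shift:
  assumes "nonconst u" "adm u" "adm (pow_shift n a u)" "n \<ge> 2" "\<And>r. good r \<Longrightarrow> nchar r u \<le> \<Phi> r"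
  shows   "poly_dominated \<Phi> 1 (pow_shift n a u)"
proof (rule poly_dominatedI)
  fix R assume R: "good R"
  have "nchar R (pow_shift n a u) \<le> n * nchar R u + (lnp (norm a) + ln 2)"
    by (rule nchar_pow_shift(1)[OF assms(1-4) R])
  also have "n * nchar R u \<le> n * \<Phi> R" using assms(5)[OF R] by (intro mult_left_mono) auto
  finally show "nchar R (pow_shift n a u) \<le> n * \<Phi> R + (lnp (norm a) + ln 2)" by simp
qed auto

lemma asym_absurd_sum:
  assumes u: "adm u" and v: "adm v" and unb: "adm (\<lambda>z. u z + c)" "zorder (\<lambda>z. u z + c) z0 > 0"
    and le: "asym_le (\<lambda>r. nchar r u + nchar r v) (\<lambda>r. \<epsilon> * (nchar r u + nchar r v)) (\<lambda>_. 0)" and "\<epsilon> > 0"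
  shows   False
proof (rule asym_le_absurd[OF _ _ le])
  fix \<rho>
  obtain K L where "\<forall>r. good r \<and> r \<le> \<rho> \<longrightarrow> nchar r u \<le> K" "\<forall>r. good r \<and> r \<le> \<rho> \<longrightarrow> nchar r v \<le> L"
    using nchar_bounded[OF u, of \<rho>] nchar_bounded[OF v, of \<rho>] by blast
  hence "\<forall>r. good r \<and> r \<le> \<rho> \<longrightarrow> nchar r u + nchar r v \<le> K + L" by (auto intro: add_mono)
  thus "\<exists>K. \<forall>r. good r \<and> r \<le> \<rho> \<longrightarrow> nchar r u + nchar r v \<le> K" by blast
next
  fix M
  obtain r where "good r" "nchar r u \<ge> M" using nchar_unbounded[OF u unb, of M] by blast
  thus "\<exists>r. good r \<and> M \<le> nchar r u + nchar r v" using nchar_nonneg[OF v, of r] by (intro exI[of _ r]) auto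
qed fact

lemma asym_absurd_single:
  assumes u: "adm u" and unb: "adm (\<lambda>z. u z + c)" "zorder (\<lambda>z. u z + c) z0 > 0"
    and le: "asym_le (\<lambda>r. nchar r u) (\<lambda>r. \<epsilon> * nchar r u) (\<lambda>_. 0)" and "\<epsilon> > 0"
  shows   False
  by (rule asym_le_absurd[OF _ _ le]) (use nchar_bounded[OF u] nchar_unbounded[OF u unb] assms in auto)

lemma asym_le_move:
  assumes "asym_le \<Phi> X (\<lambda>r. Y r + Z r)"
  shows   "asym_le \<Phi> (\<lambda>r. X r - Z r) Y"
  using assms unfolding asym_le_def by (auto simp: algebra_simps)

end

context sharing_pair
begin

text \<open>Summing the pointwise estimate over both functions, every counting function on the right
  is replaced by its characteristic: \<open>n\<close> times that of \<open>u\<close> or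
  \<open>v\<close> for \<open>Fb\<close> and \<open>Gb\<close>, once for the others.\<close>

lemma generic_case:
  assumes H: "mero H" and \<phi>: "mero \<phi>"
  shows False
proof -
  obtain c z0 where c: "zorder (\<lambda>z. u z + c) z0 > 0" using nonconst_takes_value[OF u] by blast
  obtain B where B: "circles B" and admB: "\<And>h. h \<in> {u, v, \<lambda>z. u z + c, \<lambda>z. u z + a, \<lambda>z. v z + a, F, G, Fb, Gb, deriv F, deriv G,
      f, g, deriv f, deriv g, W, H, X, \<phi>} \<Longrightarrow> circles.adm B h"
    by (rule exists_circles[of "{u, v, \<lambda>z. u z + c, \<lambda>z. u z + a, \<lambda>z. v z + a, F, G, Fb, Gb, deriv F, deriv G,
      f, g, deriv f, deriv g, W, H, X, \<phi>}"]) (use meros meros2 H \<phi> in auto)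
  interpret circles B by fact
  define \<Phi> where "\<Phi> = (\<lambda>r. nchar r u + nchar r v)"
  define l where "l = 2 / (real n - 2)"
  have l: "0 < l" "l \<le> 2/3"
    using n by (auto simp: l_def field_simps)
  have le\<Phi>: "nchar r u \<le> \<Phi> r" "nchar r v \<le> \<Phi> r" if "good r" for r
    using nchar_nonneg[OF _ that] admB by (auto simp: \<Phi>_def)
  have domF: "poly_dominated \<Phi> 1 F" and domG: "poly_dominated \<Phi> 1 G"
    using le\<Phi> admB by (intro poly_dominated_pow_shift u v n2; simp)+
  have domFb: "poly_dominated \<Phi> 1 Fb" and domGb: "poly_dominated \<Phi> 1 Gb"
    using domF domG admB by (intro poly_dominated_add_const; simp)+
  have domf: "poly_dominated \<Phi> 1 f" and domg: "poly_dominated \<Phi> 1 g"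
    unfolding f_def g_def using domFb domGb admB by (intro poly_dominated_inverse; simp)+
  \<comment> \<open>\<open>W\<close> contains derivatives of \<open>f\<close> and \<open>g\<close>,
    hence the shorter window.\<close>
  have domW: "poly_dominated \<Phi> 3 W"
    unfolding W_def using domf domg admB by (intro poly_dominated_divide poly_dominated_deriv; simp)
  have domX: "poly_dominated \<Phi> 1 X"
    unfolding X_def using domFb domGb admB by (intro poly_dominated_divide; simp)
  have nH: "asym_le \<Phi> (\<lambda>r. nav r (ordv H)) (\<lambda>_. 0)"
    unfolding H_def by (rule nav_ordv_log_deriv[OF _ _ domW]) (use admB in \<open>auto simp flip: H_def\<close>)
  have n\<phi>: "asym_le \<Phi> (\<lambda>r. nav r (ordv \<phi>)) (\<lambda>_. 0)"
    unfolding \<phi>_def by (rule nav_ordv_log_deriv[OF _ _ domX]) (use admB in \<open>auto simp flip: \<phi>_def\<close>)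
  have lfD: "loc_finite (D u)" "loc_finite (D v)"
    unfolding D_def using meros by (intro loc_finite_diff loc_finite_add loc_finite_zer loc_finite_pol loc_finite_ordv; simp)+
  have smt_u: "asym_le \<Phi> (\<lambda>r. nchar r F) (\<lambda>r. nav r (D u))"
    by (rule second_main_theorem[OF _ _ _ b domF lfD(1)]) (use admB in \<open>auto simp: D_def\<close>)
  have smt_v: "asym_le \<Phi> (\<lambda>r. nchar r G) (\<lambda>r. nav r (D v))"
    by (rule second_main_theorem[OF _ _ _ b domG lfD(2)]) (use admB in \<open>auto simp: D_def\<close>)
  define E where "E = (\<lambda>z. 11/21 * (zer Fb z + zer Gb z) + (zer (\<lambda>z. u z + a) z + zer (\<lambda>z. v z + a) z) +
           (1 + l / 2) * (pol u z + pol v z) + (ordv H z + l * ordv \<phi> z))"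
  have lf: "loc_finite (zer Fb)" "loc_finite (zer Gb)" "loc_finite (zer (\<lambda>z. u z + a))" "loc_finite (zer (\<lambda>z. v z + a))" "loc_finite (pol u)" "loc_finite (pol v)"
    "loc_finite (ordv H)" "loc_finite (ordv \<phi>)"
    using meros H \<phi> by (auto intro: loc_finite_zer loc_finite_pol loc_finite_ordv)
  have navE: "nav r E = 11/21 * (nav r (zer Fb) + nav r (zer Gb)) + (nav r (zer (\<lambda>z. u z + a)) + nav r (zer (\<lambda>z. v z + a))) +
           (1 + l / 2) * (nav r (pol u) + nav r (pol v)) + (nav r (ordv H) + l * nav r (ordv \<phi>))" for r
    unfolding E_def by (simp only: nav_add loc_finite_add loc_finite_cmult nav_cmult lf)
  have "asym_le \<Phi> (\<lambda>r. n * nchar r u + n * nchar r v) (\<lambda>r. nchar r F + nchar r G)"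
    using admB by (intro asym_le_add nchar_pow_shift_asym u v n2) auto
  also have "asym_le \<Phi> \<dots> (\<lambda>r. nav r (D u) + nav r (D v))"
    by (intro asym_le_add smt_u smt_v)
  also have "asym_le \<Phi> \<dots> (\<lambda>r. nav r E)"
  proof (rule asym_le_of_le)
    fix r assume r: "good r"
    have "nav r (D u) + nav r (D v) = nav r (\<lambda>z. D u z + D v z)" using lfD by (simp add: nav_add)
    also have "\<dots> \<le> nav r E"
    proof (rule nav_mono)
      show "loc_finite E" unfolding E_def using lf by (intro loc_finite_add loc_finite_cmult)
      show "D u z + D v z \<le> E z" for z
        using pointwise_estimate[OF H \<phi>, of z] by (simp add: E_def l_def)
    qed (use lfD good_ge_1[OF r] in auto)
    finally show "nav r (D u) + nav r (D v) \<le> nav r E" .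
  qed
  also have "asym_le \<Phi> (\<lambda>r. nav r E) (\<lambda>r. 11/21 * (nchar r F + nchar r G) + (nchar r u + nchar r v) +
           (1 + l / 2) * (nchar r u + nchar r v) + (0 + l * 0))"
    unfolding navE using l admB
    by (intro asym_le_add asym_le_cmult nav_zer_asym nav_pol_asym nH n\<phi>) auto
  also have "asym_le \<Phi> \<dots> (\<lambda>r. 11/21 * (n * nchar r u + n * nchar r v) + (nchar r u + nchar r v) +
           (1 + l / 2) * (nchar r u + nchar r v) + (0 + l * 0))"
    using admB l by (intro asym_le_add asym_le_cmult nchar_pow_shift_asym u v n2 asym_le_refl) auto
  also have "\<dots> = (\<lambda>r. 0 + (11/21 * n + 2 + l / 2) * (nchar r u + nchar r v))"
    by (auto simp: algebra_simps fun_eq_iff)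
  finally have "asym_le \<Phi> (\<lambda>r. (n * nchar r u + n * nchar r v) - (11/21 * n + 2 + l / 2) * (nchar r u + nchar r v)) (\<lambda>_. 0)"
    by (rule asym_le_move)
  also have "(\<lambda>r. (n * nchar r u + n * nchar r v) - (11/21 * n + 2 + l / 2) * (nchar r u + nchar r v)) =
             (\<lambda>r. (10/21 * n - 2 - l / 2) * (nchar r u + nchar r v))"
    by (auto simp: algebra_simps fun_eq_iff)
  finally have le: "asym_le (\<lambda>r. nchar r u + nchar r v) (\<lambda>r. (10/21 * n - 2 - l / 2) * (nchar r u + nchar r v)) (\<lambda>_. 0)"
    unfolding \<Phi>_def .
  \<comment> \<open>For \<open>n = 5\<close> one has \<open>l = 2/3\<close>, and the inequality
    reads 50/21 > 7/3 = 49/21.\<close>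
  have pos: "10/21 * n - 2 - l / 2 > 0" using n l by (simp add: field_simps)
  show False
    by (rule asym_absurd_sum[OF _ _ _ c le pos]) (use admB in auto)
qed

end

section \<open>Affine relations\<close>

lemma zorder_pow_shift:
  assumes "nonconst u"
  shows   "zorder (pow_shift n a u) z = int (n - 1) * zorder u z + zorder (\<lambda>z. u z + a) z"
  unfolding pow_shift_def using assms
  by (subst zorder_mult_mero) (auto intro!: mero_power nonconst_mero(1) simp: zorder_power_mero nonconst_mero(2))

lemma zorder_eventually_cong:
  assumes "\<forall>\<^sub>\<approx>z\<in>UNIV. p z = q z"
  shows   "zorder p z = zorder q z"
proof (rule zorder_cong)
  show "\<forall>\<^sub>F w in at z. p w = q w" using assms by (auto simp: eventually_cosparse_open_eq)
qed simp

lemma mero_cosparse_nonzero: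
  assumes "mero h"
  shows   "\<forall>\<^sub>\<approx>z\<in>UNIV. h z \<noteq> 0"
  using mero_eventually[OF assms] by (auto simp: eventually_cosparse_open_eq)

context circles
begin

text \<open>The 5/2 consists of 1 for the zeros of \<open>u\<close>, 1 for those of
  \<open>u + a\<close> and 1/2 for the poles, which are multiple. The \<open>-c\<close>-points are
  left to \<open>E\<close>, because an additional relation to \<open>v\<close> will bound
  them.\<close>

lemma second_main_theorem_pow_shift:
  assumes u: "nonconst u" and mult: "\<And>z. zorder u z < 0 \<longrightarrow> zorder u z \<le> -2" and n: "n \<ge> 2" and a: "a \<noteq> 0" and c: "c \<noteq> 0"
    and adm: "adm u" "adm (\<lambda>z. u z + a)" "adm (pow_shift n a u)" "adm (deriv (pow_shift n a u))" "adm (\<lambda>z. pow_shift n a u z + c)"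
    and \<Phi>: "\<And>r. good r \<Longrightarrow> nchar r u \<le> \<Phi> r"
    and E: "loc_finite E" "\<And>z. E z \<ge> 0" "\<And>z. zorder (\<lambda>z. pow_shift n a u z + c) z > 0 \<Longrightarrow> E z \<ge> 1"
  shows   "asym_le \<Phi> (\<lambda>r. n * nchar r u) (\<lambda>r. 5/2 * nchar r u + nav r E)"
proof -
  define E' where "E' = (\<lambda>z. zer u z + zer (\<lambda>z. u z + a) z + 1/2 * pol u z + E z)"
  have lf: "loc_finite (zer u)" "loc_finite (zer (\<lambda>z. u z + a))" "loc_finite (pol u)"
    using adm by (auto intro: loc_finite_zer loc_finite_pol adm_mero)
  have nn: "zer q z \<ge> 0" "pol q z \<ge> 0" for q z by (auto simp: zer_def pol_def)
  have "asym_le \<Phi> (\<lambda>r. n * nchar r u) (\<lambda>r. nchar r (pow_shift n a u))"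
    by (rule nchar_pow_shift_asym(2)[OF u adm(1,3) n])
  also have "asym_le \<Phi> \<dots> (\<lambda>r. nav r E')"
  proof (rule second_main_theorem[OF adm(3,5,4) c poly_dominated_pow_shift[OF u adm(1,3) n \<Phi>]])
    show "loc_finite E'" unfolding E'_def using lf E by (intro loc_finite_add loc_finite_cmult)
    fix z
    show "zer (pow_shift n a u) z + zer (\<lambda>z. pow_shift n a u z + c) z - pol (pow_shift n a u) z - ordv (deriv (pow_shift n a u)) z \<le> E' z"
    proof (cases rule: pow_shift_local_cases[OF u n a c mult[of z], case_names zero one pole other])
      case zero
      have "zer u z \<ge> 1" using zero(1) by (simp add: zer_def ordv_def)
      thus ?thesis using zero(2) nn[of "\<lambda>z. u z + a" z] nn[of u z] E(2)[of z] unfolding E'_def by linarith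
    next
      case one
      thus ?thesis using E(3)[OF one(3)] nn[of "\<lambda>z. u z + a" z] nn[of u z] unfolding E'_def by linarith
    next
      case pole
      have "pol u z \<ge> 2" using pole(1) by (simp add: pol_def ordv_def)
      thus ?thesis using pole(2) nn[of "\<lambda>z. u z + a" z] nn[of u z] E(2)[of z] unfolding E'_def by linarith
    next
      case other
      have "zer (\<lambda>z. u z + a) z = of_int (zorder (\<lambda>z. u z + a) z)" "(0::real) \<le> of_int (zorder (deriv (pow_shift n a u)) z)"
        using other(3,4) by (simp_all add: zer_def ordv_def)
      thus ?thesis using other(5) nn[of u z] E(2)[of z] unfolding E'_def by linarith
    qed
  qed
  also have "(\<lambda>r. nav r E') = (\<lambda>r. nav r (zer u) + nav r (zer (\<lambda>z. u z + a)) + 1/2 * nav r (pol u) + nav r E)"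
    unfolding E'_def by (simp only: nav_add loc_finite_add loc_finite_cmult nav_cmult lf E)
  also have "asym_le \<Phi> \<dots> (\<lambda>r. nchar r u + nchar r u + 1/2 * nchar r u + nav r E)"
    using adm by (intro asym_le_add asym_le_cmult nav_zer_asym nav_zer_asym_0 nav_pol_asym asym_le_refl) auto
  also have "\<dots> = (\<lambda>r. 5/2 * nchar r u + nav r E)"
    by (auto simp: fun_eq_iff)
  finally show ?thesis .
qed

text \<open>Agreement off a sparse set says nothing about individual points, but on a good circle
  both functions are continuous, which extends the agreement to it.\<close>

lemma nchar_cosparse_eq:
  assumes pq: "adm p" "adm q" and eq: "\<forall>\<^sub>\<approx>z\<in>UNIV. p z = q z" and r: "good r"
  shows   "nchar r p = nchar r q"
proof -
  have "pol p = pol q" using zorder_eventually_cong[OF eq] by (simp add: pol_def ordv_def fun_eq_iff)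
  moreover have "p z = q z" if z: "norm z = r" for z
  proof -
    have "isCont p z" "isCont q z"
      using adm_good[OF pq(1) r z] adm_good[OF pq(2) r z] by (auto intro: analytic_at_imp_isCont)
    hence p: "(p \<longlongrightarrow> p z) (at z)" and q: "(q \<longlongrightarrow> q z) (at z)" by (auto simp: isCont_def)
    have "\<forall>\<^sub>F w in at z. p w = q w" using eq by (auto simp: eventually_cosparse_open_eq)
    from tendsto_cong[OF this] q have "(p \<longlongrightarrow> q z) (at z)" by simp
    thus ?thesis using p by (intro tendsto_unique[of "at z" p]) auto
  qed
  ultimately show ?thesis
    unfolding nchar_def using good_ge_1[OF r] by (intro arg_cong2[of _ _ _ _ "(+)"] cmean_cong) auto
qed

lemma nchar_affine_asym:
  assumes pq: "adm p" "adm q" and A: "A \<noteq> 0" and eq: "\<forall>\<^sub>\<approx>z\<in>UNIV. p z = A * q z + C"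
    and ac: "adm (\<lambda>z. A * q z + C)"
  shows   "asym_le \<Phi> (\<lambda>r. nchar r p) (\<lambda>r. nchar r q)"
proof (rule asym_leI)
  fix r assume r: "good r"
  have aq: "adm (\<lambda>z. A * q z)" using A pq by (intro adm_mult adm_const)
  have "nchar r (\<lambda>_. A) = lnp (norm A)"
    using A by (simp add: nchar_def nav_def pol_def ordv_def)
  moreover have "nchar r (\<lambda>z. A * q z) \<le> nchar r (\<lambda>_. A) + nchar r q"
    using A pq r by (intro nchar_mult_le adm_const)
  moreover have "nchar r p = nchar r (\<lambda>z. A * q z + C)" by (rule nchar_cosparse_eq[OF pq(1) ac eq r])
  moreover have "\<dots> \<le> nchar r (\<lambda>z. A * q z) + (lnp (norm C) + ln 2)" by (rule nchar_add_const_le[OF aq ac r])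
  ultimately show "nchar r p \<le> nchar r q + (lnp (norm A) + lnp (norm C) + ln 2)" by linarith
qed

lemma nchar_add_const_asym:
  assumes "adm p" "adm (\<lambda>z. p z + c)"
  shows   "asym_le \<Phi> (\<lambda>r. nchar r (\<lambda>z. p z + c)) (\<lambda>r. nchar r p)"
          "asym_le \<Phi> (\<lambda>r. nchar r p) (\<lambda>r. nchar r (\<lambda>z. p z + c))"
proof -
  show "asym_le \<Phi> (\<lambda>r. nchar r (\<lambda>z. p z + c)) (\<lambda>r. nchar r p)"
    by (rule asym_leI) (rule nchar_add_const_le[OF assms])
  show "asym_le \<Phi> (\<lambda>r. nchar r p) (\<lambda>r. nchar r (\<lambda>z. p z + c))"
    using nchar_add_const_le[of "\<lambda>z. p z + c" "-c"] assms by (intro asym_leI) auto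
qed

lemma nchar_inverse_asym:
  assumes "adm p"
  shows   "asym_le \<Phi> (\<lambda>r. nchar r (\<lambda>z. inverse (p z))) (\<lambda>r. nchar r p)"
          "asym_le \<Phi> (\<lambda>r. nchar r p) (\<lambda>r. nchar r (\<lambda>z. inverse (p z)))"
  using nchar_inverse[OF assms]
  by (auto intro!: asym_leI[where C = "\<bar>jensen_const p\<bar>"])

text \<open>The error terms are measured by the sum of both characteristics, so a bound for
  \<open>u\<close> alone contradicts only once \<open>v\<close> is controlled by
  \<open>u\<close>.\<close>

lemma asym_absurd_dominated:
  assumes "adm u" "adm v" "adm (\<lambda>z. u z + c)" "zorder (\<lambda>z. u z + c) z0 > 0" and "\<epsilon> > 0"
    and small: "asym_le (\<lambda>r. nchar r u + nchar r v) (\<lambda>r. \<epsilon> * nchar r u) (\<lambda>_. 0)"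
    and dom: "asym_le (\<lambda>r. nchar r u + nchar r v) (\<lambda>r. nchar r v) (\<lambda>r. nchar r u)"
  shows   False
proof -
  let ?\<Phi> = "\<lambda>r. nchar r u + nchar r v"
  have "asym_le ?\<Phi> (\<lambda>r. \<epsilon> * (nchar r u + nchar r v)) (\<lambda>r. \<epsilon> * (nchar r u + nchar r u))"
    using dom \<open>\<epsilon> > 0\<close> by (intro asym_le_cmult asym_le_add asym_le_refl) auto
  also have "(\<lambda>r. \<epsilon> * (nchar r u + nchar r u)) = (\<lambda>r. 2 * (\<epsilon> * nchar r u))" by (auto simp: fun_eq_iff)
  also have "asym_le ?\<Phi> \<dots> (\<lambda>r. 2 * 0)" using small by (intro asym_le_cmult) auto
  finally have "asym_le ?\<Phi> (\<lambda>r. \<epsilon> * (nchar r u + nchar r v)) (\<lambda>_. 0)" by simp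
  thus False using asym_absurd_sum assms by blast
qed

end

text \<open>This arises when one of the two derivatives is constant.\<close>
lemma omitted_roots_case:
  assumes v: "nonconst v" and mult: "\<And>z. zorder v z < 0 \<longrightarrow> zorder v z \<le> -2" and n: "n \<ge> 5" and a: "a \<noteq> 0" and b: "b \<noteq> 0"
    and omit: "\<And>z. zorder (\<lambda>z. pow_shift n a v z + b) z \<le> 0"
  shows   False
proof -
  have n2: "n \<ge> 2" using n by simp
  obtain c z0 where c: "zorder (\<lambda>z. v z + c) z0 > 0" using nonconst_takes_value[OF v] by blast
  note P = pow_shift_nonconst[OF v n2, of a]
  obtain B where B: "circles B" and admB: "\<And>h. h \<in> {v, \<lambda>z. v z + c, \<lambda>z. v z + a, pow_shift n a v, \<lambda>z. pow_shift n a v z + b, deriv (pow_shift n a v)}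
      \<Longrightarrow> circles.adm B h"
    by (rule exists_circles[of "{v, \<lambda>z. v z + c, \<lambda>z. v z + a, pow_shift n a v, \<lambda>z. pow_shift n a v z + b, deriv (pow_shift n a v)}"])
       (use P nonconst_mero v in auto)
  interpret circles B by fact
  define \<Phi> where "\<Phi> = (\<lambda>r. nchar r v)"
  have "asym_le \<Phi> (\<lambda>r. n * nchar r v) (\<lambda>r. 5/2 * nchar r v + nav r (\<lambda>_. 0))"
    by (rule second_main_theorem_pow_shift[OF v mult n2 a b]) (use admB omit in \<open>auto simp: \<Phi>_def loc_finite_def not_less[symmetric]\<close>)
  hence "asym_le \<Phi> (\<lambda>r. n * nchar r v) (\<lambda>r. 0 + 5/2 * nchar r v)" by (simp add: nav_def)
  hence "asym_le \<Phi> (\<lambda>r. n * nchar r v - 5/2 * nchar r v) (\<lambda>_. 0)" by (rule asym_le_move)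
  hence le: "asym_le (\<lambda>r. nchar r v) (\<lambda>r. (n - 5/2) * nchar r v) (\<lambda>_. 0)" by (simp add: \<Phi>_def algebra_simps)
  show False by (rule asym_absurd_single[OF _ _ c le]) (use admB n in auto)
qed

context sharing_pair
begin

section \<open>Exclusion of the relations \<open>1 / (F + b) = A / (G + b) + C\<close>\<close>

lemma swap: "sharing_pair n a b v u"
  by unfold_locales (use n a b u v mult_u mult_v in \<open>auto simp: share0 share1\<close>)

lemma relation_swap:
  assumes rel: "\<forall>\<^sub>\<approx>z\<in>UNIV. inverse (F z + b) = A * inverse (G z + b) + C" and A: "A \<noteq> 0"
  shows   "\<forall>\<^sub>\<approx>z\<in>UNIV. inverse (G z + b) = inverse A * inverse (F z + b) + (- (C / A))"
  using rel
proof eventually_elim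
  case (elim z)
  have "inverse A * (A * y + C) + (- (C / A)) = y" for y using A by (simp add: field_simps)
  thus ?case unfolding elim by simp
qed

lemma affine_mero:
  assumes rel: "\<forall>\<^sub>\<approx>z\<in>UNIV. inverse (F z + b) = A * inverse (G z + b) + C"
  shows   "mero (\<lambda>z. A * inverse (G z + b) + C)"
proof (rule mero_cong[OF mero_inverse[OF meros(7)[of b]]])
  fix z show "\<forall>\<^sub>F w in at z. inverse (F w + b) = A * inverse (G w + b) + C"
    using rel by (auto simp: eventually_cosparse_open_eq)
qed (intro meromorphic_intros mero_meromorphic meros)

text \<open>Inversion, shifts and multiplication by constants change the characteristic by O(1), and
  the common factor \<open>n\<close> cancels in the passage to \<open>u\<close> and
  \<open>v\<close>.\<close>

lemma nchar_comparison:
  assumes "circles B" and rel: "\<forall>\<^sub>\<approx>z\<in>UNIV. inverse (F z + b) = A * inverse (G z + b) + C" and A: "A \<noteq> 0"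
    and admB: "\<And>h. h \<in> {u, v, F, G, Fb, Gb, \<lambda>z. A * inverse (G z + b) + C} \<Longrightarrow> circles.adm B h"
  shows   "circles.asym_le B \<Phi> (\<lambda>r. nchar r u) (\<lambda>r. nchar r v)"
proof -
  interpret circles B by fact
  have "asym_le \<Phi> (\<lambda>r. n * nchar r u) (\<lambda>r. nchar r F)"
    using admB by (intro nchar_pow_shift_asym u n2) auto
  also have "asym_le \<Phi> \<dots> (\<lambda>r. nchar r Fb)" using admB by (intro nchar_add_const_asym) auto
  also have "asym_le \<Phi> \<dots> (\<lambda>r. nchar r (\<lambda>z. inverse (F z + b)))" using admB by (intro nchar_inverse_asym) auto
  also have "asym_le \<Phi> \<dots> (\<lambda>r. nchar r (\<lambda>z. inverse (G z + b)))"
    using admB by (intro nchar_affine_asym[OF _ _ A rel] adm_inverse) auto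
  also have "asym_le \<Phi> \<dots> (\<lambda>r. nchar r Gb)" using admB by (intro nchar_inverse_asym) auto
  also have "asym_le \<Phi> \<dots> (\<lambda>r. nchar r G)" using admB by (intro nchar_add_const_asym) auto
  also have "asym_le \<Phi> \<dots> (\<lambda>r. n * nchar r v)"
    using admB by (intro nchar_pow_shift_asym v n2) auto
  finally have "asym_le \<Phi> (\<lambda>r. 1 / n * (n * nchar r u)) (\<lambda>r. 1 / n * (n * nchar r v))"
    by (rule asym_le_cmult) auto
  thus ?thesis using n by simp
qed

text \<open>The idea is to take for \<open>-c\<close> the value of \<open>F\<close> that the
  relation attaches to the poles or zeros of \<open>G\<close>, so that its points are counted by
  \<open>v\<close>. Since \<open>v\<close> grows no faster than \<open>u\<close>, the total is
  \<open>5/2 + 2 = 9/2 < n\<close>.\<close>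

lemma moebius_case:
  assumes rel: "\<forall>\<^sub>\<approx>z\<in>UNIV. inverse (F z + b) = A * inverse (G z + b) + C" and A: "A \<noteq> 0" and c: "c \<noteq> 0"
    and E: "loc_finite E" "\<And>z. E z \<ge> 0" "\<And>z. zorder (\<lambda>z. F z + c) z > 0 \<Longrightarrow> E z \<ge> 1"
    and El: "\<And>B \<Phi>. circles B \<Longrightarrow> circles.adm B v \<Longrightarrow> circles.adm B (\<lambda>z. v z + a) \<Longrightarrow> circles.asym_le B \<Phi> (\<lambda>r. nav r E) (\<lambda>r. 2 * nchar r v)"
  shows   False
proof -
  obtain d z0 where d: "zorder (\<lambda>z. u z + d) z0 > 0" using nonconst_takes_value[OF u] by blast
  note rel' = relation_swap[OF rel A]
  have m: "mero (\<lambda>z. A * inverse (G z + b) + C)" "mero (\<lambda>z. inverse A * inverse (F z + b) + (- (C / A)))"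
    using affine_mero[OF rel] sharing_pair.affine_mero[OF swap rel'] by auto
  obtain B where B: "circles B" and admB: "\<And>h. h \<in> {u, v, \<lambda>z. u z + d, \<lambda>z. u z + a, \<lambda>z. v z + a, F, G, Fb, Gb, \<lambda>z. F z + c, deriv F,
      \<lambda>z. A * inverse (G z + b) + C, \<lambda>z. inverse A * inverse (F z + b) + (- (C / A))} \<Longrightarrow> circles.adm B h"
    by (rule exists_circles[of "{u, v, \<lambda>z. u z + d, \<lambda>z. u z + a, \<lambda>z. v z + a, F, G, Fb, Gb, \<lambda>z. F z + c, deriv F,
      \<lambda>z. A * inverse (G z + b) + C, \<lambda>z. inverse A * inverse (F z + b) + (- (C / A))}"]) (use meros m in auto)
  interpret circles B by fact
  define \<Phi> where "\<Phi> = (\<lambda>r. nchar r u + nchar r v)"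
  have dom: "asym_le \<Phi> (\<lambda>r. nchar r v) (\<lambda>r. nchar r u)"
    by (rule sharing_pair.nchar_comparison[OF swap B rel']) (use A admB in auto)
  have "asym_le \<Phi> (\<lambda>r. n * nchar r u) (\<lambda>r. 5/2 * nchar r u + nav r E)"
    by (rule second_main_theorem_pow_shift[OF u mult_u n2 a c]) (use admB E nchar_nonneg in \<open>auto simp: \<Phi>_def\<close>)
  also have "asym_le \<Phi> \<dots> (\<lambda>r. 5/2 * nchar r u + 2 * nchar r v)"
    using admB by (intro asym_le_add asym_le_refl El B) auto
  also have "asym_le \<Phi> \<dots> (\<lambda>r. 5/2 * nchar r u + 2 * nchar r u)"
    using dom by (intro asym_le_add asym_le_refl asym_le_cmult) auto
  also have "\<dots> = (\<lambda>r. 0 + 9/2 * nchar r u)" by (auto simp: fun_eq_iff)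
  finally have "asym_le \<Phi> (\<lambda>r. n * nchar r u - 9/2 * nchar r u) (\<lambda>_. 0)" by (rule asym_le_move)
  hence le: "asym_le \<Phi> (\<lambda>r. (n - 9/2) * nchar r u) (\<lambda>_. 0)" by (simp add: algebra_simps)
  show False
    by (rule asym_absurd_dominated[OF _ _ _ d _ le[unfolded \<Phi>_def] dom[unfolded \<Phi>_def]]) (use admB n in auto)
qed

text \<open>\<open>1 / C - b\<close> is the value of \<open>F\<close> at poles of \<open>G\<close>,
  and hypothesis \<open>c\<close> keeps it apart from the value 0. Poles of \<open>v\<close> are
  multiple, so half of \<open>pol v\<close> already counts these points.\<close>

lemma relation_nonzero_const_case:
  assumes rel: "\<forall>\<^sub>\<approx>z\<in>UNIV. inverse (F z + b) = A * inverse (G z + b) + C" and A: "A \<noteq> 0" and C: "C \<noteq> 0"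
    and c: "b - 1 / C \<noteq> 0"
  shows   False
proof (rule moebius_case[OF rel A c, where E = "\<lambda>z. 1/2 * pol v z"])
  show "loc_finite (\<lambda>z. 1/2 * pol v z)" using meros by (intro loc_finite_cmult loc_finite_pol) auto
  show "1/2 * pol v z \<ge> 0" for z by (simp add: pol_def)
  show "1/2 * pol v z \<ge> 1" if z: "zorder (\<lambda>z. F z + (b - 1 / C)) z > 0" for z
  proof -
    let ?Fc = "\<lambda>z. F z + (b - 1 / C)"
    have "zorder (\<lambda>z. ?Fc z + 1 / C) z = 0"
      using zorder_add_const[of ?Fc "1 / C" z] meros z C by auto
    hence Fb0: "zorder Fb z = 0" by (simp add: algebra_simps)
    have "\<forall>\<^sub>\<approx>z\<in>UNIV. A * inverse (G z + b) = (- C) * (?Fc z / (F z + b))"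
      using rel mero_cosparse_nonzero[OF meros(7)[of b]]
    proof eventually_elim
      case (elim w)
      have *: "inverse x - C = (- C) * ((x - 1 / C) / x)" if "x \<noteq> 0" for x
        using that C by (simp add: field_simps)
      have "A * inverse (G w + b) = inverse (F w + b) - C" using elim by simp
      also have "\<dots> = (- C) * ((F w + b - 1 / C) / (F w + b))" using elim by (intro *)
      finally show ?case by (simp only: add_diff_eq)
    qed
    hence "zorder (\<lambda>z. A * inverse (G z + b)) z = zorder (\<lambda>z. (- C) * (?Fc z / (F z + b))) z"
      by (rule zorder_eventually_cong)
    also have "zorder (\<lambda>z. A * inverse (G z + b)) z = - zorder Gb z"
      using A meros by (subst zorder_mult_mero) (auto intro!: mero_const mero_inverse simp: zorder_inverse_mero)
    also have "zorder (\<lambda>z. (- C) * (?Fc z / (F z + b))) z = zorder ?Fc z"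
      using C meros Fb0 by (subst zorder_mult_mero) (auto intro!: mero_const mero_divide simp: zorder_divide_mero)
    finally have Gb: "zorder Gb z < 0" using z by simp
    show ?thesis
      by (cases rule: pow_shift_local_cases[OF v n2 a b mult_v[of z], case_names zero one pole other])
         (use Gb in \<open>auto simp: pol_def ordv_def\<close>)
  qed
  fix B \<Phi> assume "circles B" and adm: "circles.adm B v"
  interpret circles B by fact
  have "asym_le \<Phi> (\<lambda>r. 1/2 * nav r (pol v)) (\<lambda>r. 1/2 * nchar r v)"
    using adm by (intro asym_le_cmult nav_pol_asym) auto
  also have "asym_le \<Phi> \<dots> (\<lambda>r. 2 * nchar r v)"
    using nchar_nonneg[OF adm] by (intro asym_le_of_le) auto
  finally show "asym_le \<Phi> (\<lambda>r. nav r (\<lambda>z. 1/2 * pol v z)) (\<lambda>r. 2 * nchar r v)"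
    by (simp only: nav_cmult)
qed

text \<open>Here \<open>F + (b - b / A) = G / A\<close>, so the third value is the one taken at
  zeros of \<open>G\<close>, that is, at zeros of \<open>v\<close> and of
  \<open>v + a\<close>.\<close>

lemma relation_zero_const_case:
  assumes rel: "\<forall>\<^sub>\<approx>z\<in>UNIV. inverse (F z + b) = A * inverse (G z + b) + 0" and A: "A \<noteq> 0" "A \<noteq> 1"
  shows   False
proof (rule moebius_case[OF rel A(1), where c = "b - b / A" and E = "\<lambda>z. zer v z + zer (\<lambda>z. v z + a) z"])
  show "b - b / A \<noteq> 0" using A b by (simp add: field_simps)
  show "loc_finite (\<lambda>z. zer v z + zer (\<lambda>z. v z + a) z)" using meros by (intro loc_finite_add loc_finite_zer) auto
  show "zer v z + zer (\<lambda>z. v z + a) z \<ge> 0" for z by (simp add: zer_def)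
  show "zer v z + zer (\<lambda>z. v z + a) z \<ge> 1" if z: "zorder (\<lambda>z. F z + (b - b / A)) z > 0" for z
  proof -
    have "\<forall>\<^sub>\<approx>z\<in>UNIV. F z + (b - b / A) = (1 / A) * G z"
      using rel mero_cosparse_nonzero[OF meros(7)[of b]] mero_cosparse_nonzero[OF meros(8)[of b]]
      by eventually_elim (use A in \<open>auto simp: field_simps\<close>)
    hence "zorder (\<lambda>z. F z + (b - b / A)) z = zorder (\<lambda>z. (1 / A) * G z) z"
      by (rule zorder_eventually_cong)
    also have "\<dots> = zorder G z"
      using A meros by (subst zorder_mult_mero) (auto intro!: mero_const)
    finally have G: "zorder G z > 0" using z by simp
    have nn: "zer q z \<ge> 0" for q by (simp add: zer_def)
    show ?thesis
    proof (cases rule: pow_shift_local_cases[OF v n2 a b mult_v[of z], case_names zero one pole other])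
      case zero
      hence "zer v z \<ge> 1" by (simp add: zer_def ordv_def)
      thus ?thesis using nn[of "\<lambda>z. v z + a"] by linarith
    next
      case pole
      have "int n * zorder v z \<le> 0" using pole(1) by (intro mult_nonneg_nonpos) auto
      thus ?thesis using G pole by simp
    next
      case other
      hence "zer (\<lambda>z. v z + a) z \<ge> 1" using G by (simp add: zer_def ordv_def)
      thus ?thesis using nn[of v] by linarith
    qed (use G in auto)
  qed
  fix B \<Phi> assume "circles B" and adm: "circles.adm B v" "circles.adm B (\<lambda>z. v z + a)"
  interpret circles B by fact
  have lf: "loc_finite (zer v)" "loc_finite (zer (\<lambda>z. v z + a))" using meros by auto
  have "asym_le \<Phi> (\<lambda>r. nav r (zer v) + nav r (zer (\<lambda>z. v z + a))) (\<lambda>r. nchar r v + nchar r v)"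
    using adm by (intro asym_le_add nav_zer_asym_0 nav_zer_asym)
  thus "asym_le \<Phi> (\<lambda>r. nav r (\<lambda>z. zer v z + zer (\<lambda>z. v z + a) z)) (\<lambda>r. 2 * nchar r v)"
    by (simp only: nav_add[OF lf] mult_2)
qed

text \<open>This is the case \<open>F G = b\<^sup>2\<close>.\<close>
lemma relation_product_case:
  assumes rel: "\<forall>\<^sub>\<approx>z\<in>UNIV. inverse (F z + b) = (-1) * inverse (G z + b) + 1 / b"
  shows   False
proof -
  have key: "- zorder Gb z = zorder F z - zorder Fb z" for z
  proof -
    have "\<forall>\<^sub>\<approx>z\<in>UNIV. inverse (G z + b) = (1 / b) * (F z / (F z + b))"
      using rel mero_cosparse_nonzero[OF meros(7)[of b]]
    proof eventually_elim
      case (elim w)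
      hence "inverse (G w + b) = 1 / b - inverse (F w + b)" by simp
      also have "\<dots> = (1 / b) * (F w / (F w + b))" using elim b by (simp add: field_simps)
      finally show ?case .
    qed
    hence "zorder (\<lambda>z. inverse (G z + b)) z = zorder (\<lambda>z. (1 / b) * (F z / (F z + b))) z"
      by (rule zorder_eventually_cong)
    also have "\<dots> = zorder F z - zorder Fb z"
      using b meros by (subst zorder_mult_mero) (auto intro!: mero_const mero_divide simp: zorder_divide_mero)
    finally show ?thesis using meros by (simp add: zorder_inverse_mero)
  qed
  have G_pole: "zorder v z \<le> -2 \<and> zorder Gb z = int n * zorder v z" if "zorder Gb z < 0" for z
    by (cases rule: pow_shift_local_cases[OF v n2 a b mult_v[of z], case_names zero one pole other]) (use that in auto)
  \<comment> \<open>A zero of \<open>u\<close> is a zero of \<open>F\<close>, hence a pole of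
    \<open>G\<close> and of \<open>v\<close>; but \<open>v\<close> would have to vanish there
    because 0 is shared.\<close>
  have no_zero: "zorder u z \<le> 0" for z
  proof (rule ccontr)
    assume "\<not>?thesis"
    hence z: "zorder u z > 0" by simp
    have "zorder Gb z < 0"
      by (cases rule: pow_shift_local_cases[OF u n2 a b mult_u[of z], case_names zero one pole other]) (use z key[of z] in auto)
    thus False using G_pole[of z] share_cases(1)[of z] z by auto
  qed
  \<comment> \<open>A zero of \<open>u + a\<close> is a pole of \<open>G\<close> of the same order,
    and that order is \<open>n \<ge> 5\<close> times a pole order of \<open>v\<close>, which is at
    least 2.\<close>
  have ten: "zorder (\<lambda>z. u z + a) z \<ge> 10" if z: "zorder (\<lambda>z. u z + a) z > 0" for z
  proof (cases rule: pow_shift_local_cases[OF u n2 a b mult_u[of z], case_names zero one pole other])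
    case other
    hence *: "zorder Gb z = - zorder (\<lambda>z. u z + a) z" using key[of z] by simp
    hence "zorder v z \<le> -2" "int n * zorder v z = - zorder (\<lambda>z. u z + a) z" using z G_pole[of z] by auto
    moreover have "int n * zorder v z \<le> 5 * (-2)"
      using mult_mono[of 5 "int n" 2 "- zorder v z"] n calculation(1) by simp
    ultimately show ?thesis by linarith
  qed (use z in auto)
  obtain d z0 where d: "zorder (\<lambda>z. u z + d) z0 > 0" using nonconst_takes_value[OF u] by blast
  obtain B where B: "circles B" and admB: "\<And>h. h \<in> {u, \<lambda>z. u z + d, \<lambda>z. u z + a, deriv u} \<Longrightarrow> circles.adm B h"
    by (rule exists_circles[of "{u, \<lambda>z. u z + d, \<lambda>z. u z + a, deriv u}"]) (use meros in auto)
  interpret circles B by fact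
  define \<Phi> where "\<Phi> = (\<lambda>r. nchar r u)"
  \<comment> \<open>The second main theorem is applied to \<open>u\<close> itself with the values 0,
    \<open>-a\<close> and infinity: the first is omitted, the others have multiplicities at least 10
    and 2, and 1/10 + 1/2 < 1.\<close>
  define E where "E = (\<lambda>z. 1/10 * zer (\<lambda>z. u z + a) z + 1/2 * pol u z)"
  have lf: "loc_finite (zer (\<lambda>z. u z + a))" "loc_finite (pol u)" using meros by auto
  have "asym_le \<Phi> (\<lambda>r. nchar r u) (\<lambda>r. nav r E)"
  proof (rule second_main_theorem[OF _ _ _ a])
    show "poly_dominated \<Phi> 1 u" by (rule poly_dominatedI[of u 1 \<Phi> 0]) (auto simp: \<Phi>_def)
    show "loc_finite E" unfolding E_def using lf by (intro loc_finite_add loc_finite_cmult)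
    fix z
    note ua = zorder_add_const[OF meros(1) meros(3) a, of z]
    note d1 = zorder_deriv_nonzero[OF meros(1), of z]
    note d2 = zorder_deriv_nonzero[OF meros(3)[of a], of z, unfolded deriv_add_const]
    note d3 = zorder_deriv_nonneg[OF meros(1,11), of z]
    consider "zorder u z < 0" | "zorder u z = 0" "zorder (\<lambda>z. u z + a) z > 0" | "zorder u z = 0" "zorder (\<lambda>z. u z + a) z = 0"
      using ua no_zero[of z] by linarith
    thus "zer u z + zer (\<lambda>z. u z + a) z - pol u z - ordv (deriv u) z \<le> E z"
    proof cases
      case 1
      hence "zorder u z \<le> -2" using mult_u[of z] by auto
      thus ?thesis using 1 ua d1 by (simp add: E_def zer_def pol_def ordv_def)
    next
      case 2
      hence "zorder (\<lambda>z. u z + a) z \<ge> 10" by (intro ten)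
      thus ?thesis using 2 d2 by (simp add: E_def zer_def pol_def ordv_def)
    next
      case 3
      thus ?thesis using d3 by (simp add: E_def zer_def pol_def ordv_def)
    qed
  qed (use admB in auto)
  also have "(\<lambda>r. nav r E) = (\<lambda>r. 1/10 * nav r (zer (\<lambda>z. u z + a)) + 1/2 * nav r (pol u))"
    unfolding E_def by (simp only: nav_add loc_finite_cmult nav_cmult lf)
  also have "asym_le \<Phi> \<dots> (\<lambda>r. 1/10 * nchar r u + 1/2 * nchar r u)"
    using admB by (intro asym_le_add asym_le_cmult nav_zer_asym nav_pol_asym) auto
  also have "\<dots> = (\<lambda>r. 0 + 3/5 * nchar r u)" by (auto simp: fun_eq_iff)
  finally have "asym_le \<Phi> (\<lambda>r. nchar r u - 3/5 * nchar r u) (\<lambda>_. 0)" by (rule asym_le_move)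
  hence le: "asym_le (\<lambda>r. nchar r u) (\<lambda>r. 2/5 * nchar r u) (\<lambda>_. 0)" by (simp add: \<Phi>_def)
  show False by (rule asym_absurd_single[OF _ _ d le]) (use admB in auto)
qed

lemma equal_case:
  assumes eq: "\<forall>\<^sub>\<approx>z\<in>UNIV. F z = G z"
  shows   "\<forall>\<^sub>\<approx>z\<in>UNIV. u z = v z"
proof (rule ccontr)
  assume neq: "\<not>?thesis"
  have oFG: "zorder F z = zorder G z" for z by (rule zorder_eventually_cong[OF eq])
  \<comment> \<open>A zero of \<open>F\<close> may come from \<open>u\<close> or from
    \<open>u + a\<close>, and equal orders of \<open>F\<close> and \<open>G\<close> do not tell
    which. That \<open>u\<close> and \<open>v\<close> vanish at the same points decides it.\<close>
  have same: "zorder u z = zorder v z" for z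
  proof (cases "zorder u z > 0")
    case True
    hence "zorder v z > 0" using share_cases(1)[of z] by simp
    hence "int (n - 1) * zorder u z = int (n - 1) * zorder v z"
      using True oFG[of z] zorder_add_const[OF meros(1,3) a, of z] zorder_add_const[OF meros(2,4) a, of z]
      by (simp add: zorder_pow_shift[OF u] zorder_pow_shift[OF v])
    thus ?thesis using n by simp
  next
    case False
    hence v0: "zorder v z \<le> 0" using share_cases(1)[of z] by simp
    have P: "zorder w z < 0 \<Longrightarrow> zorder (pow_shift n a w) z = int n * zorder w z"
            "zorder w z = 0 \<Longrightarrow> zorder (pow_shift n a w) z \<ge> 0" if w: "nonconst w" for w
      using zorder_add_const[OF nonconst_mero(2)[OF w] nonconst_mero(1)[OF w] a, of z] zorder_pow_shift[OF w, of n a z] n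
      by (auto simp: of_nat_diff algebra_simps)
    have neg: "int n * x < 0" if "x < 0" for x using that n by (intro mult_pos_neg) auto
    show ?thesis
    proof (cases "zorder u z < 0"; cases "zorder v z < 0")
      assume "zorder u z < 0" "zorder v z < 0"
      thus ?thesis using P(1)[OF u] P(1)[OF v] oFG[of z] n by simp
    qed (use False v0 P[OF u] P[OF v] oFG[of z] neg[of "zorder u z"] neg[of "zorder v z"] in auto)
  qed
  define q where "q = (\<lambda>z. u z / v z)"
  have q: "mero q" unfolding q_def by (intro mero_divide meros)
  have q0: "zorder q z = 0" for z
    unfolding q_def using same[of z] by (subst zorder_divide_mero) (auto intro: meros)
  define k where "k = remove_sings q"
  have k: "k analytic_on {z}" "k z \<noteq> 0" for z
    using remove_sings_zorder_0[OF q q0] by (auto simp: k_def)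
  have kq: "\<forall>\<^sub>\<approx>z\<in>UNIV. k z = q z"
    unfolding k_def by (intro eventually_remove_sings_eq mero_meromorphic q)
  \<comment> \<open>Insert \<open>u = k * v\<close> into \<open>F = G\<close> and cancel
    \<open>v ^ (n - 1)\<close>.\<close>
  have ident: "\<forall>\<^sub>\<approx>z\<in>UNIV. v z * (k z ^ n + (-1)) = (- a) * (k z ^ (n - 1) + (-1))"
    using kq eq mero_cosparse_nonzero[OF meros(2)]
  proof eventually_elim
    case (elim z)
    have u: "u z = k z * v z" using elim by (simp add: q_def)
    have "k z ^ (n - 1) * (k z * v z + a) * v z ^ (n - 1) = (v z + a) * v z ^ (n - 1)"
      using elim(2) unfolding pow_shift_def u by (simp add: power_mult_distrib mult_ac)
    hence "k z ^ (n - 1) * (k z * v z + a) = v z + a" using elim by simp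
    moreover have "k z ^ n = k z ^ (n - 1) * k z" using n by (metis One_nat_def Suc_pred less_le_trans power_Suc2 zero_less_numeral)
    ultimately show ?case by (simp add: algebra_simps)
  qed
  have km: "k meromorphic_on UNIV" using k(1) by (intro analytic_on_imp_meromorphic_on) (subst analytic_on_analytic_at, auto)
  \<comment> \<open>Suppose \<open>k\<close> is a constant \<open>d\<close>. If
    \<open>d ^ n \<noteq> 1\<close>, the identity makes \<open>v\<close> constant; otherwise it
    gives \<open>d ^ (n - 1) = 1\<close> too, so \<open>d = 1\<close> and
    \<open>u = v\<close>.\<close>
  have nk: "nonconst k" unfolding nonconst_def
  proof (intro allI meroI meromorphic_intros km notI)
    fix c assume c: "\<forall>\<^sub>\<approx>z\<in>UNIV. k z + c = 0"
    define d where "d = -c"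
    have kd: "\<forall>\<^sub>\<approx>z\<in>UNIV. k z = d" using c by eventually_elim (simp add: d_def add_eq_0_iff2)
    have id: "\<forall>\<^sub>\<approx>z\<in>UNIV. v z * (d ^ n + (-1)) = (- a) * (d ^ (n - 1) + (-1))"
      using ident kd by eventually_elim simp
    show False
    proof (cases "d ^ n = 1")
      case False
      define e where "e = (- a) * (d ^ (n - 1) + (-1)) / (d ^ n + (-1))"
      have "\<forall>\<^sub>\<approx>z\<in>UNIV. v z + (- e) = 0"
        using id by eventually_elim (use False in \<open>simp add: e_def field_simps\<close>)
      with mero_cosparse_nonzero[OF meros(4)[of "-e"]] have "\<forall>\<^sub>\<approx>z\<in>(UNIV :: complex set). False"
        by eventually_elim auto
      thus False by simp
    next
      case True
      have "\<forall>\<^sub>\<approx>z\<in>(UNIV :: complex set). d ^ (n - 1) = 1"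
        by (rule eventually_mono[OF id]) (use True a in \<open>simp add: add_eq_0_iff2\<close>)
      hence "d ^ (n - 1) = 1" by simp
      moreover have "d ^ n = d ^ (n - 1) * d" using n by (metis One_nat_def Suc_pred less_le_trans power_Suc2 zero_less_numeral)
      ultimately have "d = 1" using True by simp
      have "\<forall>\<^sub>\<approx>z\<in>UNIV. u z = v z"
        using kq kd mero_cosparse_nonzero[OF meros(2)] by eventually_elim (use \<open>d = 1\<close> in \<open>simp add: q_def\<close>)
      with neq show False by contradiction
    qed
  qed
  define \<zeta> where "\<zeta> = cis (2 * pi / n)"
  have \<zeta>n: "\<zeta> ^ n = 1" using n by (subst \<zeta>_def, subst Complex.DeMoivre) simp
  have \<zeta>1: "\<zeta> \<noteq> 1"
  proof
    assume "\<zeta> = 1"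
    hence "cos (2 * pi / n) = 1" by (simp add: \<zeta>_def complex_eq_iff)
    moreover have "cos (2 * pi / n) < cos 0"
      using n by (intro cos_monotone_0_pi) (auto simp: field_simps)
    ultimately show False by simp
  qed
  have \<zeta>n1: "\<zeta> ^ (n - 1) \<noteq> 1"
  proof
    assume "\<zeta> ^ (n - 1) = 1"
    moreover have "\<zeta> ^ n = \<zeta> ^ (n - 1) * \<zeta>" using n by (metis One_nat_def Suc_pred less_le_trans power_Suc2 zero_less_numeral)
    ultimately show False using \<zeta>n \<zeta>1 by simp
  qed
  have "\<zeta> \<noteq> 0" by (simp add: \<zeta>_def)
  note mk = nonconst_mero[OF nk] nonconst_imp_mero_deriv[OF nk]
  define p where "p = (\<lambda>z. k z ^ n)"
  have dp: "deriv p = (\<lambda>z. of_nat n * (k z ^ (n - 1) * deriv k z))"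
  proof
    fix z
    have "(k has_field_derivative deriv k z) (at z)" using k by (intro analytic_derivI)
    hence "(p has_field_derivative of_nat n * (k z ^ (n - 1) * deriv k z)) (at z)"
      unfolding p_def by (auto intro!: derivative_eq_intros simp: mult_ac)
    thus "deriv p z = of_nat n * (k z ^ (n - 1) * deriv k z)" by (rule DERIV_imp_deriv)
  qed
  have mdp: "mero (deriv p)" unfolding dp using n by (intro mero_mult mero_const mero_power mk) auto
  have np: "nonconst p"
    by (rule mero_deriv_imp_nonconst[OF _ mdp]) (auto simp: p_def intro!: meromorphic_intros km)
  have zk0: "zorder k z = 0" for z using k by (intro zorder_eq_0I)
  \<comment> \<open>As \<open>k\<close> has neither zeros nor poles, \<open>deriv p\<close> and
    \<open>deriv k\<close> have the same order; this carries the multiplicity of a zero of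
    \<open>p - 1\<close> over to \<open>k - \<zeta>\<close>.\<close>
  have zdp: "zorder (deriv p) z = zorder (deriv k) z" for z
    unfolding dp using n mk zk0[of z]
    by (subst zorder_mult_mero; (subst zorder_mult_mero)?) (auto intro!: mero_const mero_mult mero_power simp: zorder_power_mero)
  have double: "zorder (\<lambda>z. k z + (- \<zeta>)) z \<ge> 2" if z: "zorder (\<lambda>z. k z + (- \<zeta>)) z > 0" for z
  proof -
    have kz: "k z = \<zeta>"
    proof -
      have "(\<lambda>z. k z + (- \<zeta>)) analytic_on {z}" by (intro analytic_intros k)
      from zorder_pos_iff'[OF this mero_frequently[OF mk(1)]] z show ?thesis by simp
    qed
    have 1: "zorder (\<lambda>z. p z + (-1)) z > 0"
      using mero_frequently[OF nonconst_mero(1)[OF np], of "-1" z] k kz \<zeta>n unfolding p_def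
      by (subst zorder_pos_iff') (auto intro!: analytic_intros)
    have 2: "zorder (\<lambda>z. (- a) * (k z ^ (n - 1) + (-1))) z = 0"
      using k kz \<zeta>n1 a by (intro zorder_eq_0I) (auto intro!: analytic_intros simp: add_eq_0_iff2)
    have "zorder (\<lambda>z. v z * (p z + (-1))) z = zorder (\<lambda>z. (- a) * (k z ^ (n - 1) + (-1))) z"
      using ident unfolding p_def by (rule zorder_eventually_cong)
    hence "zorder v z + zorder (\<lambda>z. p z + (-1)) z = 0"
      using 2 zorder_mult_mero[OF meros(2) nonconst_mero(1)[OF np, of "-1"], of z] by linarith
    with 1 mult_v[of z] have 3: "zorder (\<lambda>z. p z + (-1)) z \<ge> 2" by auto
    have "zorder (deriv p) z = zorder (\<lambda>z. p z + (-1)) z - 1"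
      using zorder_deriv_nonzero[OF nonconst_mero(1)[OF np, of "-1"], of z] 1 by (simp only: deriv_add_const)
    moreover have "zorder (deriv k) z = zorder (\<lambda>z. k z + (- \<zeta>)) z - 1"
      using zorder_deriv_nonzero[OF mk(1)[of "- \<zeta>"], of z] z by (simp only: deriv_add_const)
    ultimately show ?thesis using 3 zdp[of z] by simp
  qed
  obtain d z0 where d: "zorder (\<lambda>z. k z + d) z0 > 0" using nonconst_takes_value[OF nk] by blast
  obtain B where B: "circles B" and admB: "\<And>h. h \<in> {k, \<lambda>z. k z + d, \<lambda>z. k z + (- \<zeta>), deriv k} \<Longrightarrow> circles.adm B h"
    by (rule exists_circles[of "{k, \<lambda>z. k z + d, \<lambda>z. k z + (- \<zeta>), deriv k}"]) (use mk nonconst_mero_minus[OF nk] in auto)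
  interpret circles B by fact
  define \<Phi> where "\<Phi> = (\<lambda>r. nchar r k)"
  \<comment> \<open>For \<open>k\<close> the values 0 and infinity are omitted and
    \<open>\<zeta>\<close> is taken with multiplicity at least 2, leaving half of the characteristic
    as the only count.\<close>
  define E where "E = (\<lambda>z. 1/2 * zer (\<lambda>z. k z + (- \<zeta>)) z)"
  have lf: "loc_finite (zer (\<lambda>z. k z + (- \<zeta>)))" by (intro loc_finite_zer mk)
  have "asym_le \<Phi> (\<lambda>r. nchar r k) (\<lambda>r. nav r E)"
  proof (rule second_main_theorem[where c = "- \<zeta>"])
    show "poly_dominated \<Phi> 1 k" by (rule poly_dominatedI[of k 1 \<Phi> 0]) (auto simp: \<Phi>_def)
    show "loc_finite E" unfolding E_def using lf by (intro loc_finite_cmult)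
    fix z
    note d2 = zorder_deriv_nonzero[OF mk(1)[of "- \<zeta>"], of z, unfolded deriv_add_const]
    note d3 = zorder_deriv_nonneg[OF mk(2,3), of z]
    have ge: "zorder (\<lambda>z. k z + (- \<zeta>)) z \<ge> 0"
      using k mero_frequently[OF mk(1)[of "- \<zeta>"], of z] by (intro zorder_ge_0) (auto intro!: analytic_intros)
    show "zer k z + zer (\<lambda>z. k z + (- \<zeta>)) z - pol k z - ordv (deriv k) z \<le> E z"
    proof (cases "zorder (\<lambda>z. k z + (- \<zeta>)) z = 0")
      case True
      thus ?thesis using d3 zk0[of z] by (simp add: E_def zer_def pol_def ordv_def)
    next
      case False
      thus ?thesis using double[of z] ge d2 zk0[of z] by (simp add: E_def zer_def pol_def ordv_def)
    qed
  qed (use admB \<open>\<zeta> \<noteq> 0\<close> in auto)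
  also have "(\<lambda>r. nav r E) = (\<lambda>r. 1/2 * nav r (zer (\<lambda>z. k z + (- \<zeta>))))"
    unfolding E_def by (simp only: nav_cmult)
  also have "asym_le \<Phi> \<dots> (\<lambda>r. 1/2 * nchar r k)"
    using admB by (intro asym_le_cmult nav_zer_asym) auto
  also have "\<dots> = (\<lambda>r. 0 + 1/2 * nchar r k)" by (auto simp: fun_eq_iff)
  finally have "asym_le \<Phi> (\<lambda>r. nchar r k - 1/2 * nchar r k) (\<lambda>_. 0)" by (rule asym_le_move)
  hence le: "asym_le (\<lambda>r. nchar r k) (\<lambda>r. 1/2 * nchar r k) (\<lambda>_. 0)" by (simp add: \<Phi>_def)
  show False by (rule asym_absurd_single[OF _ _ d le]) (use admB in auto)
qed

text \<open>The relation may be read in both directions. The case \<open>C \<noteq> 0\<close>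
  survives only with \<open>C = 1 / b\<close>, and the reversed relation only with
  \<open>- (C / A) = 1 / b\<close>; together they give \<open>A = -1\<close>.\<close>

lemma affine_relation_case:
  assumes rel: "\<forall>\<^sub>\<approx>z\<in>UNIV. inverse (F z + b) = A * inverse (G z + b) + C" and A: "A \<noteq> 0"
  shows   "\<forall>\<^sub>\<approx>z\<in>UNIV. u z = v z"
proof (cases "C = 0")
  case True
  show ?thesis
  proof (cases "A = 1")
    case A1: True
    have "\<forall>\<^sub>\<approx>z\<in>UNIV. F z = G z" using rel by eventually_elim (use True A1 in auto)
    thus ?thesis by (rule equal_case)
  next
    case False
    thus ?thesis using relation_zero_const_case[of A] rel True A by auto
  qed
next
  case C: False
  have "b - 1 / C = 0" using relation_nonzero_const_case[OF rel A C] by auto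
  hence bC: "C = 1 / b" using b C by (simp add: field_simps)
  have "b - 1 / (- (C / A)) = 0"
    using sharing_pair.relation_nonzero_const_case[OF swap relation_swap[OF rel A]] A C by auto
  hence "b * (A + 1) = 0" using bC b A by (simp add: field_simps)
  hence "A = -1" using b by (simp add: add_eq_0_iff2)
  thus ?thesis using relation_product_case rel bC by auto
qed

theorem u_eq_v: "\<forall>\<^sub>\<approx>z\<in>UNIV. u z = v z"
proof (cases "mero \<phi>")
  case False
  obtain A where A: "A \<noteq> 0" "\<forall>\<^sub>\<approx>z\<in>UNIV. X z = A"
    using log_deriv_zero_imp_const[OF meros2(6)] False unfolding \<phi>_def by blast
  have "\<forall>\<^sub>\<approx>z\<in>UNIV. inverse (F z + b) = (1 / A) * inverse (G z + b) + 0"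
    using A(2) mero_cosparse_nonzero[OF meros(7)[of b]] mero_cosparse_nonzero[OF meros(8)[of b]]
    by eventually_elim (use A(1) in \<open>auto simp: X_def field_simps\<close>)
  thus ?thesis by (rule affine_relation_case) (use A(1) in auto)
next
  case True
  \<comment> \<open>For a logarithmic derivative, failing \<open>mero\<close> means vanishing
    identically. Hence \<open>W\<close> is a constant \<open>A\<close>, and \<open>f - A g\<close>
    has derivative 0 off a sparse set.\<close>
  hence "\<not>mero H" using generic_case by blast
  then obtain A where A: "A \<noteq> 0" "\<forall>\<^sub>\<approx>z\<in>UNIV. W z = A"
    using log_deriv_zero_imp_const[OF meros2(5)] unfolding H_def by blast
  have an: "\<forall>\<^sub>\<approx>z\<in>UNIV. q analytic_on {z}" if "mero q" for q
    by (intro meromorphic_on_imp_analytic_cosparse mero_meromorphic that)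
  have "\<forall>\<^sub>\<approx>z\<in>UNIV. deriv (\<lambda>z. f z - A * g z) z = 0"
    using A(2) mero_cosparse_nonzero[OF meros2(4)] an[OF meros2(1)] an[OF meros2(2)]
  proof eventually_elim
    case (elim z)
    have "((\<lambda>z. f z - A * g z) has_field_derivative deriv f z - A * deriv g z) (at z)"
      using elim by (intro DERIV_diff DERIV_cmult analytic_derivI)
    hence "deriv (\<lambda>z. f z - A * g z) z = deriv f z - A * deriv g z" by (rule DERIV_imp_deriv)
    thus ?case using elim by (simp add: W_def field_simps)
  qed
  moreover have "(\<lambda>z. f z - A * g z) meromorphic_on UNIV"
    by (intro meromorphic_intros mero_meromorphic meros2)
  ultimately obtain C where "\<forall>\<^sub>\<approx>z\<in>UNIV. f z - A * g z = C"
    using deriv_zero_imp_const by blast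
  hence "\<forall>\<^sub>\<approx>z\<in>UNIV. inverse (F z + b) = A * inverse (G z + b) + C"
    by eventually_elim (auto simp: f_def g_def algebra_simps)
  thus ?thesis using A(1) by (rule affine_relation_case)
qed

end

section \<open>Weighted sharing\<close>

text \<open>At poles both representatives have the value 0, elsewhere they are continuous; so each
  agrees with its own \<open>remove_sings\<close>, which depends only on punctured
  neighbourhoods.\<close>

lemma nicely_meromorphic_eqI:
  assumes "u nicely_meromorphic_on UNIV" "v nicely_meromorphic_on UNIV" "\<forall>\<^sub>\<approx>z\<in>UNIV. u z = v z"
  shows   "u = v"
proof
  fix z
  have eq: "remove_sings w z = w z" if "w nicely_meromorphic_on UNIV" for w
    using that nicely_meromorphic_on_imp_analytic_at[of w UNIV z] is_pole_zero_at_nicely_mero[of w UNIV z]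
    by (cases "is_pole w z") auto
  have "\<forall>\<^sub>F w in at z. u w = v w" using assms(3) by (auto simp: eventually_cosparse_open_eq)
  hence "remove_sings u z = remove_sings v z" by (intro remove_sings_cong) auto
  thus "u z = v z" using assms eq by auto
qed

lemma zorder_nonneg_imp_analytic:
  assumes "h nicely_meromorphic_on UNIV" "zorder h z \<ge> 0"
  shows   "h analytic_on {z}"
proof (rule nicely_meromorphic_on_imp_analytic_at[OF assms(1)])
  have "h meromorphic_on {z}" using assms(1) by (auto simp: nicely_meromorphic_on_def intro: meromorphic_on_subset)
  hence "isolated_singularity_at h z" by (auto simp: meromorphic_at_iff)
  thus "\<not>is_pole h z" using isolated_pole_imp_neg_zorder[of h z] assms by auto
qed auto

text \<open>The hypothesis \<open>k \<ge> 1\<close> enters here: the function is the derivative of a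
  meromorphic function, and differentiation raises the order of each pole by 1.\<close>

lemma mero_deriv_pole_order:
  assumes f: "f nicely_meromorphic_on UNIV" and k: "k \<ge> 1" and u: "mero (mero_deriv k f)"
    and neg: "zorder (mero_deriv k f) z < 0"
  shows   "zorder (mero_deriv k f) z \<le> -2"
proof -
  define p where "p = (deriv ^^ (k - 1)) f"
  have mf: "f meromorphic_on A" for A
    using f by (auto simp: nicely_meromorphic_on_def intro: meromorphic_on_subset)
  have p: "p meromorphic_on A" for A unfolding p_def by (intro meromorphic_on_higher_deriv mf)
  have dp: "(deriv ^^ k) f = deriv p"
    using k unfolding p_def by (metis Suc_diff_1 comp_apply funpow.simps(2) less_le_trans zero_less_one)
  have iso: "isolated_singularity_at (deriv p) z" "not_essential (deriv p) z"
    using meromorphic_on_deriv[OF p, of "{z}"] by (auto simp: meromorphic_at_iff)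
  have isop: "isolated_singularity_at p z" "not_essential p z"
    using p[of "{z}"] by (auto simp: meromorphic_at_iff)
  have eq: "zorder (mero_deriv k f) z = zorder (deriv p) z"
    using iso by (simp add: mero_deriv_def dp)
  have "is_pole (mero_deriv k f) z"
    by (rule zorder_neg_imp_is_pole) (use u neg in \<open>auto intro: mero_meromorphic mero_eventually\<close>)
  hence "is_pole (deriv p) z" using iso by (simp add: mero_deriv_def dp)
  hence pole: "is_pole p z" using is_pole_deriv_iff[OF p] by simp
  have neg': "zorder p z < 0" by (rule isolated_pole_imp_neg_zorder) (use isop pole in auto)
  have "zorder (deriv p) z = zorder p z - 1"
  proof (rule zorder_deriv_minus_1)
    show "\<exists>\<^sub>F w in at z. p w \<noteq> 0"
      using non_zero_neighbour_pole[OF pole] by (simp add: eventually_frequently)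
  qed (use isop neg' in auto)
  thus ?thesis using eq neg' by simp
qed

section \<open>From weighted multiplicities to orders\<close>

lemma point_mult_nonconst:
  assumes "nonconst h"
  shows   "point_mult c h z = enat (nat (zorder (\<lambda>w. h w - c) z))"
proof -
  have "\<not>(\<forall>\<^sub>F w in at z. h w = c)"
  proof
    assume "\<forall>\<^sub>F w in at z. h w = c"
    with mero_eventually[OF nonconst_mero_minus[OF assms, of c], of z] have "\<forall>\<^sub>F w in at z. False"
      by eventually_elim auto
    thus False by simp
  qed
  thus ?thesis by (simp add: point_mult_def)
qed

lemma weighted_points_nonconst:
  assumes "nonconst h"
  shows   "weighted_points (enat l) c h z = enat (min (nat (zorder (\<lambda>w. h w - c) z)) (l + 1))"
  unfolding weighted_points_def point_mult_nonconst[OF assms] Let_def by (auto simp: min_def one_enat_def)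

lemma weighted_preimage_zero:
  assumes "nonconst h"
  shows   "weighted_preimage h {0} 1 z = enat (min (nat (zorder h z)) 2)"
  using weighted_points_nonconst[OF assms, of 1 0 z] by (simp add: weighted_preimage_def one_enat_def numeral_2_eq_2)

text \<open>The derivative of the polynomial is \<open>z^(n-2) * (n * z + (n-1) * a)\<close>. The
  condition on \<open>b / a ^ n\<close> says precisely that its critical point
  \<open>-(n-1) * a / n\<close> is not a root, so all roots are simple.\<close>

lemma polynomial_critical_point:
  fixes a b c :: complex and n :: nat
  assumes n: "n \<ge> 2" and a: "a \<noteq> 0"
    and disc: "b / a ^ n \<noteq> (- 1) ^ n * (of_nat (n - 1) ^ (n - 1) / of_nat n ^ n)"
    and root: "c ^ n + a * c ^ (n - 1) + b = 0"
  shows   "c + of_nat (n - 1) * a / of_nat n \<noteq> 0"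
proof
  assume "c + of_nat (n - 1) * a / of_nat n = 0"
  hence c: "c = - (of_nat (n - 1) * a / of_nat n)" by (simp add: add_eq_0_iff2)
  have n0: "of_nat n \<noteq> (0 :: complex)" using n by simp
  have ca: "c + a = a / of_nat n"
    using n0 n unfolding c by (simp add: of_nat_diff field_simps)
  obtain m where m: "n = Suc m" using n by (cases n) auto
  have "b = - (c ^ m * (c + a))" using root by (simp add: m algebra_simps add_eq_0_iff2)
  also have "\<dots> = - ((- (of_nat m * a / of_nat n)) ^ m * (a / of_nat n))" unfolding ca by (simp add: c m)
  also have "\<dots> = - ((-1) ^ m * (of_nat m ^ m * a ^ m / of_nat n ^ m) * (a / of_nat n))"
    by (subst power_minus) (simp add: power_divide power_mult_distrib)
  also have "\<dots> = (-1) ^ n * (of_nat m ^ m / of_nat n ^ n) * a ^ n"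
    by (simp add: m mult_ac)
  finally have "b / a ^ n = (-1) ^ n * (of_nat m ^ m / of_nat n ^ n)" using a by simp
  thus False using disc by (simp add: m)
qed

text \<open>Since the roots of the polynomial are simple, the order of a zero of \<open>P \<circ> h\<close> is the
  multiplicity of the point as a \<open>c\<close>-point of \<open>h\<close> for the root \<open>c\<close> in question.\<close>
lemma weighted_preimage_roots:
  fixes a b :: complex and n :: nat
  assumes h: "h nicely_meromorphic_on UNIV" "nonconst h" and n: "n \<ge> 2" and a: "a \<noteq> 0" and b: "b \<noteq> 0"
    and disc: "b / a ^ n \<noteq> (- 1) ^ n * (of_nat (n - 1) ^ (n - 1) / of_nat n ^ n)"
    and S: "S = {z. z ^ n + a * z ^ (n - 1) + b = 0}"
  shows   "weighted_preimage h S 2 z = enat (min (nat (zorder (\<lambda>z. pow_shift n a h z + b) z)) 3)"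
proof -
  note P = pow_shift_nonconst[OF h(2) n, of a]
  let ?P = "\<lambda>z. pow_shift n a h z + b"
  have pow_shift_eq: "?P z = h z ^ n + a * h z ^ (n - 1) + b" for z
  proof -
    have "h z ^ n = h z ^ (n - 1) * h z" using n by (metis One_nat_def Suc_pred less_le_trans power_Suc2 zero_less_numeral)
    thus ?thesis by (simp add: pow_shift_def algebra_simps)
  qed
  have anP: "?P analytic_on {z}" if "h analytic_on {z}"
    unfolding pow_shift_def using that by (intro analytic_intros)
  have wp: "weighted_points 2 c h z = enat (min (nat (zorder (\<lambda>w. h w - c) z)) 3)" for c
    using weighted_points_nonconst[OF h(2), of 2 c z] by (simp add: numeral_eq_enat numeral_3_eq_3 numeral_2_eq_2)
  have order_eq: "zorder ?P z = zorder (\<lambda>w. h w - c) z" if c: "c \<in> S" "zorder (\<lambda>w. h w - c) z > 0" for c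
  proof -
    let ?k = "\<lambda>w. h w - c"
    have k: "mero ?k" by (rule nonconst_mero_minus[OF h(2)])
    have c0: "c \<noteq> 0" using c(1) b n by (auto simp: S power_0_left)
    have crit: "c + of_nat (n - 1) * a / of_nat n \<noteq> 0"
      by (rule polynomial_critical_point[OF n a disc]) (use c(1) in \<open>simp add: S\<close>)
    have h0: "zorder h z = 0"
      using zorder_add_const[of ?k c z] k nonconst_mero(2)[OF h(2)] c0 c(2) by auto
    have an: "h analytic_on {z}" using zorder_nonneg_imp_analytic[OF h(1)] h0 by simp
    have hz: "h z = c"
    proof -
      have "?k analytic_on {z}" by (intro analytic_intros an)
      from zorder_pos_iff'[OF this mero_frequently[OF k]] c(2) show ?thesis by simp
    qed
    let ?l = "\<lambda>w. h w + of_nat (n - 1) * a / of_nat n"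
    have l0: "zorder ?l z = 0"
      using an crit hz by (intro zorder_eq_0I) (auto intro!: analytic_intros)
    \<comment> \<open>The two orders are compared after differentiation: by the chain rule the
      derivatives differ by a factor that does not vanish at the simple nonzero root
      \<open>c\<close>.\<close>
    have "zorder (deriv (pow_shift n a h)) z = zorder (\<lambda>w. h w ^ (n - 2) * (of_nat n * ?l w) * deriv h w) z"
    proof (rule zorder_cong)
      show "\<forall>\<^sub>F w in at z. deriv (pow_shift n a h) w = h w ^ (n - 2) * (of_nat n * ?l w) * deriv h w"
        using eventually_analytic_nonzero[OF nonconst_mero(2)[OF h(2)], of z]
      proof eventually_elim
        case (elim w)
        have "of_nat n * ?l w = of_nat n * h w + of_nat (n - 1) * a" using n by (simp add: field_simps)
        thus ?case using deriv_pow_shift[OF n, of h w a] elim by simp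
      qed
    qed simp
    also have "\<dots> = zorder (deriv h) z"
    proof -
      have l: "mero ?l" by (rule nonconst_mero(1)[OF h(2)])
      have cn: "mero (\<lambda>_. of_nat n)" using n by (intro mero_const) auto
      note m = mero_power[OF nonconst_mero(2)[OF h(2)], of "n - 2"] mero_mult[OF cn l]
        nonconst_imp_mero_deriv[OF h(2)] l cn
      have "zorder (\<lambda>w. h w ^ (n - 2) * (of_nat n * ?l w) * deriv h w) z =
              zorder (\<lambda>w. h w ^ (n - 2)) z + zorder (\<lambda>w. of_nat n * ?l w) z + zorder (deriv h) z"
        using m by (simp add: zorder_mult_mero mero_mult)
      also have "zorder (\<lambda>w. of_nat n * ?l w) z = 0" using m l0 n by (subst zorder_mult_mero) auto
      also have "zorder (\<lambda>w. h w ^ (n - 2)) z = 0" using h0 nonconst_mero(2)[OF h(2)] by (simp add: zorder_power_mero)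
      finally show ?thesis by simp
    qed
    also have "zorder (deriv h) z = zorder ?k z - 1"
      using zorder_deriv_nonzero[OF k, of z] c(2) deriv_add_const[of h "-c"] by simp
    finally have 1: "zorder (deriv (pow_shift n a h)) z = zorder ?k z - 1" .
    have "zorder ?P z > 0"
      using anP[OF an] mero_frequently[OF nonconst_mero(1)[OF P(3)], of b z] hz c(1)
      by (subst zorder_pos_iff') (auto simp: pow_shift_eq S)
    thus ?thesis using zorder_deriv_nonzero[OF nonconst_mero(1)[OF P(3)], of b z] 1 by (simp add: deriv_add_const)
  qed
  show ?thesis
  proof (cases "zorder ?P z > 0")
    case True
    have "zorder h z \<ge> 0"
    proof (rule ccontr)
      assume "\<not>?thesis"
      hence neg: "zorder h z < 0" by simp
      hence "zorder (pow_shift n a h) z = int n * zorder h z"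
        using zorder_add_const[OF nonconst_mero(2)[OF h(2)] nonconst_mero(1)[OF h(2)] a, of z] zorder_pow_shift[OF h(2), of n a z] n
        by (auto simp: of_nat_diff algebra_simps)
      hence "zorder (pow_shift n a h) z < 0" using neg n by (simp add: mult_pos_neg)
      thus False using True zorder_add_const[OF P(1) nonconst_mero(1)[OF P(3)] b, of z] by auto
    qed
    hence an: "h analytic_on {z}" by (rule zorder_nonneg_imp_analytic[OF h(1)])
    have "?P z = 0"
      using True anP[OF an] mero_frequently[OF nonconst_mero(1)[OF P(3)], of b z] by (simp add: zorder_pos_iff')
    hence zS: "h z \<in> S" by (simp add: pow_shift_eq S)
    have pos: "zorder (\<lambda>w. h w - h z) z > 0"
      using an mero_frequently[OF nonconst_mero_minus[OF h(2)], of "h z" z]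
      by (subst zorder_pos_iff') (auto intro!: analytic_intros)
    show ?thesis unfolding weighted_preimage_def
    proof (rule antisym)
      show "(SUP c\<in>S. weighted_points 2 c h z) \<le> enat (min (nat (zorder ?P z)) 3)"
      proof (rule SUP_least)
        fix c assume c: "c \<in> S"
        show "weighted_points 2 c h z \<le> enat (min (nat (zorder ?P z)) 3)"
          using order_eq[OF c] unfolding wp by (cases "zorder (\<lambda>w. h w - c) z > 0") auto
      qed
      \<comment> \<open>The supremum is attained at the root \<open>h z\<close>.\<close>
      have "enat (min (nat (zorder ?P z)) 3) = weighted_points 2 (h z) h z"
        using order_eq[OF zS pos] by (simp add: wp)
      also have "\<dots> \<le> (SUP c\<in>S. weighted_points 2 c h z)" using zS by (rule SUP_upper)
      finally show "enat (min (nat (zorder ?P z)) 3) \<le> (SUP c\<in>S. weighted_points 2 c h z)" .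
    qed
  next
    case False
    have "weighted_points 2 c h z = 0" if "c \<in> S" for c
      using order_eq[OF that] False unfolding wp by (cases "zorder (\<lambda>w. h w - c) z > 0") (auto simp: zero_enat_def)
    hence "weighted_preimage h S 2 z \<le> 0"
      unfolding weighted_preimage_def by (intro SUP_least) auto
    thus ?thesis using False by (simp flip: zero_enat_def)
  qed
qed

text \<open>A constant takes its value everywhere with infinite multiplicity, which weight 2
  truncates to 3.\<close>

lemma weighted_preimage_const:
  assumes h: "\<And>z. h z = c"
  shows   "weighted_preimage h S 2 z = (if c \<in> S then 3 else 0)"
proof -
  have wp: "weighted_points 2 d h z = (if d = c then 3 else 0)" for d
  proof (cases "d = c")
    case True
    thus ?thesis using h by (simp add: weighted_points_def point_mult_def Let_def numeral_eq_enat one_enat_def)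
  next
    case False
    have "zorder (\<lambda>w. h w - d) z = 0" using h False zorder_const[of "c - d" z] by simp
    thus ?thesis using h False by (simp add: weighted_points_def point_mult_def Let_def flip: zero_enat_def)
  qed
  show ?thesis unfolding weighted_preimage_def wp
  proof (cases "c \<in> S")
    case False
    have "(SUP d\<in>S. if d = c then 3 else 0 :: enat) \<le> 0"
      using False by (intro SUP_least) auto
    thus "(SUP d\<in>S. if d = c then 3 else 0) = (if c \<in> S then 3 else 0 :: enat)" using False by simp
  qed (auto intro!: antisym SUP_least SUP_upper2[of c])
qed

text \<open>If the constant lies in \<open>S\<close>, the other function would have to take values
  in \<open>S\<close> at every point; if not, it omits all of \<open>S\<close>, which the second
  main theorem forbids.\<close>

lemma one_constant_absurd:
  fixes a b :: complex and n :: nat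
  assumes v: "v nicely_meromorphic_on UNIV" "nonconst v" and mult: "\<And>z. zorder v z < 0 \<longrightarrow> zorder v z \<le> -2"
    and n: "n \<ge> 5" and a: "a \<noteq> 0" and b: "b \<noteq> 0"
    and disc: "b / a ^ n \<noteq> (- 1) ^ n * (of_nat (n - 1) ^ (n - 1) / of_nat n ^ n)"
    and S: "S = {z. z ^ n + a * z ^ (n - 1) + b = 0}"
    and u: "u constant_on UNIV" and share: "weighted_preimage u S 2 = weighted_preimage v S 2"
  shows   False
proof -
  have n2: "n \<ge> 2" using n by simp
  obtain c where c: "\<And>z. u z = c" using u by (auto simp: constant_on_def)
  have eq: "enat (min (nat (zorder (\<lambda>z. pow_shift n a v z + b) z)) 3) = (if c \<in> S then 3 else 0)" for z
    using fun_cong[OF share, of z] weighted_preimage_roots[OF v n2 a b disc S, of z] weighted_preimage_const[of u c S z] c by simp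
  show False
  proof (cases "c \<in> S")
    case True
    have m: "mero (\<lambda>z. pow_shift n a v z + b)" by (intro nonconst_mero(1) pow_shift_nonconst v n2)
    obtain z where "(\<lambda>z. pow_shift n a v z + b) analytic_on {z} \<and> pow_shift n a v z + b \<noteq> 0"
      using eventually_happens[OF eventually_analytic_nonzero[OF m, of 0]] by auto
    hence "zorder (\<lambda>z. pow_shift n a v z + b) z = 0" by (intro zorder_eq_0I) auto
    thus False using eq[of z] True by (simp add: zero_enat_def[symmetric])
  next
    case False
    have "zorder (\<lambda>z. pow_shift n a v z + b) z \<le> 0" for z
      using eq[of z] False by (simp add: zero_enat_def min_def split: if_splits)
    thus False using omitted_roots_case[OF v(2) mult n a b] by blast
  qed
qed

text \<open>Distinct nonzero constants outside \<open>S\<close> share both sets vacuously, and they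
  are the \<open>k\<close>-th derivatives of the nonconstant polynomials
  \<open>c * z^k / k!\<close>. The assumption \<open>not_both_const\<close> excludes this
  situation.\<close>

theorem theorem2p1:
  fixes n k :: nat and a b :: complex and P :: "complex \<Rightarrow> complex" and S :: "complex set"
    and f g :: "complex \<Rightarrow> complex"
  assumes n: "n \<ge> 5" and k: "k \<ge> 1"
    and P: "P = (\<lambda>z. z ^ n + a * z ^ (n - 1) + b)"
    and ab: "a * b \<noteq> 0"
    and disc: "b / a ^ n \<noteq> (- 1) ^ n * (of_nat (n - 1) ^ (n - 1) / of_nat n ^ n)"
    and S: "S = {z. P z = 0}"
    and f: "f nicely_meromorphic_on UNIV" "\<not> f constant_on UNIV"
    and g: "g nicely_meromorphic_on UNIV" "\<not> g constant_on UNIV"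
    and not_both_const: "\<not> (mero_deriv k f constant_on UNIV \<and> mero_deriv k g constant_on UNIV)"
    and share_S: "weighted_preimage (mero_deriv k f) S 2 = weighted_preimage (mero_deriv k g) S 2"
    and share_0: "weighted_preimage (mero_deriv k f) {0} 1 = weighted_preimage (mero_deriv k g) {0} 1"
  shows "mero_deriv k f = mero_deriv k g"
proof -
  define u where "u = mero_deriv k f"
  define v where "v = mero_deriv k g"
  have a: "a \<noteq> 0" and b: "b \<noteq> 0" and n2: "n \<ge> 2" using ab n by auto
  have S': "S = {z. z ^ n + a * z ^ (n - 1) + b = 0}" by (simp add: S P)
  have u_nice: "u nicely_meromorphic_on UNIV" and v_nice: "v nicely_meromorphic_on UNIV"
    unfolding u_def v_def using f g by (auto intro: mero_deriv_nicely_meromorphic)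
  have mult_u: "zorder u z < 0 \<longrightarrow> zorder u z \<le> -2" if "nonconst u" for z
    using mero_deriv_pole_order[OF f(1) k, of z] nonconst_mero(2)[OF that] by (auto simp: u_def)
  have mult_v: "zorder v z < 0 \<longrightarrow> zorder v z \<le> -2" if "nonconst v" for z
    using mero_deriv_pole_order[OF g(1) k, of z] nonconst_mero(2)[OF that] by (auto simp: v_def)
  have nc_u: "nonconst u" if "\<not>u constant_on UNIV" by (rule nicely_meromorphic_imp_nonconst[OF u_nice that])
  have nc_v: "nonconst v" if "\<not>v constant_on UNIV" by (rule nicely_meromorphic_imp_nonconst[OF v_nice that])
  show ?thesis
  proof (cases "u constant_on UNIV \<or> v constant_on UNIV")
    case True
    thus ?thesis
    proof
      assume c: "u constant_on UNIV"
      hence v': "nonconst v" using nc_v not_both_const by (auto simp: u_def v_def)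
      from one_constant_absurd[OF v_nice v' mult_v[OF v'] n a b disc S' c] share_S show ?thesis by (simp add: u_def v_def)
    next
      assume c: "v constant_on UNIV"
      hence u': "nonconst u" using nc_u not_both_const by (auto simp: u_def v_def)
      from one_constant_absurd[OF u_nice u' mult_u[OF u'] n a b disc S' c] share_S show ?thesis by (simp add: u_def v_def)
    qed
  next
    case False
    hence nc: "nonconst u" "nonconst v" using nc_u nc_v by auto
    interpret sharing_pair n a b u v
    proof
      show "min (nat (zorder u z)) 2 = min (nat (zorder v z)) 2" for z
        using fun_cong[OF share_0, of z] weighted_preimage_zero[OF nc(1), of z] weighted_preimage_zero[OF nc(2), of z]
        by (simp add: u_def v_def)
      show "min (nat (zorder (\<lambda>z. pow_shift n a u z + b) z)) 3 = min (nat (zorder (\<lambda>z. pow_shift n a v z + b) z)) 3" for z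
        using fun_cong[OF share_S, of z] weighted_preimage_roots[OF u_nice nc(1) n2 a b disc S', of z]
          weighted_preimage_roots[OF v_nice nc(2) n2 a b disc S', of z]
        by (simp add: u_def v_def)
    qed (use n a b nc mult_u mult_v in auto)
    show ?thesis
      using nicely_meromorphic_eqI[OF u_nice v_nice u_eq_v] by (simp add: u_def v_def)
  qed
qed

end
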